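(* Let $(M,F)$ be a Finsler manifold and let $I\subset\mathbb{R}$ be a bounded closed interval. Then $$\mathsf{NAC}(I;M)=\mathsf{MAC}(I;M)=\mathsf{AC}(I;M)=\mathsf{FAC}(I;M)=\mathsf{BAC}(I;M).$$
   Context: A Finsler manifold $(M,F)$ is a connected smooth manifold $M$ without boundary of dimension $n\ge 2$ with a continuous function $F:TM\to[0,\infty)$ such that (a) $F\in C^\infty(TM\setminus\{0\})$; (b) $F(x,\lambda y)=\lambda F(x,y)$ for all $\lambda\ge 0$, $(x,y)\in TM$; (c) the matrix $g_{ij}(x,y)=[\frac12F^2]_{y^iy^j}(x,y)$ is positive definite for $y\neq 0$. $F(x,-y)=F(x,y)$ is not assumed, and no completeness is assumed. The (generally non-symmetric) distance is $d_F(p,q)=\inf\int_0^1F(\gamma'(t))\,dt$ over piecewise smooth curves $\gamma:[0,1]\to M$ from $p$ to $q$. Curve classes, for an interval $I$: - $\mathsf{FAC}(I;M)$: maps $\gamma:I\to M$ for which there is a nonnegative $f\in L^1(I)$ with $d_F(\gamma(t_1),\gamma(t_2))\le\int_{t_1}^{t_2}f(s)\,ds$ for all $t_1\le t_2$ in $I$. - $\mathsf{BAC}(I;M)$: maps $\gamma:I\to M$ for which there is a nonnegative $f\in L^1(I)$ with $d_F(\gamma(t_2),\gamma(t_1))\le\int_{t_1}^{t_2}f(s)\,ds$ for all $t_1\le t_2$ in $I$. - $\mathsf{AC}(I;M)=\mathsf{FAC}(I;M)\cap\mathsf{BAC}(I;M)$. - $\mathsf{NAC}(I;M)$ (naturally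 absolutely continuous): continuous curves $\gamma:I\to M$ such that for every chart $(U,\varphi)$ of $M$ the composition $\varphi\circ\gamma:\gamma^{-1}(\gamma(I)\cap U)\to\varphi(U)\subset\mathbb{R}^n$ is locally absolutely continuous, i.e. absolutely continuous on all bounded closed subintervals of $\gamma^{-1}(\gamma(I)\cap U)$. - $\mathsf{MAC}(I;M)$ (metric absolutely continuous): curves $\gamma:I\to M$ such that for all $\varepsilon>0$ there is $\delta>0$ with $\sum_{i=1}^n d_F(\gamma(a_i),\gamma(b_i))<\varepsilon$ whenever $\{(a_i,b_i)\}_{i=1}^n$ are (finitely many) nonoverlapping subintervals of $I$ with $\sum_{i=1}^n(b_i-a_i)<\delta$. *)

theory Defs
  imports "HOL-Analysis.Analysis"
begin

section \<open>Smooth maps between open subsets of normed spaces\<close>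

text \<open>
  Only meant for open \<open>S\<close>. On finite-dimensional domains, continuity of all directional
  derivatives of order at most \<open>k\<close> is the usual notion of class \<open>C\<^sup>k\<close>.
\<close>

primrec Ck_on ::
  "nat \<Rightarrow> 'a::real_normed_vector set \<Rightarrow> ('a \<Rightarrow> 'b::real_normed_vector) \<Rightarrow> bool" where
  "Ck_on 0 S f \<longleftrightarrow> continuous_on S f"
| "Ck_on (Suc k) S f \<longleftrightarrow>
     (\<forall>x\<in>S. f differentiable (at x)) \<and>
     (\<forall>v. Ck_on k S (\<lambda>x. frechet_derivative f (at x) v))"

definition smooth_on ::
  "'a::real_normed_vector set \<Rightarrow> ('a \<Rightarrow> 'b::real_normed_vector) \<Rightarrow> bool" where
  "smooth_on S f \<longleftrightarrow> (\<forall>k. Ck_on k S f)"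


section \<open>Smooth manifolds\<close>

text \<open>A chart \<open>(U, \<phi>)\<close>; the values of \<open>\<phi>\<close> outside \<open>U\<close> are irrelevant.\<close>

type_synonym ('a, 'n) chart = "'a set \<times> ('a \<Rightarrow> real ^ 'n)"

definition chart_of :: "'a topology \<Rightarrow> ('a, 'n::finite) chart \<Rightarrow> bool" where
  "chart_of X c \<longleftrightarrow>
     openin X (fst c) \<and> open (snd c ` fst c) \<and>
     homeomorphic_map (subtopology X (fst c)) (top_of_set (snd c ` fst c)) (snd c)"

definition chart_inv :: "('a, 'n::finite) chart \<Rightarrow> real ^ 'n \<Rightarrow> 'a" where
  "chart_inv c = inv_into (fst c) (snd c)"

definition coord_change ::
  "('a, 'n::finite) chart \<Rightarrow> ('a, 'n) chart \<Rightarrow> real ^ 'n \<Rightarrow> real ^ 'n" where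
  "coord_change c d = snd d \<circ> chart_inv c"

definition smoothly_compatible ::
  "('a, 'n::finite) chart \<Rightarrow> ('a, 'n) chart \<Rightarrow> bool" where
  "smoothly_compatible c d \<longleftrightarrow>
     smooth_on (snd c ` (fst c \<inter> fst d)) (coord_change c d) \<and>
     smooth_on (snd d ` (fst c \<inter> fst d)) (coord_change d c)"

text \<open>
  \<open>A\<close> is the whole smooth structure (a maximal smooth atlas), so the charts of the manifold
  are exactly the elements of \<open>A\<close>. Charts have open images in \<open>\<real>\<^sup>n\<close>, hence no boundary.
\<close>

locale smooth_manifold =
  fixes X :: "'a topology" and A :: "('a, 'n::finite) chart set"
  assumes Hausdorff: "Hausdorff_space X"
    and second_countable: "second_countable X"
    and charts: "c \<in> A \<Longrightarrow> chart_of X c"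
    and cover: "(\<Union>c\<in>A. fst c) = topspace X"
    and compatible: "c \<in> A \<Longrightarrow> d \<in> A \<Longrightarrow> smoothly_compatible c d"
    and maximal: "chart_of X c \<Longrightarrow> (\<And>d. d \<in> A \<Longrightarrow> smoothly_compatible c d) \<Longrightarrow> c \<in> A"


section \<open>The tangent bundle\<close>

text \<open>
  A tangent vector at \<open>p\<close> is the family of its component vectors in all the charts around
  \<open>p\<close>, related by the Jacobians of the coordinate changes.
\<close>

type_synonym ('a, 'n) tvec = "('a, 'n) chart \<Rightarrow> real ^ 'n"

definition charts_at :: "('a, 'n::finite) chart set \<Rightarrow> 'a \<Rightarrow> ('a, 'n) chart set" where
  "charts_at A p = {c \<in> A. p \<in> fst c}"

definition tangent_space :: "('a, 'n::finite) chart set \<Rightarrow> 'a \<Rightarrow> ('a, 'n) tvec set" where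
  "tangent_space A p =
     {v \<in> charts_at A p \<rightarrow>\<^sub>E UNIV.
        \<forall>c\<in>charts_at A p. \<forall>d\<in>charts_at A p.
          v d = frechet_derivative (coord_change c d) (at (snd c p)) (v c)}"

definition tangent_bundle ::
  "'a topology \<Rightarrow> ('a, 'n::finite) chart set \<Rightarrow> ('a \<times> ('a, 'n) tvec) set" where
  "tangent_bundle X A = Sigma (topspace X) (tangent_space A)"

definition tscale ::
  "('a, 'n::finite) chart set \<Rightarrow> 'a \<Rightarrow> real \<Rightarrow> ('a, 'n) tvec \<Rightarrow> ('a, 'n) tvec" where
  "tscale A p r v = (\<lambda>c\<in>charts_at A p. r *\<^sub>R v c)"

text \<open>The tangent vector at \<open>p\<close> whose components in the chart \<open>c\<close> are \<open>y\<close>, that is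
  \<open>y\<^sup>i \<partial>/\<partial>x\<^sup>i\<close> at \<open>p\<close>.\<close>

definition tvec_of ::
  "('a, 'n::finite) chart set \<Rightarrow> ('a, 'n) chart \<Rightarrow> 'a \<Rightarrow> real ^ 'n \<Rightarrow> ('a, 'n) tvec" where
  "tvec_of A c p y =
     (\<lambda>d\<in>charts_at A p. frechet_derivative (coord_change c d) (at (snd c p)) y)"


section \<open>Finsler manifolds\<close>

text \<open>
  The local expression \<open>F(x, y)\<close> of \<open>F\<close> in the chart \<open>c\<close>, for \<open>x \<in> \<phi>(U)\<close> and
  \<open>y \<in> \<real>\<^sup>n\<close>. The maps \<open>(p, v) \<mapsto> (\<phi> p, v c)\<close> are the charts that define the topology
  and the smooth structure of the tangent bundle, so continuity and smoothness of \<open>F\<close> are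
  those of its local expressions.
\<close>

definition local_expr ::
  "('a, 'n::finite) chart set \<Rightarrow> ('a \<times> ('a, 'n) tvec \<Rightarrow> real) \<Rightarrow> ('a, 'n) chart
    \<Rightarrow> (real ^ 'n) \<times> (real ^ 'n) \<Rightarrow> real" where
  "local_expr A F c = (\<lambda>(x, y). F (chart_inv c x, tvec_of A c (chart_inv c x) y))"

definition partial_deriv ::
  "'n::finite \<Rightarrow> (real ^ 'n \<Rightarrow> real) \<Rightarrow> real ^ 'n \<Rightarrow> real" where
  "partial_deriv i f y = frechet_derivative f (at y) (axis i 1)"

definition fundamental_tensor ::
  "('a, 'n::finite) chart set \<Rightarrow> ('a \<times> ('a, 'n) tvec \<Rightarrow> real) \<Rightarrow> ('a, 'n) chart
    \<Rightarrow> real ^ 'n \<Rightarrow> real ^ 'n \<Rightarrow> real ^ 'n ^ 'n" where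
  "fundamental_tensor A F c x y =
     (\<chi> i j. partial_deriv j (partial_deriv i (\<lambda>z. 1/2 * (local_expr A F c (x, z))\<^sup>2)) y)"

definition positive_definite :: "real ^ 'n ^ 'n::finite \<Rightarrow> bool" where
  "positive_definite G \<longleftrightarrow> (\<forall>w. w \<noteq> 0 \<longrightarrow> w \<bullet> (G *v w) > 0)"

locale finsler_manifold = smooth_manifold X A
  for X :: "'a topology" and A :: "('a, 'n::finite) chart set" +
  fixes F :: "'a \<times> ('a, 'n) tvec \<Rightarrow> real"
  assumes connected: "connected_space X"
    and dim: "CARD('n) \<ge> 2"
    and nonneg: "(p, v) \<in> tangent_bundle X A \<Longrightarrow> F (p, v) \<ge> 0"
    and continuous: "c \<in> A \<Longrightarrow> continuous_on ((snd c ` fst c) \<times> UNIV) (local_expr A F c)"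
    and smooth: "c \<in> A \<Longrightarrow> smooth_on ((snd c ` fst c) \<times> (UNIV - {0})) (local_expr A F c)"
    and homogeneous:
      "(p, v) \<in> tangent_bundle X A \<Longrightarrow> r \<ge> 0 \<Longrightarrow> F (p, tscale A p r v) = r * F (p, v)"
    and pos_def:
      "c \<in> A \<Longrightarrow> x \<in> snd c ` fst c \<Longrightarrow> y \<noteq> 0 \<Longrightarrow>
         positive_definite (fundamental_tensor A F c x y)"


section \<open>The Finsler distance\<close>

text \<open>
  Smoothness of a curve on a (closed) interval \<open>J\<close>: near each point of \<open>J\<close> the curve has, in
  some chart, a smooth extension to an open interval.
\<close>

definition smooth_curve_on ::
  "('a, 'n::finite) chart set \<Rightarrow> real set \<Rightarrow> (real \<Rightarrow> 'a) \<Rightarrow> bool" where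
  "smooth_curve_on A J \<gamma> \<longleftrightarrow>
     (\<forall>u\<in>J. \<exists>c\<in>A. \<exists>e>0. \<exists>g. smooth_on {u - e<..<u + e} g \<and>
        (\<forall>r \<in> J \<inter> {u - e<..<u + e}. \<gamma> r \<in> fst c \<and> snd c (\<gamma> r) = g r))"

definition piecewise_smooth_path ::
  "'a topology \<Rightarrow> ('a, 'n::finite) chart set \<Rightarrow> (real \<Rightarrow> 'a) \<Rightarrow> bool" where
  "piecewise_smooth_path X A \<gamma> \<longleftrightarrow>
     pathin X \<gamma> \<and>
     (\<exists>m. \<exists>\<tau>::nat \<Rightarrow> real. \<tau> 0 = 0 \<and> \<tau> m = 1 \<and>
        (\<forall>i<m. \<tau> i < \<tau> (Suc i) \<and> smooth_curve_on A {\<tau> i..\<tau> (Suc i)} \<gamma>))"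

text \<open>
  At the finitely many break points and at the endpoints this may be junk, which does not
  affect the length integral.
\<close>

definition velocity ::
  "('a, 'n::finite) chart set \<Rightarrow> (real \<Rightarrow> 'a) \<Rightarrow> real \<Rightarrow> ('a, 'n) tvec" where
  "velocity A \<gamma> t = (\<lambda>c\<in>charts_at A (\<gamma> t). vector_derivative (snd c \<circ> \<gamma>) (at t))"

definition finsler_length ::
  "('a, 'n::finite) chart set \<Rightarrow> ('a \<times> ('a, 'n) tvec \<Rightarrow> real) \<Rightarrow> (real \<Rightarrow> 'a) \<Rightarrow> real" where
  "finsler_length A F \<gamma> = integral {0..1} (\<lambda>t. F (\<gamma> t, velocity A \<gamma> t))"

definition finsler_dist ::
  "'a topology \<Rightarrow> ('a, 'n::finite) chart set \<Rightarrow> ('a \<times> ('a, 'n) tvec \<Rightarrow> real)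
    \<Rightarrow> 'a \<Rightarrow> 'a \<Rightarrow> real" where
  "finsler_dist X A F p q =
     Inf {finsler_length A F \<gamma> | \<gamma>. piecewise_smooth_path X A \<gamma> \<and> \<gamma> 0 = p \<and> \<gamma> 1 = q}"


section \<open>Classes of absolutely continuous curves\<close>

text \<open>Maps \<open>I \<rightarrow> M\<close> are the extensional functions on \<open>I\<close>, so that equality of classes of
  maps is equality of sets.\<close>

definition FAC ::
  "'a topology \<Rightarrow> ('a, 'n::finite) chart set \<Rightarrow> ('a \<times> ('a, 'n) tvec \<Rightarrow> real)
    \<Rightarrow> real set \<Rightarrow> (real \<Rightarrow> 'a) set" where
  "FAC X A F I =
     {\<gamma> \<in> I \<rightarrow>\<^sub>E topspace X.
        \<exists>f::real \<Rightarrow> real. f absolutely_integrable_on I \<and> (\<forall>s\<in>I. 0 \<le> f s) \<and>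
          (\<forall>t\<^sub>1\<in>I. \<forall>t\<^sub>2\<in>I. t\<^sub>1 \<le> t\<^sub>2 \<longrightarrow>
             finsler_dist X A F (\<gamma> t\<^sub>1) (\<gamma> t\<^sub>2) \<le> integral {t\<^sub>1..t\<^sub>2} f)}"

definition BAC ::
  "'a topology \<Rightarrow> ('a, 'n::finite) chart set \<Rightarrow> ('a \<times> ('a, 'n) tvec \<Rightarrow> real)
    \<Rightarrow> real set \<Rightarrow> (real \<Rightarrow> 'a) set" where
  "BAC X A F I =
     {\<gamma> \<in> I \<rightarrow>\<^sub>E topspace X.
        \<exists>f::real \<Rightarrow> real. f absolutely_integrable_on I \<and> (\<forall>s\<in>I. 0 \<le> f s) \<and>
          (\<forall>t\<^sub>1\<in>I. \<forall>t\<^sub>2\<in>I. t\<^sub>1 \<le> t\<^sub>2 \<longrightarrow>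
             finsler_dist X A F (\<gamma> t\<^sub>2) (\<gamma> t\<^sub>1) \<le> integral {t\<^sub>1..t\<^sub>2} f)}"

definition AC ::
  "'a topology \<Rightarrow> ('a, 'n::finite) chart set \<Rightarrow> ('a \<times> ('a, 'n) tvec \<Rightarrow> real)
    \<Rightarrow> real set \<Rightarrow> (real \<Rightarrow> 'a) set" where
  "AC X A F I = FAC X A F I \<inter> BAC X A F I"

text \<open>
  The \<open>\<epsilon>\<close>-\<open>\<delta>\<close> condition of absolute continuity with respect to a possibly non-symmetric
  distance function \<open>d\<close>. Nonoverlapping means that the open intervals are disjoint.
\<close>

definition abs_cont_wrt ::
  "('b \<Rightarrow> 'b \<Rightarrow> real) \<Rightarrow> real set \<Rightarrow> (real \<Rightarrow> 'b) \<Rightarrow> bool" where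
  "abs_cont_wrt d I f \<longleftrightarrow>
     (\<forall>\<epsilon>>0. \<exists>\<delta>>0. \<forall>(k::nat) (a::nat \<Rightarrow> real) b.
        (\<forall>i<k. a i < b i \<and> a i \<in> I \<and> b i \<in> I) \<longrightarrow>
        (\<forall>i<k. \<forall>j<k. i \<noteq> j \<longrightarrow> {a i<..<b i} \<inter> {a j<..<b j} = {}) \<longrightarrow>
        (\<Sum>i<k. b i - a i) < \<delta> \<longrightarrow>
        (\<Sum>i<k. d (f (a i)) (f (b i))) < \<epsilon>)"

definition MAC ::
  "'a topology \<Rightarrow> ('a, 'n::finite) chart set \<Rightarrow> ('a \<times> ('a, 'n) tvec \<Rightarrow> real)
    \<Rightarrow> real set \<Rightarrow> (real \<Rightarrow> 'a) set" where
  "MAC X A F I = {\<gamma> \<in> I \<rightarrow>\<^sub>E topspace X. abs_cont_wrt (finsler_dist X A F) I \<gamma>}"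

definition NAC ::
  "'a topology \<Rightarrow> ('a, 'n::finite) chart set \<Rightarrow> real set \<Rightarrow> (real \<Rightarrow> 'a) set" where
  "NAC X A I =
     {\<gamma> \<in> I \<rightarrow>\<^sub>E topspace X.
        continuous_map (top_of_set I) X \<gamma> \<and>
        (\<forall>c\<in>A. \<forall>s t. {s..t} \<subseteq> {r \<in> I. \<gamma> r \<in> fst c} \<longrightarrow>
           abs_cont_wrt dist {s..t} (snd c \<circ> \<gamma>))}"

end

theory Submission
  imports Defs
begin

text \<open>
  For any non-symmetric distance, the \<open>\<epsilon>\<close>-\<open>\<delta>\<close> condition of absolute continuity is equivalent to
  a bound of the distance by the integral of an integrable function: the variation of the curve is
  an absolutely continuous monotone function, hence has a density by the Radon--Nikodym theorem.
  This gives the equality of the metric classes with the classes defined by such bounds. In a chart,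
  \<open>F\<close> lies between two multiples of the Euclidean norm over a compact set of base points, since \<open>F\<close>
  is positive by Euler's theorem. So the Finsler distance, its reverse and the coordinate distance
  are locally equivalent. Having an integrable bound is a local property of a continuous curve, so
  it does not matter which of the three distances is used.
\<close>

section \<open>Absolutely continuous curves for a non-symmetric distance\<close>

text \<open>Three obstacles shape the proof. A curve in a space that carries only a distance has no
  derivative from which a speed could be read off; the speed is therefore extracted from a real
  function, the variation of the curve. Next, a bound on \<open>dF (\<gamma> u) (\<gamma> v)\<close>
  for \<open>u \<le> v\<close> says nothing directly about
  \<open>dF (\<gamma> v) (\<gamma> u)\<close>, and continuity of the curve is not part of the metric
  definitions. Continuity has to be derived first, from bounds in one direction of time only,
  because the comparison constants belong to a small coordinate ball and are useful only while the
  curve stays in it. Finally, \<open>dF\<close> is an infimum over paths in the whole manifold.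
  Comparing it from below with coordinates requires that a short path starting or ending near a
  point cannot leave a coordinate ball; this rests on compact balls in charts and on the Hausdorff
  property. Constants of different charts are never compared with each other: compactness of the
  interval enters as a bisection argument for integrable bounds, which are additive in time.\<close>

definition nonoverlapping :: "(real \<times> real) set \<Rightarrow> bool" where
  "nonoverlapping K \<longleftrightarrow>
     (\<forall>p\<in>K. fst p < snd p) \<and>
     (\<forall>p\<in>K. \<forall>q\<in>K. p \<noteq> q \<longrightarrow> {fst p<..<snd p} \<inter> {fst q<..<snd q} = {})"

lemma nonoverlappingD:
  assumes "nonoverlapping K"
  shows "p \<in> K \<Longrightarrow> fst p < snd p"
    and "p \<in> K \<Longrightarrow> q \<in> K \<Longrightarrow> p \<noteq> q \<Longrightarrow> {fst p<..<snd p} \<inter> {fst q<..<snd q} = {}"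
  using assms unfolding nonoverlapping_def by blast+

text \<open>Finite sets of pairs replace indexed families, so that the intervals of several
  subdivisions can be merged by a union. Nothing is lost, since nonoverlapping nondegenerate
  intervals with different indices are different pairs.\<close>

lemma abs_cont_wrt_iff_nonoverlapping:
  "abs_cont_wrt d I f \<longleftrightarrow>
     (\<forall>\<epsilon>>0. \<exists>\<delta>>0. \<forall>K. finite K \<longrightarrow> nonoverlapping K \<longrightarrow> K \<subseteq> I \<times> I \<longrightarrow>
        (\<Sum>p\<in>K. snd p - fst p) < \<delta> \<longrightarrow> (\<Sum>p\<in>K. d (f (fst p)) (f (snd p))) < \<epsilon>)"
  (is "?L = ?R")
proof
  assume L: ?L
  show ?R
  proof (intro allI impI)
    fix \<epsilon> :: real assume "\<epsilon> > 0"
    from L[unfolded abs_cont_wrt_def, THEN spec, THEN mp, OF this]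
    obtain \<delta> where "\<delta> > 0" and \<delta>: "\<forall>(k::nat) a b.
        (\<forall>i<k. a i < b i \<and> a i \<in> I \<and> b i \<in> I) \<longrightarrow>
        (\<forall>i<k. \<forall>j<k. i \<noteq> j \<longrightarrow> {a i<..<b i} \<inter> {a j<..<b j} = {}) \<longrightarrow>
        (\<Sum>i<k. b i - a i) < \<delta> \<longrightarrow> (\<Sum>i<k. d (f (a i)) (f (b i))) < \<epsilon>"
      by (elim exE conjE)
    have "(\<Sum>p\<in>K. d (f (fst p)) (f (snd p))) < \<epsilon>"
      if K: "finite K" "nonoverlapping K" "K \<subseteq> I \<times> I" "(\<Sum>p\<in>K. snd p - fst p) < \<delta>" for K
    proof -
      obtain h where h: "bij_betw h {..<card K} K"
        using K(1) ex_bij_betw_nat_finite lessThan_atLeast0 by metis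
      have hK: "h i \<in> K" if "i < card K" for i
        using h that by (auto simp: bij_betw_def)
      have "h i \<noteq> h j" if "i < card K" "j < card K" "i \<noteq> j" for i j
        using h that by (auto simp: bij_betw_def inj_on_def)
      moreover have "(\<Sum>i<card K. snd (h i) - fst (h i)) < \<delta>"
        using sum.reindex_bij_betw[OF h, of "\<lambda>p. snd p - fst p"] K(4) by simp
      ultimately have "(\<Sum>i<card K. d (f (fst (h i))) (f (snd (h i)))) < \<epsilon>"
        using hK subsetD[OF K(3) hK] nonoverlappingD[OF K(2)]
        by (intro \<delta>[rule_format, of "card K" "\<lambda>i. fst (h i)" "\<lambda>i. snd (h i)"])
          (auto simp: mem_Times_iff)
      then show ?thesis
        using sum.reindex_bij_betw[OF h, of "\<lambda>p. d (f (fst p)) (f (snd p))"] by simp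
    qed
    then show "\<exists>\<delta>>0. \<forall>K. finite K \<longrightarrow> nonoverlapping K \<longrightarrow> K \<subseteq> I \<times> I \<longrightarrow>
        (\<Sum>p\<in>K. snd p - fst p) < \<delta> \<longrightarrow> (\<Sum>p\<in>K. d (f (fst p)) (f (snd p))) < \<epsilon>"
      by (intro exI[of _ \<delta>] conjI allI impI \<open>\<delta> > 0\<close>)
  qed
next
  assume R: ?R
  show ?L
    unfolding abs_cont_wrt_def
  proof (intro allI impI)
    fix \<epsilon> :: real assume "\<epsilon> > 0"
    from R[THEN spec, THEN mp, OF this]
    obtain \<delta> where "\<delta> > 0" and \<delta>: "\<forall>K. finite K \<longrightarrow> nonoverlapping K \<longrightarrow>
        K \<subseteq> I \<times> I \<longrightarrow> (\<Sum>p\<in>K. snd p - fst p) < \<delta> \<longrightarrow>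
        (\<Sum>p\<in>K. d (f (fst p)) (f (snd p))) < \<epsilon>"
      by (elim exE conjE)
    have "(\<Sum>i<k. d (f (a i)) (f (b i))) < \<epsilon>"
      if I: "\<forall>i<k. a i < b i \<and> a i \<in> I \<and> b i \<in> I"
       and disj: "\<forall>i<k. \<forall>j<k. i \<noteq> j \<longrightarrow> {a i<..<b i} \<inter> {a j<..<b j} = {}"
       and len: "(\<Sum>i<k. b i - a i) < \<delta>" for k :: nat and a b
    proof -
      let ?h = "\<lambda>i. (a i, b i)"
      have inj: "inj_on ?h {..<k}"
      proof (rule inj_onI)
        fix i j assume "i \<in> {..<k}" "j \<in> {..<k}" and eq: "?h i = ?h j"
        \<comment> \<open>Equal pairs at two indices would share this midpoint, against
          disjointness.\<close>
        moreover have "(a i + b i) / 2 \<in> {a i<..<b i}" using I \<open>i \<in> {..<k}\<close> by auto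
        ultimately show "i = j"
          using disj by (metis Int_iff empty_iff lessThan_iff prod.inject)
      qed
      have "nonoverlapping (?h ` {..<k})"
        unfolding nonoverlapping_def using I disj by auto
      moreover have "?h ` {..<k} \<subseteq> I \<times> I" using I by auto
      moreover have "(\<Sum>p\<in>?h ` {..<k}. snd p - fst p) < \<delta>"
        using len by (simp add: sum.reindex[OF inj])
      ultimately have "(\<Sum>p\<in>?h ` {..<k}. d (f (fst p)) (f (snd p))) < \<epsilon>"
        by (intro \<delta>[rule_format]) auto
      then show ?thesis by (simp add: sum.reindex[OF inj])
    qed
    then show "\<exists>\<delta>>0. \<forall>(k::nat) a b.
        (\<forall>i<k. a i < b i \<and> a i \<in> I \<and> b i \<in> I) \<longrightarrow>
        (\<forall>i<k. \<forall>j<k. i \<noteq> j \<longrightarrow> {a i<..<b i} \<inter> {a j<..<b j} = {}) \<longrightarrow>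
        (\<Sum>i<k. b i - a i) < \<delta> \<longrightarrow> (\<Sum>i<k. d (f (a i)) (f (b i))) < \<epsilon>"
      by (intro exI[of _ \<delta>] conjI allI impI \<open>\<delta> > 0\<close>)
  qed
qed

text \<open>Each point lies in at most one of the open intervals, so the sum of the cut-off
  functions is pointwise at most \<open>h\<close>. The cut-off uses open intervals because
  neighbouring closed ones may share an endpoint.\<close>

lemma sum_integral_nonoverlapping_le:
  fixes h :: "real \<Rightarrow> real"
  assumes h: "h integrable_on {s..t}" "\<And>x. x \<in> {s..t} \<Longrightarrow> 0 \<le> h x"
    and K: "finite K" "nonoverlapping K" "K \<subseteq> {s..t} \<times> {s..t}"
  shows "(\<Sum>p\<in>K. integral {fst p..snd p} h) \<le> integral {s..t} h"
proof -
  let ?J = "\<lambda>p::real\<times>real. {fst p<..<snd p}"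
  have sub: "?J p \<subseteq> {s..t}" "{fst p..snd p} \<subseteq> {s..t}" if "p \<in> K" for p
    using subsetD[OF K(3) that] by (auto simp: mem_Times_iff)
  have int: "h integrable_on ?J p" if "p \<in> K" for p
    using integrable_on_subinterval[OF h(1) sub(2)[OF that]]
    by (simp add: integrable_on_open_interval_real)
  have int': "(\<lambda>x. if x \<in> ?J p then h x else 0) integrable_on {s..t}" if "p \<in> K" for p
    using int[OF that] sub(1)[OF that]
    by (subst integrable_restrict_Int) (simp add: Int_absorb2)
  have "integral {fst p..snd p} h = integral {s..t} (\<lambda>x. if x \<in> ?J p then h x else 0)"
    if "p \<in> K" for p
    using sub(1)[OF that]
    by (subst integral_restrict_Int) (simp add: Int_absorb1 Int_absorb2 integral_open_interval_real)
  then have "(\<Sum>p\<in>K. integral {fst p..snd p} h) =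
      integral {s..t} (\<lambda>x. \<Sum>p\<in>K. if x \<in> ?J p then h x else 0)"
    using int' by (subst integral_sum) (auto simp: K(1))
  also have "\<dots> \<le> integral {s..t} h"
  proof (rule integral_le)
    show "(\<lambda>x. \<Sum>p\<in>K. if x \<in> ?J p then h x else 0) integrable_on {s..t}"
      using int' by (intro integrable_sum K)
    fix x assume x: "x \<in> {s..t}"
    show "(\<Sum>p\<in>K. if x \<in> ?J p then h x else 0) \<le> h x"
    proof (cases "\<exists>q\<in>K. x \<in> ?J q")
      case True
      then obtain q where q: "q \<in> K" "x \<in> ?J q" by blast
      have "x \<notin> ?J p" if "p \<in> K" "p \<noteq> q" for p
        using nonoverlappingD(2)[OF K(2) q(1) that(1)] q(2) that(2) by blast
      then have "(\<Sum>p\<in>K. if x \<in> ?J p then h x else 0) = (\<Sum>p\<in>K. if p = q then h x else 0)"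
        using q(2) by (intro sum.cong refl) metis
      also have "\<dots> = h x" using q K(1) by simp
      finally show ?thesis by simp
    next
      case False
      then have "(\<Sum>p\<in>K. if x \<in> ?J p then h x else 0) = 0" by (intro sum.neutral) auto
      then show ?thesis using h(2)[OF x] by simp
    qed
  qed (use h in auto)
  finally show ?thesis .
qed

text \<open>Only pairs in temporal order occur; bounds in the opposite direction are expressed by
  swapping the arguments of \<open>d\<close>. For nonnegative \<open>f\<close>, plain integrability
  already gives absolute integrability.\<close>

definition has_speed_bound ::
  "('b \<Rightarrow> 'b \<Rightarrow> real) \<Rightarrow> (real \<Rightarrow> 'b) \<Rightarrow> real \<Rightarrow> real \<Rightarrow> bool" where
  "has_speed_bound d \<gamma> s t \<longleftrightarrow>
     (\<exists>f. f integrable_on {s..t} \<and> (\<forall>x\<in>{s..t}. 0 \<le> f x) \<and>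
        (\<forall>u v. s \<le> u \<longrightarrow> u \<le> v \<longrightarrow> v \<le> t \<longrightarrow> d (\<gamma> u) (\<gamma> v) \<le> integral {u..v} f))"

text \<open>Absolute continuity of the integral, by truncation: by dominated convergence
  \<open>f - min f N\<close> has a small integral over the whole interval for large
  \<open>N\<close>, while \<open>min f N\<close> contributes at most \<open>N\<close> times the
  total length.\<close>

lemma has_speed_bound_imp_abs_cont_wrt:
  assumes "has_speed_bound d \<gamma> s t"
  shows "abs_cont_wrt d {s..t} \<gamma>"
  unfolding abs_cont_wrt_iff_nonoverlapping
proof (intro allI impI)
  fix \<epsilon> :: real assume e: "\<epsilon> > 0"
  obtain f where f: "f integrable_on {s..t}" "\<And>x. x \<in> {s..t} \<Longrightarrow> 0 \<le> f x"
    and d: "\<And>u v. \<lbrakk>s \<le> u; u \<le> v; v \<le> t\<rbrakk> \<Longrightarrow> d (\<gamma> u) (\<gamma> v) \<le> integral {u..v} f"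
    using assms unfolding has_speed_bound_def by blast
  have fa: "f absolutely_integrable_on {s..t}"
    using f by (rule nonnegative_absolutely_integrable_1)
  let ?m = "\<lambda>(N::nat) x. min (f x) (real N)"
  have m: "?m N integrable_on {s..t}" for N
  proof -
    have "?m N absolutely_integrable_on {s..t}"
      by (intro absolutely_integrable_min_1 fa) auto
    then show ?thesis by (rule set_lebesgue_integral_eq_integral)
  qed
  have "(\<lambda>N. integral {s..t} (?m N)) \<longlonglongrightarrow> integral {s..t} f"
  proof (rule dominated_convergence(2)[OF m f(1)])
    show "norm (?m N x) \<le> f x" if "x \<in> {s..t}" for N x using f(2)[OF that] by auto
    show "(\<lambda>N. ?m N x) \<longlonglongrightarrow> f x" if "x \<in> {s..t}" for x
    proof (rule tendsto_eventually)
      obtain N0 :: nat where "f x \<le> real N0" using real_arch_simple by blast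
      then show "\<forall>\<^sub>F N in sequentially. ?m N x = f x"
        by (auto simp: eventually_sequentially intro!: exI[of _ N0])
    qed
  qed
  then have "\<forall>\<^sub>F N in sequentially. dist (integral {s..t} (?m N)) (integral {s..t} f) < \<epsilon> / 2"
    using e by (intro tendstoD) auto
  then obtain N where N: "dist (integral {s..t} (?m N)) (integral {s..t} f) < \<epsilon> / 2"
    by (auto simp: eventually_sequentially)
  show "\<exists>\<delta>>0. \<forall>K. finite K \<longrightarrow> nonoverlapping K \<longrightarrow> K \<subseteq> {s..t} \<times> {s..t} \<longrightarrow>
        (\<Sum>p\<in>K. snd p - fst p) < \<delta> \<longrightarrow> (\<Sum>p\<in>K. d (\<gamma> (fst p)) (\<gamma> (snd p))) < \<epsilon>"
  \<comment> \<open>With this \<delta> the truncated part contributes at most \<epsilon>/2; the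
    summand 1 covers \<open>N = 0\<close>.\<close>
  proof (intro exI[of _ "\<epsilon> / (2 * (real N + 1))"] conjI allI impI)
    show "0 < \<epsilon> / (2 * (real N + 1))" using e by simp
    fix K assume K: "finite K" "nonoverlapping K" "K \<subseteq> {s..t} \<times> {s..t}"
      and len: "(\<Sum>p\<in>K. snd p - fst p) < \<epsilon> / (2 * (real N + 1))"
    have sub: "{fst p..snd p} \<subseteq> {s..t}" if "p \<in> K" for p
      using subsetD[OF K(3) that] by (auto simp: mem_Times_iff)
    have "(\<Sum>p\<in>K. d (\<gamma> (fst p)) (\<gamma> (snd p))) \<le> (\<Sum>p\<in>K. integral {fst p..snd p} f)"
      using subsetD[OF K(3)] nonoverlappingD(1)[OF K(2)]
      by (intro sum_mono d) (auto simp: less_imp_le mem_Times_iff)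
    also have "\<dots> \<le> (\<Sum>p\<in>K. integral {fst p..snd p} (\<lambda>x. f x - ?m N x) + real N * (snd p - fst p))"
    proof (intro sum_mono)
      fix p assume p: "p \<in> K"
      note le = nonoverlappingD(1)[OF K(2) p]
      have i: "f integrable_on {fst p..snd p}" "?m N integrable_on {fst p..snd p}"
        using integrable_on_subinterval[OF f(1) sub[OF p]] integrable_on_subinterval[OF m sub[OF p]]
        by auto
      have "integral {fst p..snd p} f =
          integral {fst p..snd p} (\<lambda>x. f x - ?m N x) + integral {fst p..snd p} (?m N)"
        using i by (simp add: integral_diff)
      also have "integral {fst p..snd p} (?m N) \<le> integral {fst p..snd p} (\<lambda>x. real N)"
        using i by (intro integral_le) auto
      also have "\<dots> = real N * (snd p - fst p)" using le by (simp add: mult.commute)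
      finally show "integral {fst p..snd p} f
          \<le> integral {fst p..snd p} (\<lambda>x. f x - ?m N x) + real N * (snd p - fst p)" by simp
    qed
    also have "\<dots> = (\<Sum>p\<in>K. integral {fst p..snd p} (\<lambda>x. f x - ?m N x))
        + real N * (\<Sum>p\<in>K. snd p - fst p)"
      by (simp add: sum.distrib sum_distrib_left)
    also have "(\<Sum>p\<in>K. integral {fst p..snd p} (\<lambda>x. f x - ?m N x))
        \<le> integral {s..t} (\<lambda>x. f x - ?m N x)"
      using m f(1) K by (intro sum_integral_nonoverlapping_le integrable_diff) auto
    also have "\<dots> = integral {s..t} f - integral {s..t} (?m N)"
      using m f(1) by (intro integral_diff)
    also have "\<dots> < \<epsilon> / 2" using N unfolding dist_real_def by linarith
    also have "real N * (\<Sum>p\<in>K. snd p - fst p) \<le> real N * (\<epsilon> / (2 * (real N + 1)))"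
      using len by (intro mult_left_mono) auto
    also have "\<dots> \<le> \<epsilon> / 2" using e by (simp add: field_simps)
    finally show "(\<Sum>p\<in>K. d (\<gamma> (fst p)) (\<gamma> (snd p))) < \<epsilon>" by simp
  qed
qed

section \<open>Variation of a curve with respect to a non-symmetric distance\<close>

text \<open>The last argument is the sum of \<open>d\<close> along a subdivision of the interval,
  built from left to right. The supremum of these values is the variation. Subdivision points
  increase strictly, so that the pieces are nondegenerate as \<open>nonoverlapping\<close>
  demands.\<close>

inductive chain_sum ::
  "('b \<Rightarrow> 'b \<Rightarrow> real) \<Rightarrow> (real \<Rightarrow> 'b) \<Rightarrow> real \<Rightarrow> real \<Rightarrow> real \<Rightarrow> bool"
  for d \<gamma> s where
  base: "chain_sum d \<gamma> s s 0"
| step: "chain_sum d \<gamma> s p v \<Longrightarrow> p < t \<Longrightarrow> chain_sum d \<gamma> s t (v + d (\<gamma> p) (\<gamma> t))"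

lemma chain_sum_le: "chain_sum d \<gamma> s t v \<Longrightarrow> s \<le> t"
  by (induction rule: chain_sum.induct) auto

lemma chain_sum_append:
  assumes "chain_sum d \<gamma> m t w" "chain_sum d \<gamma> s m v"
  shows "chain_sum d \<gamma> s t (v + w)"
  using assms
proof (induction rule: chain_sum.induct)
  case (step p w t)
  then show ?case using chain_sum.step[of d \<gamma> s p "v + w" t] by (simp add: add.assoc)
qed simp

lemma chain_sum_intervals:
  assumes "chain_sum d \<gamma> s t v"
  shows "\<exists>K. finite K \<and> nonoverlapping K \<and> K \<subseteq> {s..t} \<times> {s..t} \<and>
           (\<Sum>p\<in>K. snd p - fst p) = t - s \<and> (\<Sum>p\<in>K. d (\<gamma> (fst p)) (\<gamma> (snd p))) = v"
  using assms
proof (induction rule: chain_sum.induct)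
  case base
  show ?case by (rule exI[of _ "{}"]) (auto simp: nonoverlapping_def)
next
  case (step p v t)
  then obtain K where K: "finite K" "nonoverlapping K" "K \<subseteq> {s..p} \<times> {s..p}"
    "(\<Sum>p\<in>K. snd p - fst p) = p - s" "(\<Sum>p\<in>K. d (\<gamma> (fst p)) (\<gamma> (snd p))) = v"
    by blast
  have sub: "s \<le> fst q" "fst q \<le> p" "s \<le> snd q" "snd q \<le> p" if "q \<in> K" for q
    using subsetD[OF K(3) that] by (auto simp: mem_Times_iff)
  have "(p, t) \<notin> K" using sub(4)[of "(p, t)"] step.hyps by auto
  moreover have "nonoverlapping (insert (p, t) K)"
  proof -
    have "{fst q<..<snd q} \<inter> {p<..<t} = {}" if "q \<in> K" for q
      using sub(4)[OF that] by auto
    then show ?thesis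
      using K(2) step.hyps(2) unfolding nonoverlapping_def
      by (simp only: ball_simps fst_conv snd_conv Int_commute) blast
  qed
  moreover have "insert (p, t) K \<subseteq> {s..t} \<times> {s..t}"
    using sub step.hyps chain_sum_le[OF step.hyps(1)] by (fastforce simp: mem_Times_iff)
  ultimately show ?case
    using K by (intro exI[of _ "insert (p, t) K"]) (auto simp: add.commute)
qed

locale asym_dist =
  fixes d :: "'b \<Rightarrow> 'b \<Rightarrow> real" and S :: "'b set"
  assumes dist_nonneg: "x \<in> S \<Longrightarrow> y \<in> S \<Longrightarrow> 0 \<le> d x y"
    and dist_refl: "x \<in> S \<Longrightarrow> d x x = 0"
    and dist_triangle: "x \<in> S \<Longrightarrow> y \<in> S \<Longrightarrow> z \<in> S \<Longrightarrow> d x z \<le> d x y + d y z"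
begin

text \<open>Makes the gluing results of the locale available for the reverse distance.\<close>

lemma flip: "asym_dist (\<lambda>x y. d y x) S"
proof unfold_locales
  fix x y z assume "x \<in> S" "y \<in> S" "z \<in> S"
  then show "d z x \<le> d y x + d z y" using dist_triangle[of z y x] by simp
qed (use dist_nonneg dist_refl in auto)

text \<open>The only chain from \<open>s\<close> to \<open>s\<close> is the empty one with sum 0, so
  the case \<open>s = t\<close> rests on \<open>dist_refl\<close>.\<close>

lemma chain_sum_single:
  assumes "s \<le> t" "\<gamma> s \<in> S"
  shows "chain_sum d \<gamma> s t (d (\<gamma> s) (\<gamma> t))"
proof (cases "s = t")
  case True
  then show ?thesis using assms dist_refl by (auto intro: chain_sum.base)
next
  case False
  then show ?thesis using chain_sum.step[OF chain_sum.base, of s t d \<gamma>] assms by auto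
qed

text \<open>Inserting \<open>m\<close> does not decrease the sum, by the triangle inequality for the
  step that contains \<open>m\<close>; the induction peels off last steps until that step is
  reached.\<close>

lemma chain_sum_split:
  assumes "chain_sum d \<gamma> s t v" "\<gamma> ` {s..t} \<subseteq> S" "s \<le> m" "m \<le> t"
  shows "\<exists>v1 v2. chain_sum d \<gamma> s m v1 \<and> chain_sum d \<gamma> m t v2 \<and> v \<le> v1 + v2"
  using assms
proof (induction rule: chain_sum.induct)
  case base
  then show ?case by (intro exI[of _ 0]) (auto intro: chain_sum.base)
next
  case (step p v t)
  have "s \<le> p" using chain_sum_le[OF step.hyps(1)] .
  then have S: "\<gamma> p \<in> S" "\<gamma> t \<in> S" "\<gamma> m \<in> S" "\<gamma> ` {s..p} \<subseteq> S"
    using step by auto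
  show ?case
  proof (cases "m \<le> p")
    case True
    with step.IH[OF S(4) step.prems(2)] obtain v1 v2
      where v: "chain_sum d \<gamma> s m v1" "chain_sum d \<gamma> m p v2" "v \<le> v1 + v2" by blast
    then show ?thesis
      using chain_sum.step[OF v(2) step.hyps(2)]
      by (intro exI[of _ v1] exI[of _ "v2 + d (\<gamma> p) (\<gamma> t)"]) auto
  next
    case False
    then have "chain_sum d \<gamma> s m (v + d (\<gamma> p) (\<gamma> m))"
      using chain_sum.step[OF step.hyps(1)] by auto
    moreover have "chain_sum d \<gamma> m t (d (\<gamma> m) (\<gamma> t))"
      using chain_sum_single step.prems S by blast
    moreover have "d (\<gamma> p) (\<gamma> t) \<le> d (\<gamma> p) (\<gamma> m) + d (\<gamma> m) (\<gamma> t)"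
      using S by (intro dist_triangle)
    ultimately show ?thesis
      by (intro exI[of _ "v + d (\<gamma> p) (\<gamma> m)"] exI[of _ "d (\<gamma> m) (\<gamma> t)"]) auto
  qed
qed

text \<open>\<open>V t\<close> is the supremum of the chain sums from \<open>a\<close> to
  \<open>t\<close>. It is additive over adjacent intervals, because chains can be split and
  appended. It inherits absolute continuity, because nearly optimal chains on all intervals of a
  nonoverlapping family form together one nonoverlapping family of the same total length.\<close>

lemma abs_cont_wrt_imp_variation:
  assumes ac: "abs_cont_wrt d {a..b} \<gamma>" and ab: "a \<le> b" and S: "\<gamma> ` {a..b} \<subseteq> S"
  obtains V :: "real \<Rightarrow> real"
  where "\<And>s t. \<lbrakk>a \<le> s; s \<le> t; t \<le> b\<rbrakk> \<Longrightarrow> d (\<gamma> s) (\<gamma> t) \<le> V t - V s"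
    and "\<And>s t. \<lbrakk>a \<le> s; s \<le> t; t \<le> b\<rbrakk> \<Longrightarrow> V s \<le> V t"
    and "abs_cont_wrt dist {a..b} V"
proof -
  let ?ch = "chain_sum d \<gamma>"
  \<comment> \<open>The \<epsilon>-\<delta> condition with each interval subdivided further by an
    arbitrary chain: the refinement \<open>\<Union>p\<in>K. L p\<close> has the same total length,
    so the same \<delta> works.\<close>
  have ac': "\<exists>\<delta>>0. \<forall>K. finite K \<longrightarrow> nonoverlapping K \<longrightarrow> K \<subseteq> {a..b} \<times> {a..b} \<longrightarrow>
      (\<Sum>p\<in>K. snd p - fst p) < \<delta> \<longrightarrow> (\<forall>v. (\<forall>p\<in>K. ?ch (fst p) (snd p) (v p)) \<longrightarrow> sum v K < \<epsilon>)"
    if "\<epsilon> > 0" for \<epsilon>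
  proof -
    from ac[unfolded abs_cont_wrt_iff_nonoverlapping, THEN spec, THEN mp, OF that]
    obtain \<delta> where "\<delta> > 0" and \<delta>: "\<forall>K. finite K \<longrightarrow> nonoverlapping K \<longrightarrow>
        K \<subseteq> {a..b} \<times> {a..b} \<longrightarrow> (\<Sum>p\<in>K. snd p - fst p) < \<delta> \<longrightarrow>
        (\<Sum>p\<in>K. d (\<gamma> (fst p)) (\<gamma> (snd p))) < \<epsilon>"
      by (elim exE conjE)
    have "sum v K < \<epsilon>" if K: "finite K" "nonoverlapping K" "K \<subseteq> {a..b} \<times> {a..b}"
        "(\<Sum>p\<in>K. snd p - fst p) < \<delta>" and v: "\<forall>p\<in>K. ?ch (fst p) (snd p) (v p)" for K v
    proof -
      have "\<forall>p\<in>K. \<exists>L. finite L \<and> nonoverlapping L \<and> L \<subseteq> {fst p..snd p} \<times> {fst p..snd p} \<and>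
           (\<Sum>p\<in>L. snd p - fst p) = snd p - fst p \<and>
           (\<Sum>p\<in>L. d (\<gamma> (fst p)) (\<gamma> (snd p))) = v p"
        using v chain_sum_intervals by blast
      from bchoice[OF this] obtain L where L0: "\<forall>p\<in>K. finite (L p) \<and> nonoverlapping (L p) \<and>
           L p \<subseteq> {fst p..snd p} \<times> {fst p..snd p} \<and>
           (\<Sum>p\<in>L p. snd p - fst p) = snd p - fst p \<and>
           (\<Sum>p\<in>L p. d (\<gamma> (fst p)) (\<gamma> (snd p))) = v p"
        by (elim exE)
      have L: "\<And>p. p \<in> K \<Longrightarrow> finite (L p)" "\<And>p. p \<in> K \<Longrightarrow> nonoverlapping (L p)"
        "\<And>p. p \<in> K \<Longrightarrow> L p \<subseteq> {fst p..snd p} \<times> {fst p..snd p}"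
        "\<And>p. p \<in> K \<Longrightarrow> (\<Sum>p\<in>L p. snd p - fst p) = snd p - fst p"
        "\<And>p. p \<in> K \<Longrightarrow> (\<Sum>p\<in>L p. d (\<gamma> (fst p)) (\<gamma> (snd p))) = v p"
        using L0 by blast+
      have Lsub: "fst p \<le> fst q" "snd q \<le> snd p" "fst q < snd q" if "p \<in> K" "q \<in> L p" for p q
        using subsetD[OF L(3) that(2), OF that(1)] nonoverlappingD(1)[OF L(2) that(2), OF that(1)]
        by (auto simp: mem_Times_iff)
      have cross: "{fst q<..<snd q} \<inter> {fst r<..<snd r} = {}"
        if "p \<in> K" "p' \<in> K" "p \<noteq> p'" "q \<in> L p" "r \<in> L p'" for p p' q r
      proof -
        have "{fst q<..<snd q} \<subseteq> {fst p<..<snd p}" "{fst r<..<snd r} \<subseteq> {fst p'<..<snd p'}"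
          using Lsub[OF that(1,4)] Lsub[OF that(2,5)] by auto
        then show ?thesis using nonoverlappingD(2)[OF K(2) that(1-3)] by blast
      qed
      have disj: "L p \<inter> L p' = {}" if "p \<in> K" "p' \<in> K" "p \<noteq> p'" for p p'
      proof (rule ccontr)
        assume "L p \<inter> L p' \<noteq> {}"
        then obtain q where q: "q \<in> L p" "q \<in> L p'" by blast
        then show False using cross[OF that q] Lsub(3)[OF that(1) q(1)] by simp
      qed
      have sums: "sum h (\<Union>p\<in>K. L p) = (\<Sum>p\<in>K. sum h (L p))" for h :: "real \<times> real \<Rightarrow> real"
        using K(1) L(1) disj by (intro sum.UNION_disjoint) auto
      have "(\<Sum>p\<in>(\<Union>p\<in>K. L p). d (\<gamma> (fst p)) (\<gamma> (snd p))) < \<epsilon>"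
      proof (rule \<delta>[rule_format])
        show "finite (\<Union>p\<in>K. L p)" using K(1) L(1) by auto
        show "nonoverlapping (\<Union>p\<in>K. L p)"
          unfolding nonoverlapping_def
        proof (intro conjI ballI impI)
          show "fst q < snd q" if "q \<in> (\<Union>p\<in>K. L p)" for q
            using that Lsub(3) by blast
          fix q r assume qr: "q \<in> (\<Union>p\<in>K. L p)" "r \<in> (\<Union>p\<in>K. L p)" "q \<noteq> r"
          then obtain p p' where pp: "p \<in> K" "p' \<in> K" "q \<in> L p" "r \<in> L p'" by blast
          show "{fst q<..<snd q} \<inter> {fst r<..<snd r} = {}"
          proof (cases "p = p'")
            case True
            then show ?thesis using nonoverlappingD(2)[OF L(2)[OF pp(1)]] pp qr(3) by blast
          qed (use cross pp in blast)
        qed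
        show "(\<Union>p\<in>K. L p) \<subseteq> {a..b} \<times> {a..b}"
        proof
          fix q assume "q \<in> (\<Union>p\<in>K. L p)"
          then obtain p where p: "p \<in> K" "q \<in> L p" by blast
          then show "q \<in> {a..b} \<times> {a..b}"
            using Lsub[OF p] subsetD[OF K(3) p(1)] by (auto simp: mem_Times_iff)
        qed
        show "(\<Sum>p\<in>(\<Union>p\<in>K. L p). snd p - fst p) < \<delta>"
          using K(4) L(4) by (simp add: sums)
      qed
      then show ?thesis using L(5) by (simp add: sums)
    qed
    then show ?thesis by (intro exI[of _ \<delta>] conjI allI impI \<open>\<delta> > 0\<close>)
  qed
  have Ssub: "\<gamma> ` {s..t} \<subseteq> S" if "a \<le> s" "t \<le> b" for s t
    using S that by (auto simp: image_subset_iff)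
  \<comment> \<open>Finiteness of the variation by bisection: on intervals shorter than the \<delta>
    belonging to \<epsilon> = 1 every chain sum is below 1, and bounds add over adjacent intervals.
    The guards, trivial for the whole interval, keep the pieces inside it.\<close>
  have bdd: "a \<le> a \<longrightarrow> b \<le> b \<longrightarrow> bdd_above {v. ?ch a b v}"
    using ab
  proof (induction rule: Bolzano[where P = "\<lambda>s t. a \<le> s \<longrightarrow> t \<le> b \<longrightarrow> bdd_above {v. ?ch s t v}"])
    case (trans s m t)
    show ?case
    proof (intro impI)
      assume "a \<le> s" "t \<le> b"
      then obtain B1 B2 where B: "\<And>v. ?ch s m v \<Longrightarrow> v \<le> B1" "\<And>v. ?ch m t v \<Longrightarrow> v \<le> B2"
        using trans by (auto simp: bdd_above_def)
      have "v \<le> B1 + B2" if "?ch s t v" for v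
        using chain_sum_split[OF that Ssub, of m] B trans \<open>a \<le> s\<close> \<open>t \<le> b\<close> by force
      then show "bdd_above {v. ?ch s t v}" by (auto simp: bdd_above_def)
    qed
  next
    case (local x)
    from ac'[of 1] obtain \<delta> where "\<delta> > 0" and \<delta>: "\<forall>K. finite K \<longrightarrow> nonoverlapping K \<longrightarrow>
      K \<subseteq> {a..b} \<times> {a..b} \<longrightarrow> (\<Sum>p\<in>K. snd p - fst p) < \<delta> \<longrightarrow>
      (\<forall>v. (\<forall>p\<in>K. ?ch (fst p) (snd p) (v p)) \<longrightarrow> sum v K < 1)"
      by auto
    have "bdd_above {v. ?ch s t v}" if "s \<le> x" "x \<le> t" "t - s < \<delta>" "a \<le> s" "t \<le> b" for s t
    proof (cases "s < t")
      case True
      have "v < 1" if "?ch s t v" for v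
        using \<delta>[rule_format, of "{(s, t)}" "\<lambda>_. v"] that True \<open>t - s < \<delta>\<close> \<open>a \<le> s\<close> \<open>t \<le> b\<close>
        by (auto simp: nonoverlapping_def)
      then show ?thesis by (auto simp: bdd_above_def intro: less_imp_le)
    next
      case False
      have "v = 0" if "?ch s t v" for v
        using that
      proof cases
        case (step p v')
        then show ?thesis using False chain_sum_le[of d \<gamma> s p v'] by auto
      qed auto
      then show ?thesis by (auto simp: bdd_above_def)
    qed
    then show ?case using \<open>\<delta> > 0\<close> by (intro exI[of _ \<delta>]) auto
  qed
  define W where "W s t = Sup {v. ?ch s t v}" for s t
  have ne: "{v. ?ch s t v} \<noteq> {}" if "a \<le> s" "s \<le> t" "t \<le> b" for s t
    using chain_sum_single[of s t \<gamma>] that S by fastforce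
  \<comment> \<open>A chain on the subinterval is completed by fixed chains \<open>v1\<close> and
    \<open>v2\<close> to one on the whole interval, where \<open>B\<close> applies.\<close>
  have bdd': "bdd_above {v. ?ch s t v}" if st: "a \<le> s" "s \<le> t" "t \<le> b" for s t
  proof -
    obtain B where B: "\<And>v. ?ch a b v \<Longrightarrow> v \<le> B"
      using bdd by (auto simp: bdd_above_def)
    obtain v1 v2 where v12: "?ch a s v1" "?ch t b v2"
      using ne[of a s] ne[of t b] st by auto
    have "v \<le> B - v1 - v2" if "?ch s t v" for v
      using B[OF chain_sum_append[OF v12(2) chain_sum_append[OF that v12(1)]]] by simp
    then show ?thesis by (auto simp: bdd_above_def)
  qed
  have W_upper: "v \<le> W s t" if "?ch s t v" "a \<le> s" "t \<le> b" for s t v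
    unfolding W_def using that bdd' chain_sum_le[OF that(1)] by (intro cSup_upper) auto
  have W_approx: "\<exists>v. ?ch s t v \<and> W s t - e < v" if "a \<le> s" "s \<le> t" "t \<le> b" "e > 0" for s t e
    using less_cSupD[OF ne[OF that(1-3)], of "W s t - e"] that(4) unfolding W_def by auto
  have W_add: "W s t = W s m + W m t" if st: "a \<le> s" "s \<le> m" "m \<le> t" "t \<le> b" for s m t
  proof (rule antisym)
    show "W s t \<le> W s m + W m t"
    proof (rule field_le_epsilon)
      fix e :: real assume "e > 0"
      then obtain v where v: "?ch s t v" "W s t - e < v" using W_approx[of s t] st by force
      then obtain v1 v2 where "?ch s m v1" "?ch m t v2" "v \<le> v1 + v2"
        using chain_sum_split[OF v(1) Ssub, of m] st by auto
      then show "W s t \<le> W s m + W m t + e"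
        using W_upper[of s m v1] W_upper[of m t v2] v st by auto
    qed
    show "W s m + W m t \<le> W s t"
    proof (rule field_le_epsilon)
      fix e :: real assume "e > 0"
      then obtain v1 v2 where v: "?ch s m v1" "W s m - e/2 < v1" "?ch m t v2" "W m t - e/2 < v2"
        using W_approx[of s m "e/2"] W_approx[of m t "e/2"] st by force
      then show "W s m + W m t \<le> W s t + e"
        using W_upper[OF chain_sum_append[OF v(3) v(1)]] st by auto
    qed
  qed
  have W_diff: "W a t - W a s = W s t" if "a \<le> s" "s \<le> t" "t \<le> b" for s t
    using W_add[of a s t] that by auto
  show thesis
  proof (rule that[of "W a"])
    show *: "d (\<gamma> s) (\<gamma> t) \<le> W a t - W a s" if "a \<le> s" "s \<le> t" "t \<le> b" for s t
      using W_upper[OF chain_sum_single[of s t \<gamma>]] that S W_diff[OF that] by (auto simp: image_subset_iff)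
    show mono: "W a s \<le> W a t" if "a \<le> s" "s \<le> t" "t \<le> b" for s t
      using *[OF that] dist_nonneg[of "\<gamma> s" "\<gamma> t"] that S by (force simp: image_subset_iff)
    show "abs_cont_wrt dist {a..b} (W a)"
      unfolding abs_cont_wrt_iff_nonoverlapping
    proof (intro allI impI)
      fix \<epsilon> :: real assume "\<epsilon> > 0"
      then obtain \<delta> where "\<delta> > 0" and \<delta>: "\<forall>K. finite K \<longrightarrow> nonoverlapping K \<longrightarrow>
        K \<subseteq> {a..b} \<times> {a..b} \<longrightarrow> (\<Sum>p\<in>K. snd p - fst p) < \<delta> \<longrightarrow>
        (\<forall>v. (\<forall>p\<in>K. ?ch (fst p) (snd p) (v p)) \<longrightarrow> sum v K < \<epsilon> / 2)"
        using ac'[of "\<epsilon> / 2"] by auto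
      have "(\<Sum>p\<in>K. dist (W a (fst p)) (W a (snd p))) < \<epsilon>"
        if K: "finite K" "nonoverlapping K" "K \<subseteq> {a..b} \<times> {a..b}"
          "(\<Sum>p\<in>K. snd p - fst p) < \<delta>" for K
      proof -
        have le: "a \<le> fst p" "fst p \<le> snd p" "snd p \<le> b" if "p \<in> K" for p
          using subsetD[OF K(3) that] nonoverlappingD(1)[OF K(2) that] by (auto simp: mem_Times_iff)
        \<comment> \<open>Replacing each variation by a nearly optimal chain costs at most
          \<epsilon>/4 in total, and the chains themselves sum to less than \<epsilon>/2. The
          summand 1 covers the empty family.\<close>
        let ?e = "\<epsilon> / (4 * (real (card K) + 1))"
        have e: "?e > 0" using \<open>\<epsilon> > 0\<close> by simp
        have "\<forall>p\<in>K. \<exists>v. ?ch (fst p) (snd p) v \<and> W (fst p) (snd p) - ?e < v"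
          using W_approx[OF le e] by blast
        then obtain v where v: "\<And>p. p \<in> K \<Longrightarrow> ?ch (fst p) (snd p) (v p)"
          "\<And>p. p \<in> K \<Longrightarrow> W (fst p) (snd p) - ?e < v p"
          by metis
        have "(\<Sum>p\<in>K. dist (W a (fst p)) (W a (snd p))) \<le> (\<Sum>p\<in>K. v p + ?e)"
        proof (intro sum_mono)
          fix p assume p: "p \<in> K"
          have "dist (W a (fst p)) (W a (snd p)) = W (fst p) (snd p)"
            using W_diff[OF le[OF p]] mono[OF le[OF p]] by (simp add: dist_real_def)
          then show "dist (W a (fst p)) (W a (snd p)) \<le> v p + ?e" using v(2)[OF p] by linarith
        qed
        also have "\<dots> = sum v K + real (card K) * ?e" by (simp add: sum.distrib)
        also have "sum v K < \<epsilon> / 2" using \<delta> K v(1) by blast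
        also have "real (card K) * ?e \<le> \<epsilon> / 4" using \<open>\<epsilon> > 0\<close> by (simp add: field_simps)
        finally show ?thesis using \<open>\<epsilon> > 0\<close> by simp
      qed
      then show "\<exists>\<delta>>0. \<forall>K. finite K \<longrightarrow> nonoverlapping K \<longrightarrow> K \<subseteq> {a..b} \<times> {a..b} \<longrightarrow>
        (\<Sum>p\<in>K. snd p - fst p) < \<delta> \<longrightarrow> (\<Sum>p\<in>K. dist (W a (fst p)) (W a (snd p))) < \<epsilon>"
        by (intro exI[of _ \<delta>] conjI allI impI \<open>\<delta> > 0\<close>)
    qed
  qed
qed

end

section \<open>Densities of absolutely continuous monotone functions\<close>

text \<open>The gauge assigns \<open>U\<close> to every point of \<open>U\<close>. Each cell of the
  covering lemma has its tag in \<open>Z\<close>, hence in \<open>U\<close>, and therefore lies in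
  \<open>U\<close>; its nonempty interior makes it a nondegenerate interval.\<close>

lemma interval_covering_within_open:
  fixes Z :: "real set"
  assumes Z: "Z \<subseteq> {a..b}" and ab: "a < b" and U: "open U" "Z \<subseteq> U"
  obtains D where "countable D" "Z \<subseteq> \<Union>D"
    "pairwise (\<lambda>A B. interior A \<inter> interior B = {}) D"
    "\<forall>K\<in>D. \<exists>l u. l < u \<and> K = {l..u} \<and> K \<subseteq> U \<and> K \<subseteq> {a..b}"
proof (rule covering_lemma[of Z a b "\<lambda>x. if x \<in> U then U else UNIV"])
  show "Z \<subseteq> cbox a b" "box a b \<noteq> {}" using Z ab by auto
  show "gauge (\<lambda>x. if x \<in> U then U else UNIV)" using U(1) by (auto simp: gauge_def)
  fix D :: "real set set"
  assume D: "countable D" "\<Union>D \<subseteq> cbox a b"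
    "\<And>K. K \<in> D \<Longrightarrow> interior K \<noteq> {} \<and> (\<exists>c d. K = cbox c d)"
    "pairwise (\<lambda>A B. interior A \<inter> interior B = {}) D"
    "\<And>K. K \<in> D \<Longrightarrow> \<exists>x\<in>Z \<inter> K. K \<subseteq> (if x \<in> U then U else UNIV)"
    "Z \<subseteq> \<Union>D"
  have "\<exists>l u. l < u \<and> K = {l..u} \<and> K \<subseteq> U \<and> K \<subseteq> {a..b}" if K: "K \<in> D" for K
  proof -
    obtain l u where lu: "K = {l..u}" "interior K \<noteq> {}" using D(3)[OF K] by auto
    moreover have "l < u" using lu by auto
    moreover obtain x where "x \<in> Z" "K \<subseteq> (if x \<in> U then U else UNIV)" using D(5)[OF K] by blast
    then have "K \<subseteq> U" using U(2) by (simp add: subsetD)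
    moreover have "K \<subseteq> {a..b}" using D(2) K by auto
    ultimately show ?thesis by (intro exI[of _ l] exI[of _ u]) simp
  qed
  then show thesis using that[of D] D by blast
qed

text \<open>The Stieltjes measure of \<open>V\<close> vanishes on Lebesgue null sets, since these
  are covered by nonoverlapping intervals of small total length, on which \<open>V\<close> increases
  by little. Its Radon-Nikodym derivative is the density.\<close>

lemma abs_cont_mono_imp_density:
  fixes V :: "real \<Rightarrow> real"
  assumes ab: "a < b" and mono: "\<And>s t. \<lbrakk>a \<le> s; s \<le> t; t \<le> b\<rbrakk> \<Longrightarrow> V s \<le> V t"
    and ac: "abs_cont_wrt dist {a..b} V"
  obtains f where "f integrable_on {a..b}" "\<And>x. 0 \<le> f x"
    "\<And>s t. \<lbrakk>a \<le> s; s \<le> t; t \<le> b\<rbrakk> \<Longrightarrow> integral {s..t} f = V t - V s"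
proof -
  \<comment> \<open>Clamping extends \<open>V\<close> by constants, because a monotone continuous
    function on the whole line is wanted for \<open>interval_measure\<close>. Being 1-Lipschitz, the
    clamp preserves the uniform continuity of \<open>V\<close>.\<close>
  define c where "c x = max a (min b x)" for x
  define G where "G x = V (c x)" for x
  have c: "c x \<in> {a..b}" "x \<in> {a..b} \<Longrightarrow> c x = x" for x using ab by (auto simp: c_def min_def max_def)
  have c_mono: "x \<le> y \<Longrightarrow> c x \<le> c y" and c_dist: "\<bar>c x - c y\<bar> \<le> \<bar>x - y\<bar>" for x y
    unfolding c_def min_def max_def by (simp_all split: if_splits)
  have G_mono: "G x \<le> G y" if "x \<le> y" for x y
    unfolding G_def using c(1)[of x] c(1)[of y] c_mono[OF that] by (intro mono) auto
  have G_eq: "G x = V x" if "x \<in> {a..b}" for x using c(2)[OF that] by (simp add: G_def)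
  have ac': "\<exists>\<delta>>0. \<forall>K. finite K \<longrightarrow> nonoverlapping K \<longrightarrow> K \<subseteq> {a..b} \<times> {a..b} \<longrightarrow>
        (\<Sum>p\<in>K. snd p - fst p) < \<delta> \<longrightarrow> (\<Sum>p\<in>K. dist (V (fst p)) (V (snd p))) < \<epsilon>"
    if "\<epsilon> > 0" for \<epsilon>
    using ac[unfolded abs_cont_wrt_iff_nonoverlapping, THEN spec, THEN mp, OF that] .
  have G_cont: "continuous_on UNIV G"
    unfolding continuous_on_iff
  proof (intro ballI allI impI)
    fix x e :: real assume "e > 0"
    then obtain \<delta> where "\<delta> > 0" and \<delta>: "\<forall>K. finite K \<longrightarrow> nonoverlapping K \<longrightarrow> K \<subseteq> {a..b} \<times> {a..b} \<longrightarrow>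
        (\<Sum>p\<in>K. snd p - fst p) < \<delta> \<longrightarrow> (\<Sum>p\<in>K. dist (V (fst p)) (V (snd p))) < e"
      using ac' by blast
    have *: "dist (V u) (V v) < e" if "u < v" "u \<in> {a..b}" "v \<in> {a..b}" "v - u < \<delta>" for u v
      using \<delta>[rule_format, of "{(u, v)}"] that by (auto simp: nonoverlapping_def)
    have "dist (G y) (G x) < e" if "dist y x < \<delta>" for y
    proof -
      have "\<bar>c y - c x\<bar> < \<delta>" using c_dist[of y x] that by (simp add: dist_real_def)
      then show ?thesis
        using *[of "c x" "c y"] *[of "c y" "c x"] c(1)[of x] c(1)[of y] \<open>e > 0\<close>
        unfolding G_def by (cases "c x" "c y" rule: linorder_cases) (auto simp: dist_commute)
    qed
    then show "\<exists>d>0. \<forall>x'\<in>UNIV. dist x' x < d \<longrightarrow> dist (G x') (G x) < e"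
      using \<open>\<delta> > 0\<close> by blast
  qed
  define M where "M = interval_measure G"
  have sets_M: "sets M = sets borel" by (simp add: M_def)
  have M_Icc: "emeasure M {s..t} = ennreal (G t - G s)" if "s \<le> t" for s t
    unfolding M_def using that G_mono G_cont by (intro emeasure_interval_measure_Icc) auto
  have null: "emeasure M Z = 0" if Z: "Z \<in> sets borel" "emeasure lborel Z = 0" "Z \<subseteq> {a..b}" for Z
  proof -
    have "emeasure M Z \<le> ennreal \<epsilon>" if "\<epsilon> > 0" for \<epsilon>
    proof -
      from ac'[OF that] obtain \<delta> where "\<delta> > 0" and \<delta>: "\<forall>K. finite K \<longrightarrow> nonoverlapping K \<longrightarrow>
        K \<subseteq> {a..b} \<times> {a..b} \<longrightarrow> (\<Sum>p\<in>K. snd p - fst p) < \<delta> \<longrightarrow>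
        (\<Sum>p\<in>K. dist (V (fst p)) (V (snd p))) < \<epsilon>" by (elim exE conjE)
      obtain U where U: "open U" "Z \<subseteq> U" "emeasure lborel (U - Z) < \<delta>"
        using outer_regular_lborel[OF Z(1) \<open>\<delta> > 0\<close>] .
      have "emeasure lborel U \<le> emeasure lborel (U - Z) + emeasure lborel Z"
        using U Z emeasure_subadditive[of "U - Z" lborel Z] by (simp add: Un_absorb2)
      then have U_small: "emeasure lborel U < \<delta>" using U(3) Z(2) by simp
      obtain D where D: "countable D" "Z \<subseteq> \<Union>D"
          "pairwise (\<lambda>A B. interior A \<inter> interior B = {}) D"
          "\<forall>K\<in>D. \<exists>l u. l < u \<and> K = {l..u} \<and> K \<subseteq> U \<and> K \<subseteq> {a..b}"
        using interval_covering_within_open[OF Z(3) ab U(1,2)] by blast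
      \<comment> \<open>A cell is recovered from its infimum and supremum, which turns a finite set
        of cells into a set of pairs without repetition.\<close>
      have D_eq: "K = {Inf K..Sup K} \<and> Inf K < Sup K \<and> K \<subseteq> U \<and> Inf K \<in> {a..b} \<and> Sup K \<in> {a..b}"
        if K: "K \<in> D" for K
      proof -
        from bspec[OF D(4) K] obtain l u
          where lu: "l < u" "K = {l..u}" "K \<subseteq> U" "K \<subseteq> {a..b}" by (elim exE conjE)
        then have "Inf K = l" "Sup K = u" by simp_all
        then show ?thesis using lu by simp
      qed
      have D_sets: "K \<in> sets M" if "K \<in> D" for K
        using bspec[OF D(4) that] by (elim exE conjE) (simp add: sets_M)
      have fin: "emeasure M (\<Union>E) \<le> ennreal \<epsilon>" if E: "finite E" "E \<subseteq> D" for E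
      proof -
        let ?p = "\<lambda>K::real set. (Inf K, Sup K)"
        have inj: "inj_on ?p E"
        proof (rule inj_onI)
          fix K L assume KL: "K \<in> E" "L \<in> E" "?p K = ?p L"
          then have "K = {Inf K..Sup K}" "L = {Inf L..Sup L}" using D_eq E(2) by blast+
          then show "K = L" using KL(3) by (metis prod.inject)
        qed
        have int: "interior K = {Inf K<..<Sup K}" if "K \<in> E" for K
          using D_eq[of K] E(2) that by (metis interior_atLeastAtMost_real subsetD)
        have disj: "{Inf K<..<Sup K} \<inter> {Inf L<..<Sup L} = {}" if "K \<in> E" "L \<in> E" "K \<noteq> L" for K L
        proof -
          have "interior K \<inter> interior L = {}"
            using D(3) that E(2) unfolding pairwise_def by blast
          then show ?thesis using int that by simp
        qed
        \<comment> \<open>The interiors are disjoint subsets of \<open>U\<close>, so the lengths sum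
          to at most the measure of \<open>U\<close>, which is below \<delta>.\<close>
        have "ennreal (\<Sum>K\<in>E. Sup K - Inf K) = (\<Sum>K\<in>E. emeasure lborel {Inf K<..<Sup K})"
          using D_eq E(2) by (subst sum_ennreal[symmetric]) (auto simp: less_imp_le subset_iff)
        also have "\<dots> = emeasure lborel (\<Union>K\<in>E. {Inf K<..<Sup K})"
          using disj E(1) by (intro sum_emeasure) (auto simp: disjoint_family_on_def)
        also have "\<dots> \<le> emeasure lborel U"
        proof (rule emeasure_mono)
          have "{Inf K<..<Sup K} \<subseteq> U" if "K \<in> E" for K
            using D_eq[of K] E(2) int[OF that] interior_subset[of K] that by blast
          then show "(\<Union>K\<in>E. {Inf K<..<Sup K}) \<subseteq> U" by blast
        qed (use U in auto)
        finally have "ennreal (\<Sum>K\<in>E. Sup K - Inf K) < ennreal \<delta>" using U_small by simp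
        then have len: "(\<Sum>K\<in>E. Sup K - Inf K) < \<delta>"
          using \<open>\<delta> > 0\<close> by (metis ennreal_leI leD leI)
        have "(\<Sum>p\<in>?p ` E. dist (V (fst p)) (V (snd p))) < \<epsilon>"
        proof (rule \<delta>[rule_format])
          show "nonoverlapping (?p ` E)"
            unfolding nonoverlapping_def
          proof (intro conjI ballI impI)
            show "fst p < snd p" if "p \<in> ?p ` E" for p using that D_eq E(2) by auto
            fix p q assume "p \<in> ?p ` E" "q \<in> ?p ` E" "p \<noteq> q"
            then obtain K L where "K \<in> E" "L \<in> E" "p = ?p K" "q = ?p L" "K \<noteq> L" by blast
            then show "{fst p<..<snd p} \<inter> {fst q<..<snd q} = {}" using disj[of K L] by simp
          qed
          show "?p ` E \<subseteq> {a..b} \<times> {a..b}" using D_eq E(2) by blast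
          show "(\<Sum>p\<in>?p ` E. snd p - fst p) < \<delta>" using len by (simp add: sum.reindex[OF inj])
        qed (use E in auto)
        then have sum_lt: "(\<Sum>K\<in>E. dist (V (Inf K)) (V (Sup K))) < \<epsilon>"
          by (simp add: sum.reindex[OF inj])
        have "emeasure M (\<Union>E) \<le> (\<Sum>K\<in>E. emeasure M K)"
        proof -
          have "(\<lambda>K. K) ` E \<subseteq> sets M" using D_sets E(2) by blast
          then show ?thesis
            using emeasure_subadditive_finite[OF E(1), of "\<lambda>K. K" M] by simp
        qed
        also have "\<dots> = (\<Sum>K\<in>E. ennreal (dist (V (Inf K)) (V (Sup K))))"
        proof (intro sum.cong refl)
          fix K assume "K \<in> E"
          then have K: "K = {Inf K..Sup K}" "Inf K < Sup K" "Inf K \<in> {a..b}" "Sup K \<in> {a..b}"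
            using D_eq E(2) by blast+
          have "emeasure M K = emeasure M {Inf K..Sup K}" using K(1) by simp
          also have "\<dots> = ennreal (G (Sup K) - G (Inf K))" using K(2) by (intro M_Icc) simp
          also have "\<dots> = ennreal (dist (V (Inf K)) (V (Sup K)))"
            using K mono[of "Inf K" "Sup K"] by (simp add: G_eq dist_real_def)
          finally show "emeasure M K = ennreal (dist (V (Inf K)) (V (Sup K)))" .
        qed
        also have "\<dots> = ennreal (\<Sum>K\<in>E. dist (V (Inf K)) (V (Sup K)))"
          by (intro sum_ennreal) auto
        also have "\<dots> \<le> ennreal \<epsilon>" using sum_lt by (intro ennreal_leI) simp
        finally show ?thesis .
      qed
      show ?thesis
      proof (cases "D = {}")
        case True
        then show ?thesis using D(2) by simp
      next
        case False
        \<comment> \<open>The \<epsilon>-\<delta> condition controls finite families only.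
          Continuity of \<open>M\<close> from below along the partial unions carries the estimate
          over to the countable cover.\<close>
        define e where "e = from_nat_into D"
        have e: "range e = D" unfolding e_def using D(1) False by (simp add: range_from_nat_into)
        have e_sets: "e n \<in> sets M" for n
          using D_sets e by blast
        have "emeasure M Z \<le> emeasure M (\<Union>n. \<Union>i<n. e i)"
        proof (rule emeasure_mono)
          show "Z \<subseteq> (\<Union>n. \<Union>i<n. e i)"
          proof
            fix x assume "x \<in> Z"
            then obtain i where "x \<in> e i" using D(2) e by blast
            then show "x \<in> (\<Union>n. \<Union>i<n. e i)" by (intro UN_I[of "Suc i"] UN_I[of i]) auto
          qed
          show "(\<Union>n. \<Union>i<n. e i) \<in> sets M" using e_sets by (intro sets.countable_UN sets.finite_UN) auto
        qed
        also have "\<dots> = (SUP n. emeasure M (\<Union>i<n. e i))"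
          using e_sets by (intro SUP_emeasure_incseq[symmetric]) (auto simp: incseq_def intro: order.strict_trans2)
        also have "\<dots> \<le> ennreal \<epsilon>"
          using e by (intro SUP_least fin) auto
        finally show ?thesis .
      qed
    qed
    then show ?thesis
      by (metis ennreal_0 ennreal_le_epsilon le_zero_eq add_0 zero_le)
  qed
  \<comment> \<open>Restriction to the interval, since \<open>null\<close> is established for
    subsets of it only.\<close>
  define N where "N = density M (indicator {a..b})"
  have N_eq: "emeasure N Z = emeasure M ({a..b} \<inter> Z)" if "Z \<in> sets borel" for Z
    unfolding N_def using that by (intro emeasure_restricted) (auto simp: sets_M)
  have "absolutely_continuous lborel N"
    unfolding absolutely_continuous_def
  proof
    fix Z :: "real set" assume "Z \<in> null_sets lborel"
    then have Z: "Z \<in> sets borel" "emeasure lborel Z = 0" by auto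
    have "emeasure lborel ({a..b} \<inter> Z) \<le> emeasure lborel Z"
      using Z by (intro emeasure_mono) auto
    then have "emeasure M ({a..b} \<inter> Z) = 0"
      using Z by (intro null) auto
    then show "Z \<in> null_sets N"
      using N_eq[OF Z(1)] Z(1) by (simp add: null_sets_def N_def sets_M)
  qed
  then obtain h where h: "h \<in> borel_measurable lborel" "density lborel h = N"
    using sigma_finite_measure.Radon_Nikodym[OF sigma_finite_lborel, of N]
    by (auto simp: N_def sets_M)
  have h_int: "(\<integral>\<^sup>+x. h x * indicator {s..t} x \<partial>lborel) = ennreal (V t - V s)"
    if "a \<le> s" "s \<le> t" "t \<le> b" for s t
  proof -
    have "(\<integral>\<^sup>+x. h x * indicator {s..t} x \<partial>lborel) = emeasure N {s..t}"
      using h by (subst h(2)[symmetric], subst emeasure_density) auto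
    also have "\<dots> = emeasure M {s..t}" using that by (subst N_eq) (auto simp: Int_absorb1)
    also have "\<dots> = ennreal (V t - V s)" using that by (simp add: M_Icc G_eq)
    finally show ?thesis .
  qed
  \<comment> \<open>\<open>h\<close> has a finite integral over the interval and so is finite almost
    everywhere there; at the remaining points \<open>enn2real\<close> replaces infinity by 0, which
    no integral notices.\<close>
  define f where "f x = enn2real (h x)" for x
  have f_nonneg: "0 \<le> f x" for x by (simp add: f_def)
  have f_meas: "f \<in> borel_measurable lborel" unfolding f_def using h(1) by measurable
  have "AE x in lborel. h x * indicator {a..b} x \<noteq> \<infinity>"
    using h_int[of a b] ab h(1) by (intro nn_integral_noteq_infinite) auto
  then have fh: "AE x in lborel. x \<in> {a..b} \<longrightarrow> ennreal (f x) = h x"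
    by (rule AE_mp) (auto simp: f_def less_top intro!: AE_I2)
  have f_int: "(f has_integral (V t - V s)) {s..t}" if "a \<le> s" "s \<le> t" "t \<le> b" for s t
  proof -
    have "(\<integral>\<^sup>+x. ennreal (f x * indicator {s..t} x) \<partial>lborel) =
        (\<integral>\<^sup>+x. h x * indicator {s..t} x \<partial>lborel)"
    proof (rule nn_integral_cong_AE, rule AE_mp[OF fh], rule AE_I2, rule impI)
      fix x assume "x \<in> {a..b} \<longrightarrow> ennreal (f x) = h x"
      then show "ennreal (f x * indicator {s..t} x) = h x * indicator {s..t} x"
        using that by (auto simp: indicator_def)
    qed
    also have "\<dots> = ennreal (V t - V s)" using h_int[OF that] .
    finally have "((\<lambda>x. f x * indicator {s..t} x) has_integral (V t - V s)) UNIV"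
      using f_meas f_nonneg mono[OF that]
      by (intro nn_integral_has_integral) (auto intro!: borel_measurable_times)
    also have "(\<lambda>x. f x * indicator {s..t} x) = (\<lambda>x. if x \<in> {s..t} then f x else 0)"
      by (auto simp: indicator_def)
    finally show ?thesis by (simp only: has_integral_restrict_UNIV)
  qed
  show thesis
  proof (rule that[of f])
    show "f integrable_on {a..b}" using f_int[of a b] ab by (auto simp: integrable_on_def)
  qed (use f_int in \<open>auto simp: f_def\<close>)
qed

lemma (in asym_dist) abs_cont_wrt_iff_has_speed_bound:
  assumes ab: "a \<le> b" and S: "\<gamma> ` {a..b} \<subseteq> S"
  shows "abs_cont_wrt d {a..b} \<gamma> \<longleftrightarrow> has_speed_bound d \<gamma> a b"
proof
  assume ac: "abs_cont_wrt d {a..b} \<gamma>"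
  show "has_speed_bound d \<gamma> a b"
  \<comment> \<open>The density lemma is about nondegenerate intervals; on a single point the zero
    function is a bound by \<open>dist_refl\<close>.\<close>
  proof (cases "a = b")
    case True
    have "d (\<gamma> u) (\<gamma> v) = 0" if "a \<le> u" "u \<le> v" "v \<le> b" for u v
    proof -
      have "u = a" "v = a" using that True by auto
      moreover have "\<gamma> a \<in> S" using S ab by auto
      ultimately show ?thesis by (simp add: dist_refl)
    qed
    then show ?thesis unfolding has_speed_bound_def by (intro exI[of _ "\<lambda>_. 0"]) auto
  next
    case False
    obtain V :: "real \<Rightarrow> real" where
      dV: "\<And>s t. \<lbrakk>a \<le> s; s \<le> t; t \<le> b\<rbrakk> \<Longrightarrow> d (\<gamma> s) (\<gamma> t) \<le> V t - V s"
      and mono: "\<And>s t. \<lbrakk>a \<le> s; s \<le> t; t \<le> b\<rbrakk> \<Longrightarrow> V s \<le> V t"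
      and acV: "abs_cont_wrt dist {a..b} V"
      using abs_cont_wrt_imp_variation[OF ac ab S] by metis
    obtain f where "f integrable_on {a..b}" "\<And>x. 0 \<le> f x"
      "\<And>s t. \<lbrakk>a \<le> s; s \<le> t; t \<le> b\<rbrakk> \<Longrightarrow> integral {s..t} f = V t - V s"
      using abs_cont_mono_imp_density[of a b V] mono acV ab False by (metis order_less_le)
    then show ?thesis
      unfolding has_speed_bound_def by (intro exI[of _ f]) (use dV in auto)
  qed
qed (rule has_speed_bound_imp_abs_cont_wrt)

section \<open>Locality and transfer of integrable bounds\<close>

text \<open>For a pair on different sides of \<open>m\<close> the triangle inequality through
  \<gamma>(m) matches the additivity of the integral of the glued function.\<close>

lemma (in asym_dist) has_speed_bound_combine:
  assumes "has_speed_bound d \<gamma> s m" "has_speed_bound d \<gamma> m t" "s \<le> m" "m \<le> t"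
    and S: "\<gamma> ` {s..t} \<subseteq> S"
  shows "has_speed_bound d \<gamma> s t"
proof -
  obtain f where f: "f integrable_on {s..m}" "\<And>x. x \<in> {s..m} \<Longrightarrow> 0 \<le> f x"
    "\<And>u v. \<lbrakk>s \<le> u; u \<le> v; v \<le> m\<rbrakk> \<Longrightarrow> d (\<gamma> u) (\<gamma> v) \<le> integral {u..v} f"
    using assms(1) unfolding has_speed_bound_def by blast
  obtain g where g: "g integrable_on {m..t}" "\<And>x. x \<in> {m..t} \<Longrightarrow> 0 \<le> g x"
    "\<And>u v. \<lbrakk>m \<le> u; u \<le> v; v \<le> t\<rbrakk> \<Longrightarrow> d (\<gamma> u) (\<gamma> v) \<le> integral {u..v} g"
    using assms(2) unfolding has_speed_bound_def by blast
  define h where "h x = (if x \<le> m then f x else g x)" for x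
  have hf: "(h has_integral integral {u..v} f) {u..v}" if "s \<le> u" "v \<le> m" for u v
  proof (rule has_integral_eq)
    show "(f has_integral integral {u..v} f) {u..v}"
      using integrable_on_subinterval[OF f(1)] that by (simp add: integrable_integral)
  qed (use that in \<open>auto simp: h_def\<close>)
  have hg: "(h has_integral integral {u..v} g) {u..v}" if "m \<le> u" "v \<le> t" for u v
  \<comment> \<open>At \<open>m\<close> the glued function takes the value of \<open>f\<close>, so
    on the right piece it may differ from \<open>g\<close> at this one point.\<close>
  proof (rule has_integral_spike_finite[of "{m}"])
    show "(g has_integral integral {u..v} g) {u..v}"
      using integrable_on_subinterval[OF g(1)] that by (simp add: integrable_integral)
  qed (use that in \<open>auto simp: h_def\<close>)
  have h: "h integrable_on {s..t}"
    using has_integral_combine[OF assms(3,4) hf hg] by (auto simp: integrable_on_def)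
  have "d (\<gamma> u) (\<gamma> v) \<le> integral {u..v} h" if uv: "s \<le> u" "u \<le> v" "v \<le> t" for u v
  proof -
    consider "v \<le> m" | "m \<le> u" | "u \<le> m" "m \<le> v" by linarith
    then show ?thesis
    proof cases
      case 1
      then show ?thesis using f(3)[of u v] integral_unique[OF hf[of u v]] uv by simp
    next
      case 2
      then show ?thesis using g(3)[of u v] integral_unique[OF hg[of u v]] uv by simp
    next
      case 3
      have "d (\<gamma> u) (\<gamma> v) \<le> d (\<gamma> u) (\<gamma> m) + d (\<gamma> m) (\<gamma> v)"
        using uv assms(3,4) by (intro dist_triangle subsetD[OF S] imageI) auto
      also have "\<dots> \<le> integral {u..m} f + integral {m..v} g"
        using f(3)[of u m] g(3)[of m v] uv 3 by simp
      also have "\<dots> = integral {u..v} h"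
        using has_integral_combine[OF 3 hf hg] uv by (simp add: integral_unique)
      finally show ?thesis .
    qed
  qed
  then show ?thesis
    unfolding has_speed_bound_def using h f(2) g(2)
    by (intro exI[of _ h]) (auto simp: h_def)
qed

text \<open>Bounds on adjacent intervals combine and bounds on short intervals around each point
  exist, which are the two hypotheses of bisection. This replaces a finite subcover.\<close>

lemma (in asym_dist) has_speed_boundI_local:
  assumes ab: "a \<le> b" and S: "\<gamma> ` {a..b} \<subseteq> S"
    and loc: "\<And>x. x \<in> {a..b} \<Longrightarrow> \<exists>e>0. \<forall>s t. a \<le> s \<longrightarrow> s \<le> x \<longrightarrow> x \<le> t \<longrightarrow> t \<le> b \<longrightarrow>
       t - s < e \<longrightarrow> has_speed_bound d \<gamma> s t"
  shows "has_speed_bound d \<gamma> a b"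
proof -
  have "a \<le> a \<longrightarrow> b \<le> b \<longrightarrow> has_speed_bound d \<gamma> a b"
    using ab
  proof (induction rule: Bolzano[where P = "\<lambda>s t. a \<le> s \<longrightarrow> t \<le> b \<longrightarrow> has_speed_bound d \<gamma> s t"])
    case (trans s m t)
    show ?case
    proof (intro impI)
      assume st: "a \<le> s" "t \<le> b"
      then have "\<gamma> ` {s..t} \<subseteq> S" using S by (auto simp: image_subset_iff)
      then show "has_speed_bound d \<gamma> s t" using trans st by (intro has_speed_bound_combine[of \<gamma> s m t]) auto
    qed
  next
    case (local x)
    then obtain e where "e > 0" and e: "\<forall>s t. a \<le> s \<longrightarrow> s \<le> x \<longrightarrow> x \<le> t \<longrightarrow> t \<le> b \<longrightarrow>
       t - s < e \<longrightarrow> has_speed_bound d \<gamma> s t" using loc[of x] by auto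
    then show ?case by (intro exI[of _ e]) auto
  qed
  then show ?thesis by simp
qed

lemma has_speed_bound_subinterval:
  assumes "has_speed_bound d \<gamma> a b" "a \<le> s" "t \<le> b"
  shows "has_speed_bound d \<gamma> s t"
proof -
  obtain f where f: "f integrable_on {a..b}" "\<forall>x\<in>{a..b}. 0 \<le> f x"
    "\<forall>u v. a \<le> u \<longrightarrow> u \<le> v \<longrightarrow> v \<le> b \<longrightarrow> d (\<gamma> u) (\<gamma> v) \<le> integral {u..v} f"
    using assms(1) unfolding has_speed_bound_def by blast
  have "f integrable_on {s..t}"
    using integrable_on_subinterval[OF f(1), of s t] assms(2,3) by simp
  then show ?thesis
    unfolding has_speed_bound_def using f(2,3) assms(2,3) by (intro exI[of _ f]) auto
qed

lemma has_speed_bound_scaled_mono: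
  assumes "has_speed_bound d \<gamma> s t" "0 \<le> C"
    and le: "\<And>u v. \<lbrakk>s \<le> u; u \<le> v; v \<le> t\<rbrakk> \<Longrightarrow> d' (\<gamma>' u) (\<gamma>' v) \<le> C * d (\<gamma> u) (\<gamma> v)"
  shows "has_speed_bound d' \<gamma>' s t"
proof -
  obtain f where f: "f integrable_on {s..t}" "\<forall>x\<in>{s..t}. 0 \<le> f x"
    "\<And>u v. \<lbrakk>s \<le> u; u \<le> v; v \<le> t\<rbrakk> \<Longrightarrow> d (\<gamma> u) (\<gamma> v) \<le> integral {u..v} f"
    using assms(1) unfolding has_speed_bound_def by blast
  have "d' (\<gamma>' u) (\<gamma>' v) \<le> integral {u..v} (\<lambda>x. C * f x)" if "s \<le> u" "u \<le> v" "v \<le> t" for u v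
    using le[OF that] mult_left_mono[OF f(3)[OF that] assms(2)] by simp
  then show ?thesis
    unfolding has_speed_bound_def using f(1,2) assms(2)
    by (intro exI[of _ "\<lambda>x. C * f x"]) (auto intro: integrable_on_mult_right)
qed

text \<open>The indefinite integral is continuous. It controls distances in the direction of
  increasing time only, so \<gamma>(x) is the first argument to the right of \<open>x\<close> and
  the second one to the left.\<close>

lemma has_speed_bound_tendsto:
  assumes "has_speed_bound d \<gamma> a b" "x \<in> {a..b}" "e > 0"
  shows "\<exists>\<delta>>0. \<forall>y\<in>{a..b}. \<bar>y - x\<bar> < \<delta> \<longrightarrow>
    (x \<le> y \<longrightarrow> d (\<gamma> x) (\<gamma> y) < e) \<and> (y \<le> x \<longrightarrow> d (\<gamma> y) (\<gamma> x) < e)"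
proof -
  obtain f where f: "f integrable_on {a..b}"
    "\<And>u v. \<lbrakk>a \<le> u; u \<le> v; v \<le> b\<rbrakk> \<Longrightarrow> d (\<gamma> u) (\<gamma> v) \<le> integral {u..v} f"
    using assms(1) unfolding has_speed_bound_def by blast
  have "continuous_on {a..b} (\<lambda>t. integral {a..t} f)"
    using f(1) by (rule indefinite_integral_continuous_1)
  then obtain \<delta> where "\<delta> > 0" and
    \<delta>: "\<And>y. y \<in> {a..b} \<Longrightarrow> dist y x < \<delta> \<Longrightarrow> dist (integral {a..y} f) (integral {a..x} f) < e"
    using assms(2,3) unfolding continuous_on_iff by blast
  have split: "integral {a..v} f - integral {a..u} f = integral {u..v} f"
    if "a \<le> u" "u \<le> v" "v \<le> b" for u v
    using Henstock_Kurzweil_Integration.integral_combine[OF that(1,2), of f]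
      integrable_on_subinterval[OF f(1), of a v] that by simp
  have "(x \<le> y \<longrightarrow> d (\<gamma> x) (\<gamma> y) < e) \<and> (y \<le> x \<longrightarrow> d (\<gamma> y) (\<gamma> x) < e)"
    if "y \<in> {a..b}" "\<bar>y - x\<bar> < \<delta>" for y
    using \<delta>[of y] that assms(2) split[of x y] split[of y x] f(2)[of x y] f(2)[of y x]
    unfolding dist_real_def by (intro conjI impI) auto
  then show ?thesis using \<open>\<delta> > 0\<close> by blast
qed

section \<open>Smooth maps and charts\<close>

lemma frechet_derivative_cong_open:
  assumes "open S" "x \<in> S" "\<And>y. y \<in> S \<Longrightarrow> f y = g y"
  shows "frechet_derivative f (at x) = frechet_derivative g (at x)"
proof -
  have "(f has_derivative D) (at x) \<longleftrightarrow> (g has_derivative D) (at x)" for D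
    using assms has_derivative_transform_within_open[of f D x UNIV S g]
      has_derivative_transform_within_open[of g D x UNIV S f] by auto
  then show ?thesis unfolding frechet_derivative_def by simp
qed

lemma Ck_on_cong_open:
  assumes "open S" "\<And>x. x \<in> S \<Longrightarrow> f x = g x" "Ck_on k S f"
  shows "Ck_on k S g"
  using assms(2,3)
proof (induction k arbitrary: f g)
  case 0
  then show ?case using continuous_on_cong[of S S f g] by simp
next
  case (Suc k)
  have "g differentiable (at x)" if "x \<in> S" for x
  proof -
    have "f differentiable (at x)" using Suc.prems(2) that by simp
    then obtain D where "(f has_derivative D) (at x)" unfolding differentiable_def ..
    then have "(g has_derivative D) (at x)"
      by (rule has_derivative_transform_within_open[OF _ assms(1) that Suc.prems(1)])
    then show ?thesis unfolding differentiable_def by blast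
  qed
  moreover have "Ck_on k S (\<lambda>x. frechet_derivative g (at x) v)" for v
  proof (rule Suc.IH)
    show "frechet_derivative f (at x) v = frechet_derivative g (at x) v" if "x \<in> S" for x
      using frechet_derivative_cong_open[OF assms(1) that Suc.prems(1)] by simp
    show "Ck_on k S (\<lambda>x. frechet_derivative f (at x) v)" using Suc.prems(2) by simp
  qed
  ultimately show ?case by simp
qed

text \<open>The derivative of the composition in direction \<open>v\<close> is the derivative of
  \<open>g\<close> in the fixed direction \<open>a *\<^sub>R v\<close>, again composed with the same
  affine map; hence the induction over all \<open>g\<close>. Its use is the reparametrisation of
  curves.\<close>

lemma Ck_on_compose_affine:
  assumes "open S" "\<And>x. x \<in> S \<Longrightarrow> a *\<^sub>R x + b \<in> T" "Ck_on k T g"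
  shows "Ck_on k S (\<lambda>x. g (a *\<^sub>R x + b))"
  using assms(3)
proof (induction k arbitrary: g)
  case 0
  then have "continuous_on S (g \<circ> (\<lambda>x. a *\<^sub>R x + b))"
    using assms(2) by (intro continuous_on_compose continuous_intros) (auto elim: continuous_on_subset)
  then show ?case by (simp add: o_def)
next
  case (Suc k)
  have D: "((\<lambda>x. g (a *\<^sub>R x + b)) has_derivative
      (\<lambda>v. frechet_derivative g (at (a *\<^sub>R x + b)) (a *\<^sub>R v))) (at x)" if "x \<in> S" for x
  proof -
    have "(g has_derivative frechet_derivative g (at (a *\<^sub>R x + b))) (at (a *\<^sub>R x + b))"
      using Suc.prems assms(2)[OF that] by (simp add: frechet_derivative_works[symmetric])
    moreover have "((\<lambda>x. a *\<^sub>R x + b) has_derivative (\<lambda>v. a *\<^sub>R v)) (at x)"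
      by (auto intro!: derivative_eq_intros)
    ultimately show ?thesis by (rule has_derivative_compose[rotated])
  qed
  have "Ck_on k S (\<lambda>x. frechet_derivative (\<lambda>x. g (a *\<^sub>R x + b)) (at x) v)" for v
  proof (rule Ck_on_cong_open[OF assms(1)])
    show "Ck_on k S (\<lambda>x. frechet_derivative g (at (a *\<^sub>R x + b)) (a *\<^sub>R v))"
      using Suc.prems by (intro Suc.IH[of "\<lambda>x. frechet_derivative g (at x) (a *\<^sub>R v)"]) simp
    show "frechet_derivative g (at (a *\<^sub>R x + b)) (a *\<^sub>R v) =
        frechet_derivative (\<lambda>x. g (a *\<^sub>R x + b)) (at x) v" if "x \<in> S" for x
      using frechet_derivative_at[OF D[OF that]] by (metis (no_types))
  qed
  moreover have "(\<lambda>x. g (a *\<^sub>R x + b)) differentiable (at x)" if "x \<in> S" for x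
    using D[OF that] unfolding differentiable_def by blast
  ultimately show ?case by simp
qed

lemma smooth_on_compose_affine:
  assumes "open S" "\<And>x. x \<in> S \<Longrightarrow> a *\<^sub>R x + b \<in> T" "smooth_on T g"
  shows "smooth_on S (\<lambda>x. g (a *\<^sub>R x + b))"
  using assms Ck_on_compose_affine unfolding smooth_on_def by blast

lemma Ck_on_const: "Ck_on k S (\<lambda>_. w)"
  by (induction k arbitrary: w) (auto simp: frechet_derivative_const)

lemma smooth_on_line: "smooth_on S (\<lambda>t::real. x + t *\<^sub>R v)"
  unfolding smooth_on_def
proof
  fix k
  show "Ck_on k S (\<lambda>t. x + t *\<^sub>R v)"
  proof (cases k)
    case 0
    then show ?thesis by (simp only: Ck_on.simps) (intro continuous_intros)
  next
    case (Suc m)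
    have D: "((\<lambda>t. x + t *\<^sub>R v) has_derivative (\<lambda>h. h *\<^sub>R v)) (at t)" for t
      by (auto intro!: derivative_eq_intros)
    then have "frechet_derivative (\<lambda>t. x + t *\<^sub>R v) (at t) = (\<lambda>h. h *\<^sub>R v)" for t
      using frechet_derivative_at[OF D] by simp
    then show ?thesis using Suc D Ck_on_const by (auto simp: differentiable_def)
  qed
qed

lemma smooth_onD:
  assumes "smooth_on S f"
  shows "continuous_on S f"
    and "x \<in> S \<Longrightarrow> (f has_derivative frechet_derivative f (at x)) (at x)"
    and "continuous_on S (\<lambda>x. frechet_derivative f (at x) v)"
    and "x \<in> S \<Longrightarrow> (\<lambda>x. frechet_derivative f (at x) v) differentiable (at x)"
proof -
  have "Ck_on 0 S f" "Ck_on (Suc 0) S f" "Ck_on (Suc (Suc 0)) S f"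
    using assms unfolding smooth_on_def by blast+
  then show "continuous_on S f"
    "x \<in> S \<Longrightarrow> (f has_derivative frechet_derivative f (at x)) (at x)"
    "continuous_on S (\<lambda>x. frechet_derivative f (at x) v)"
    "x \<in> S \<Longrightarrow> (\<lambda>x. frechet_derivative f (at x) v) differentiable (at x)"
    by (auto simp: frechet_derivative_works[symmetric])
qed

lemma smooth_on_has_vector_derivative:
  assumes "smooth_on S g" "t \<in> S"
  shows "(g has_vector_derivative frechet_derivative g (at t) 1) (at t)"
proof -
  have D: "(g has_derivative frechet_derivative g (at t)) (at t)"
    using smooth_onD(2)[OF assms] .
  then have "frechet_derivative g (at t) h = h *\<^sub>R frechet_derivative g (at t) 1" for h :: real
    using linear_cmul[OF has_derivative_linear[OF D], of h 1] by simp
  then show ?thesis using D unfolding has_vector_derivative_def by (metis (no_types) ext)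
qed

text \<open>Compute the derivative of \<open>f (t *\<^sub>R y)\<close> at \<open>t = 1\<close> by
  the chain rule and from the power of \<open>t\<close>. Homogeneity is asked on one open ray only,
  as the functions in question may fail to be smooth at 0.\<close>

lemma euler_homogeneous:
  fixes f :: "'a::real_normed_vector \<Rightarrow> real"
  assumes D: "(f has_derivative f') (at y)" and hom: "\<And>t. t > 0 \<Longrightarrow> f (t *\<^sub>R y) = t ^ k * f y"
  shows "f' y = real k * f y"
proof -
  have "((\<lambda>t. f (t *\<^sub>R y)) has_derivative (\<lambda>h. f' (h *\<^sub>R y))) (at 1)"
    by (rule has_derivative_compose[of "\<lambda>t. t *\<^sub>R y" "\<lambda>h. h *\<^sub>R y" 1 UNIV f f'])
      (use D in \<open>auto intro!: derivative_eq_intros\<close>)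
  then have "((\<lambda>t. t ^ k * f y) has_derivative (\<lambda>h. f' (h *\<^sub>R y))) (at 1)"
    by (rule has_derivative_transform_within_open[of _ _ _ _ "{0<..}"]) (use hom in auto)
  moreover have "((\<lambda>t. t ^ k * f y) has_derivative (\<lambda>h. h * (real k * f y))) (at 1)"
    by (auto intro!: derivative_eq_intros)
  ultimately have "(\<lambda>h. f' (h *\<^sub>R y)) = (\<lambda>h. h * (real k * f y))"
    by (rule has_derivative_unique)
  from fun_cong[OF this, of 1] show ?thesis by simp
qed

lemma linear_sum_axis:
  fixes h :: "real ^ 'n::finite \<Rightarrow> real"
  assumes "linear h"
  shows "(\<Sum>i\<in>UNIV. y $ i * h (axis i 1)) = h y"
proof -
  have "h y = h (\<Sum>i\<in>UNIV. (y $ i) *\<^sub>R axis i 1)"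
    using basis_expansion[of y] by (simp add: scalar_mult_eq_scaleR)
  also have "\<dots> = (\<Sum>i\<in>UNIV. y $ i * h (axis i 1))"
    by (simp add: linear_sum[OF assms] linear_cmul[OF assms])
  finally show ?thesis by simp
qed

section \<open>Charts, coordinate changes and tangent vectors\<close>

context smooth_manifold
begin

lemma chart_openin: "c \<in> A \<Longrightarrow> openin X (fst c)"
  and chart_open_image: "c \<in> A \<Longrightarrow> open (snd c ` fst c)"
  and chart_homeo: "c \<in> A \<Longrightarrow>
    homeomorphic_map (subtopology X (fst c)) (top_of_set (snd c ` fst c)) (snd c)"
  using charts unfolding chart_of_def by auto

lemma chart_subset: "c \<in> A \<Longrightarrow> fst c \<subseteq> topspace X"
  by (rule openin_subset[OF chart_openin])

lemma topspace_chart: "c \<in> A \<Longrightarrow> topspace (subtopology X (fst c)) = fst c"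
  using chart_subset[of c] by (simp add: topspace_subtopology Int_absorb1)

lemma chart_inj: "c \<in> A \<Longrightarrow> inj_on (snd c) (fst c)"
  using homeomorphic_imp_injective_map[OF chart_homeo] topspace_chart by simp

lemma chart_inv_left: "c \<in> A \<Longrightarrow> p \<in> fst c \<Longrightarrow> chart_inv c (snd c p) = p"
  unfolding chart_inv_def by (simp add: chart_inj)

lemma chart_inv_right: "x \<in> snd c ` fst c \<Longrightarrow> snd c (chart_inv c x) = x"
  unfolding chart_inv_def by (rule f_inv_into_f)

lemma chart_inv_in: "x \<in> snd c ` fst c \<Longrightarrow> chart_inv c x \<in> fst c"
  unfolding chart_inv_def by (rule inv_into_into)

lemma coord_change_apply: "c \<in> A \<Longrightarrow> p \<in> fst c \<Longrightarrow> coord_change c d (snd c p) = snd d p"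
  by (simp add: coord_change_def chart_inv_left)

lemma chart_continuous_map: "c \<in> A \<Longrightarrow> continuous_map (subtopology X (fst c)) euclidean (snd c)"
  using homeomorphic_imp_continuous_map[OF chart_homeo] by (simp add: continuous_map_in_subtopology)

lemma chart_inv_continuous_map:
  assumes "c \<in> A"
  shows "continuous_map (top_of_set (snd c ` fst c)) X (chart_inv c)"
proof -
  obtain h where h: "homeomorphic_maps (subtopology X (fst c)) (top_of_set (snd c ` fst c)) (snd c) h"
    using chart_homeo[OF assms] homeomorphic_map_maps by blast
  have "continuous_map (top_of_set (snd c ` fst c)) (subtopology X (fst c)) h"
    using h by (simp add: homeomorphic_maps_def)
  then have "continuous_map (top_of_set (snd c ` fst c)) X h"
    by (simp add: continuous_map_in_subtopology)
  moreover have "h x = chart_inv c x" if "x \<in> snd c ` fst c" for x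
    using h that topspace_chart[OF assms] chart_inv_left[OF assms]
    by (auto simp: homeomorphic_maps_def)
  ultimately show ?thesis by (auto intro: continuous_map_eq)
qed

lemma chart_image_open:
  assumes "c \<in> A" "openin X U"
  shows "open (snd c ` (fst c \<inter> U))"
proof -
  have "openin (subtopology X (fst c)) (fst c \<inter> U)"
    using assms(2) by (simp add: Int_commute openin_subtopology_Int)
  then have "openin (top_of_set (snd c ` fst c)) (snd c ` (fst c \<inter> U))"
    using homeomorphic_map_openness_eq[OF chart_homeo[OF assms(1)]] by blast
  then show ?thesis using chart_open_image[OF assms(1)] openin_open_eq by blast
qed

lemma chart_preimage_openin:
  assumes "c \<in> A" "open W"
  shows "openin X {p \<in> fst c. snd c p \<in> W}"
proof -
  have "openin (subtopology X (fst c)) {p \<in> topspace (subtopology X (fst c)). snd c p \<in> W}"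
    using chart_continuous_map[OF assms(1)] assms(2)
    by (intro openin_continuous_map_preimage) auto
  then have "openin (subtopology X (fst c)) {p \<in> fst c. snd c p \<in> W}"
    unfolding topspace_chart[OF assms(1)] .
  then show ?thesis
    using openin_open_subtopology[OF chart_openin[OF assms(1)]] by blast
qed

lemma coord_change_has_derivative:
  assumes "c \<in> A" "d \<in> A" "p \<in> fst c" "p \<in> fst d"
  shows "(coord_change c d has_derivative frechet_derivative (coord_change c d) (at (snd c p)))
    (at (snd c p))"
proof -
  have "smooth_on (snd c ` (fst c \<inter> fst d)) (coord_change c d)"
    using compatible[OF assms(1,2)] by (simp add: smoothly_compatible_def)
  from smooth_onD(2)[OF this] show ?thesis using assms by blast
qed

text \<open>The chain rule for the composition of coordinate changes on a triple overlap. This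
  cocycle identity is what makes \<open>tvec_of\<close> a tangent vector.\<close>

lemma coord_change_chain:
  assumes "c \<in> A" "d \<in> A" "e \<in> A" "p \<in> fst c" "p \<in> fst d" "p \<in> fst e"
  shows "frechet_derivative (coord_change d e) (at (snd d p))
      (frechet_derivative (coord_change c d) (at (snd c p)) y) =
    frechet_derivative (coord_change c e) (at (snd c p)) y"
proof -
  have D: "(coord_change c e has_derivative
      (\<lambda>y. frechet_derivative (coord_change d e) (at (snd d p))
        (frechet_derivative (coord_change c d) (at (snd c p)) y))) (at (snd c p))"
  proof (rule has_derivative_transform_within_open)
    show "((\<lambda>x. coord_change d e (coord_change c d x)) has_derivative
      (\<lambda>y. frechet_derivative (coord_change d e) (at (snd d p))
        (frechet_derivative (coord_change c d) (at (snd c p)) y))) (at (snd c p))"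
      by (rule has_derivative_compose[OF coord_change_has_derivative])
        (use assms coord_change_has_derivative in \<open>auto simp: coord_change_apply\<close>)
    show "open (snd c ` (fst c \<inter> fst d))"
      using assms by (intro chart_image_open chart_openin)
    show "snd c p \<in> snd c ` (fst c \<inter> fst d)" using assms by blast
    show "coord_change d e (coord_change c d x) = coord_change c e x"
      if "x \<in> snd c ` (fst c \<inter> fst d)" for x
      using that assms by (auto simp: coord_change_apply)
  qed
  from frechet_derivative_at[OF D] show ?thesis by metis
qed

lemma tvec_of_in_tangent_bundle:
  assumes "c \<in> A" "p \<in> fst c"
  shows "(p, tvec_of A c p y) \<in> tangent_bundle X A"
proof -
  have "p \<in> topspace X" using assms chart_subset by blast
  moreover have "tvec_of A c p y e =
      frechet_derivative (coord_change d e) (at (snd d p)) (tvec_of A c p y d)"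
    if "d \<in> charts_at A p" "e \<in> charts_at A p" for d e
    using that coord_change_chain[OF assms(1) _ _ assms(2), of d e y]
    by (simp add: tvec_of_def charts_at_def)
  moreover have "tvec_of A c p y \<in> charts_at A p \<rightarrow>\<^sub>E UNIV"
    by (simp add: tvec_of_def)
  ultimately show ?thesis unfolding tangent_bundle_def tangent_space_def by blast
qed

lemma tscale_tvec_of:
  assumes "c \<in> A" "p \<in> fst c"
  shows "tscale A p r (tvec_of A c p y) = tvec_of A c p (r *\<^sub>R y)"
proof -
  have "r *\<^sub>R frechet_derivative (coord_change c d) (at (snd c p)) y =
      frechet_derivative (coord_change c d) (at (snd c p)) (r *\<^sub>R y)" if "d \<in> A" "p \<in> fst d" for d
    using linear_cmul[OF has_derivative_linear[OF coord_change_has_derivative[OF assms(1) that(1) assms(2) that(2)]]]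
    by simp
  then show ?thesis by (auto simp: tscale_def tvec_of_def charts_at_def fun_eq_iff)
qed

text \<open>By the chain rule the derivative in one chart determines those in all others. The curve
  has to stay in the domain of \<open>c\<close> near \<open>t\<close>, since
  \<open>coord_change\<close> is meaningful only there.\<close>

lemma velocity_eq_tvec_of:
  assumes c: "c \<in> A" and T: "open T" "t \<in> T" "\<And>r. r \<in> T \<Longrightarrow> \<gamma> r \<in> fst c"
    and D: "((\<lambda>r. snd c (\<gamma> r)) has_vector_derivative w) (at t)"
  shows "velocity A \<gamma> t = tvec_of A c (\<gamma> t) w"
proof -
  have "vector_derivative (snd d \<circ> \<gamma>) (at t) =
      frechet_derivative (coord_change c d) (at (snd c (\<gamma> t))) w"
    if d: "d \<in> A" "\<gamma> t \<in> fst d" for d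
  proof (rule vector_derivative_at, rule has_vector_derivative_transform_within_open)
    let ?D = "frechet_derivative (coord_change c d) (at (snd c (\<gamma> t)))"
    have CD: "(coord_change c d has_derivative ?D) (at (snd c (\<gamma> t)))"
      using coord_change_has_derivative[OF c d(1)] T d by blast
    have "((\<lambda>r. coord_change c d (snd c (\<gamma> r))) has_derivative (\<lambda>h. ?D (h *\<^sub>R w))) (at t)"
      using D CD unfolding has_vector_derivative_def by (rule has_derivative_compose)
    then show "((\<lambda>r. coord_change c d (snd c (\<gamma> r))) has_vector_derivative ?D w) (at t)"
      unfolding has_vector_derivative_def
      by (simp add: linear_cmul[OF has_derivative_linear[OF CD]])
    show "coord_change c d (snd c (\<gamma> r)) = (snd d \<circ> \<gamma>) r" if "r \<in> T" for r
      using T(3)[OF that] c by (simp add: coord_change_apply)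
  qed (use T in auto)
  then show ?thesis by (auto simp: velocity_def tvec_of_def charts_at_def fun_eq_iff)
qed

end

section \<open>Positivity and norm bounds of the local expressions\<close>

context finsler_manifold
begin

abbreviation LE where "LE \<equiv> local_expr A F"

lemma local_expr_chart:
  assumes "c \<in> A" "p \<in> fst c"
  shows "LE c (snd c p, y) = F (p, tvec_of A c p y)"
  using assms by (simp add: local_expr_def chart_inv_left)

lemma local_expr_nonneg:
  assumes "c \<in> A" "x \<in> snd c ` fst c"
  shows "0 \<le> LE c (x, y)"
proof -
  obtain p where p: "p \<in> fst c" "x = snd c p" using assms(2) by blast
  then show ?thesis
    using local_expr_chart[OF assms(1) p(1)] nonneg[OF tvec_of_in_tangent_bundle[OF assms(1) p(1)]]
    by simp
qed

lemma local_expr_scale: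
  assumes "c \<in> A" "x \<in> snd c ` fst c" "0 \<le> r"
  shows "LE c (x, r *\<^sub>R y) = r * LE c (x, y)"
proof -
  obtain p where p: "p \<in> fst c" "x = snd c p" using assms(2) by blast
  have "F (p, tvec_of A c p (r *\<^sub>R y)) = r * F (p, tvec_of A c p y)"
    using homogeneous[OF tvec_of_in_tangent_bundle[OF assms(1) p(1)] assms(3), of y]
    by (simp add: tscale_tvec_of[OF assms(1) p(1)])
  then show ?thesis using p local_expr_chart[OF assms(1) p(1)] by simp
qed

text \<open>By Euler's theorem the Hessian of \<open>F\<^sup>2/2\<close> at \<open>y\<close>, applied twice to \<open>y\<close>, is \<open>F\<^sup>2\<close>.\<close>

lemma local_expr_pos:
  assumes c: "c \<in> A" and x: "x \<in> snd c ` fst c" and y: "y \<noteq> 0"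
  shows "0 < LE c (x, y)"
proof -
  let ?L = "LE c" and ?S = "(snd c ` fst c) \<times> (UNIV - {0})"
  \<comment> \<open>The derivative along the fibre: the base point \<open>x\<close> is fixed by
    composing with the inclusion of \<open>z\<close> as \<open>(x, z)\<close>.\<close>
  define DL where "DL z h = frechet_derivative ?L (at (x, z)) (0, h)" for z h
  define E where "E z = 1/2 * (?L (x, z))\<^sup>2" for z
  note sm = smooth[OF c]
  have pair: "((\<lambda>z. (x, z)) has_derivative (\<lambda>h. (0, h))) (at z)" for z :: "real ^ 'n"
    by (auto intro!: derivative_eq_intros)
  have D_L: "((\<lambda>z. ?L (x, z)) has_derivative DL z) (at z)" if "z \<noteq> 0" for z
    unfolding DL_def using smooth_onD(2)[OF sm, of "(x, z)"] x that
    by (intro has_derivative_compose[OF pair]) auto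
  have D_E: "(E has_derivative (\<lambda>h. ?L (x, z) * DL z h)) (at z)" if "z \<noteq> 0" for z
    unfolding E_def[abs_def] using D_L[OF that]
    by (auto intro!: derivative_eq_intros)
  \<comment> \<open>\<open>g h z\<close> is the derivative of \<open>E\<close> at \<open>z\<close>
    in direction \<open>h\<close>. Its derivatives in \<open>z\<close> give the Hessian, and it is
    homogeneous of degree 1 in \<open>z\<close>.\<close>
  define g where "g h z = ?L (x, z) * DL z h" for h z
  have pd: "partial_deriv i E z = g (axis i 1) z" if "z \<noteq> 0" for i z
    using frechet_derivative_at[OF D_E[OF that]] unfolding partial_deriv_def g_def by metis
  have g_diff: "g h differentiable (at z)" if "z \<noteq> 0" for h z
  proof -
    have "(\<lambda>q. frechet_derivative ?L (at q) (0, h)) differentiable (at (x, z))"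
      using smooth_onD(4)[OF sm, of "(x, z)"] x that by auto
    then have "(\<lambda>z. DL z h) differentiable (at z)"
      using has_derivative_compose[OF pair] unfolding DL_def differentiable_def by blast
    moreover have "(\<lambda>z. ?L (x, z)) differentiable (at z)"
      using D_L[OF that] unfolding differentiable_def by blast
    ultimately show ?thesis unfolding g_def by (intro differentiable_mult)
  qed
  have E_hom: "E (t *\<^sub>R z) = t\<^sup>2 * E z" if "t > 0" for t z
    using local_expr_scale[OF c x, of t z] that by (simp add: E_def power_mult_distrib)
  \<comment> \<open>Differentiating \<open>E (t *\<^sub>R z)\<close> in \<open>z\<close> in two ways
    gives \<open>t * g h (t *\<^sub>R z)\<close> on one side and the square of \<open>t\<close>
    times \<open>g h z\<close> on the other; divide by \<open>t\<close>.\<close>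
  have g_hom: "g h (t *\<^sub>R z) = t ^ 1 * g h z" if "t > 0" "z \<noteq> 0" for t z h
  proof -
    have tz: "t *\<^sub>R z \<noteq> 0" using that by simp
    have "((\<lambda>z. t *\<^sub>R z) has_derivative (\<lambda>h. t *\<^sub>R h)) (at z)"
      by (auto intro!: derivative_eq_intros)
    from has_derivative_compose[OF this D_E[OF tz]]
    have "((\<lambda>z. E (t *\<^sub>R z)) has_derivative (\<lambda>h. g (t *\<^sub>R h) (t *\<^sub>R z))) (at z)"
      unfolding g_def .
    moreover have "((\<lambda>z. E (t *\<^sub>R z)) has_derivative (\<lambda>h. t\<^sup>2 * g h z)) (at z)"
      unfolding E_hom[OF that(1)] g_def by (rule has_derivative_mult_right[OF D_E[OF that(2)]])
    ultimately have "(\<lambda>h. g (t *\<^sub>R h) (t *\<^sub>R z)) = (\<lambda>h. t\<^sup>2 * g h z)"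
      by (rule has_derivative_unique)
    then have "g (t *\<^sub>R h) (t *\<^sub>R z) = t\<^sup>2 * g h z"
      by (rule fun_cong)
    moreover have "g (t *\<^sub>R h) (t *\<^sub>R z) = t * g h (t *\<^sub>R z)"
      using linear_cmul[OF has_derivative_linear[OF D_E[OF tz]], of t h] by (simp add: g_def)
    ultimately show ?thesis using that(1) by (simp add: power2_eq_square)
  qed
  let ?G = "fundamental_tensor A F c x y"
  have G: "?G $ i $ j = frechet_derivative (g (axis i 1)) (at y) (axis j 1)" for i j
  proof -
    have "frechet_derivative (partial_deriv i E) (at y) = frechet_derivative (g (axis i 1)) (at y)"
      by (rule frechet_derivative_cong_open[of "UNIV - {0}"]) (use y pd in auto)
    then show ?thesis
      unfolding fundamental_tensor_def E_def[abs_def] by (simp add: partial_deriv_def)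
  qed
  have Gy: "(?G *v y) $ i = g (axis i 1) y" for i
  proof -
    have D: "(g (axis i 1) has_derivative frechet_derivative (g (axis i 1)) (at y)) (at y)"
      using g_diff[OF y] by (simp add: frechet_derivative_works[symmetric])
    have "(?G *v y) $ i = (\<Sum>j\<in>UNIV. y $ j * frechet_derivative (g (axis i 1)) (at y) (axis j 1))"
      by (simp add: matrix_vector_mult_def G mult.commute)
    also have "\<dots> = frechet_derivative (g (axis i 1)) (at y) y"
      by (rule linear_sum_axis[OF has_derivative_linear[OF D]])
    also have "\<dots> = g (axis i 1) y"
      using euler_homogeneous[OF D g_hom] y by simp
    finally show ?thesis .
  qed
  \<comment> \<open>\<open>Gy\<close> used Euler's theorem in degree 1 for \<open>g\<close>; now it
    is used in degree 2 for \<open>E\<close>.\<close>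
  have "y \<bullet> (?G *v y) = (\<Sum>i\<in>UNIV. y $ i * g (axis i 1) y)"
    by (simp add: inner_vec_def Gy)
  also have "\<dots> = g y y"
    using linear_sum_axis[OF has_derivative_linear[OF D_E[OF y]]] by (simp add: g_def)
  also have "\<dots> = 2 * E y"
    using euler_homogeneous[OF D_E[OF y] E_hom] by (simp add: g_def)
  finally have "0 < 2 * E y"
    using pos_def[OF c x y] y unfolding positive_definite_def by auto
  then have "?L (x, y) \<noteq> 0" by (auto simp: E_def)
  then show ?thesis using local_expr_nonneg[OF c x, of y] by simp
qed

lemma local_expr_zero:
  assumes "c \<in> A" "x \<in> snd c ` fst c"
  shows "LE c (x, 0) = 0"
  using local_expr_scale[OF assms, of 0 0] by simp

text \<open>The constants are the minimum and the maximum over \<open>K\<close> times the unit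
  sphere, positive by \<open>local_expr_pos\<close>. Homogeneity extends the estimates to all
  vectors.\<close>

lemma local_expr_norm_bounds:
  assumes c: "c \<in> A" and K: "compact K" "K \<subseteq> snd c ` fst c"
  obtains m M where "m > 0" "M > 0"
    "\<And>x y. x \<in> K \<Longrightarrow> m * norm y \<le> LE c (x, y)" "\<And>x y. x \<in> K \<Longrightarrow> LE c (x, y) \<le> M * norm y"
proof (cases "K = {}")
  case True
  then show ?thesis using that[of 1 1] by simp
next
  case False
  let ?S = "K \<times> sphere (0::real^'n) 1"
  have cont: "continuous_on ?S (LE c)"
    using continuous[OF c] by (rule continuous_on_subset) (use K in auto)
  have "compact ?S" using K by (intro compact_Times) auto
  moreover have "?S \<noteq> {}" using False by auto
  ultimately obtain q Q where q: "q \<in> ?S" "\<And>r. r \<in> ?S \<Longrightarrow> LE c q \<le> LE c r"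
    and Q: "Q \<in> ?S" "\<And>r. r \<in> ?S \<Longrightarrow> LE c r \<le> LE c Q"
    using continuous_attains_inf[OF _ _ cont] continuous_attains_sup[OF _ _ cont] by metis
  have pos: "0 < LE c r" if "r \<in> ?S" for r
  proof -
    have "fst r \<in> snd c ` fst c" "snd r \<noteq> 0"
      using that subsetD[OF K(2), of "fst r"] by auto
    from local_expr_pos[OF c this] show ?thesis by simp
  qed
  have eq: "LE c (x, y) = norm y * LE c (x, sgn y)" if "x \<in> K" for x y
  proof -
    have "norm y *\<^sub>R sgn y = y" by (cases "y = 0") (simp_all add: sgn_div_norm)
    then show ?thesis using local_expr_scale[OF c subsetD[OF K(2) that], of "norm y" "sgn y"] by simp
  qed
  show ?thesis
  proof (rule that[of "LE c q" "LE c Q"])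
    fix x and y :: "real ^ 'n" assume x: "x \<in> K"
    show "LE c q * norm y \<le> LE c (x, y)" "LE c (x, y) \<le> LE c Q * norm y"
    proof (atomize(full), cases "y = 0")
      case True
      then show "LE c q * norm y \<le> LE c (x, y) \<and> LE c (x, y) \<le> LE c Q * norm y"
        using local_expr_zero[OF c] x K by auto
    next
      case False
      then have "(x, sgn y) \<in> ?S" using x by (simp add: norm_sgn)
      then show "LE c q * norm y \<le> LE c (x, y) \<and> LE c (x, y) \<le> LE c Q * norm y"
        using eq[OF x, of y] mult_left_mono[OF q(2), of "(x, sgn y)" "norm y"]
          mult_left_mono[OF Q(2), of "(x, sgn y)" "norm y"]
        by (simp add: mult.commute)
    qed
  qed (use pos q Q in auto)
qed

end

section \<open>Piecewise smooth paths and their length\<close>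

text \<open>Intended for speeds, which carry no information at break points and endpoints.\<close>

lemma integral_le_off_finite:
  fixes f g :: "real \<Rightarrow> real"
  assumes "f integrable_on I" "g integrable_on I" "finite S" "\<And>x. x \<in> I - S \<Longrightarrow> f x \<le> g x"
  shows "integral I f \<le> integral I g"
proof -
  let ?f = "\<lambda>x. if x \<in> S then g x else f x"
  have "integral I f = integral I ?f"
    by (rule integral_spike[OF negligible_finite[OF assms(3)]]) auto
  also have "\<dots> \<le> integral I g"
  proof (rule integral_le)
    show "?f integrable_on I"
      by (rule integrable_spike_finite[OF assms(3) _ assms(1)]) auto
  qed (use assms in auto)
  finally show ?thesis .
qed

lemma piecewise_partition_cover:
  fixes \<tau> :: "nat \<Rightarrow> real"
  assumes "u \<in> {\<tau> 0..\<tau> m}" "u \<notin> \<tau> ` {..m}"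
  shows "\<exists>i<m. u \<in> {\<tau> i<..<\<tau> (Suc i)}"
  using assms
proof (induction m)
  case (Suc m)
  show ?case
  proof (cases "u \<le> \<tau> m")
    case True
    then have "\<exists>i<m. u \<in> {\<tau> i<..<\<tau> (Suc i)}" using Suc by (intro Suc.IH) auto
    then show ?thesis using less_SucI by blast
  next
    case False
    moreover have "u \<noteq> \<tau> (Suc m)" using Suc.prems(2) by auto
    ultimately show ?thesis using Suc.prems(1) by (intro exI[of _ m]) auto
  qed
qed auto

context smooth_manifold
begin

definition regular_at :: "(real \<Rightarrow> 'a) \<Rightarrow> real \<Rightarrow> bool" where
  "regular_at \<gamma> u \<longleftrightarrow> \<gamma> u \<in> topspace X \<and>
     (\<forall>d\<in>A. \<gamma> u \<in> fst d \<longrightarrow> (\<exists>w T. open T \<and> u \<in> T \<and> (\<forall>r\<in>T. \<gamma> r \<in> fst d) \<and>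
        ((\<lambda>r. snd d (\<gamma> r)) has_vector_derivative w) (at u)))"

lemma regular_atE:
  assumes "regular_at \<gamma> u" "d \<in> A" "\<gamma> u \<in> fst d"
  obtains w T where "open T" "u \<in> T" "\<And>r. r \<in> T \<Longrightarrow> \<gamma> r \<in> fst d"
    "((\<lambda>r. snd d (\<gamma> r)) has_vector_derivative w) (at u)" "velocity A \<gamma> u = tvec_of A d (\<gamma> u) w"
proof -
  from assms obtain w T where T: "open T" "u \<in> T" "\<forall>r\<in>T. \<gamma> r \<in> fst d"
    "((\<lambda>r. snd d (\<gamma> r)) has_vector_derivative w) (at u)"
    unfolding regular_at_def by blast
  with velocity_eq_tvec_of[OF assms(2) T(1,2)] show thesis by (intro that[of T w]) auto
qed

lemma regular_at_chart:
  assumes "regular_at \<gamma> u"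
  obtains d where "d \<in> A" "\<gamma> u \<in> fst d"
  using assms cover unfolding regular_at_def by blast

text \<open>At an interior point the curve agrees with the extension \<open>g\<close> on a whole
  neighbourhood, and a coordinate change turns the derivative of \<open>g\<close> into one in any
  other chart.\<close>

lemma smooth_curve_regular_at:
  assumes \<gamma>: "smooth_curve_on A {s..t} \<gamma>" and u: "u \<in> {s<..<t}"
  shows "regular_at \<gamma> u"
proof -
  have "u \<in> {s..t}" using u by simp
  then obtain c e g where c: "c \<in> A" and e: "e > 0" and g: "smooth_on {u - e<..<u + e} g"
    and eq: "\<forall>r \<in> {s..t} \<inter> {u - e<..<u + e}. \<gamma> r \<in> fst c \<and> snd c (\<gamma> r) = g r"
    using \<gamma> unfolding smooth_curve_on_def by blast
  define T0 where "T0 = {s<..<t} \<inter> {u - e<..<u + e}"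
  have T0: "open T0" "u \<in> T0" using u e by (auto simp: T0_def)
  have eq': "\<gamma> r \<in> fst c" "snd c (\<gamma> r) = g r" if "r \<in> T0" for r
    using eq that by (auto simp: T0_def)
  have cont: "continuous_on T0 g"
    using smooth_onD(1)[OF g] by (rule continuous_on_subset) (auto simp: T0_def)
  have "\<exists>w T. open T \<and> u \<in> T \<and> (\<forall>r\<in>T. \<gamma> r \<in> fst d) \<and>
        ((\<lambda>r. snd d (\<gamma> r)) has_vector_derivative w) (at u)"
    if d: "d \<in> A" "\<gamma> u \<in> fst d" for d
  proof -
    let ?W = "snd c ` (fst c \<inter> fst d)"
    define T where "T = T0 \<inter> g -` ?W"
    have "open T"
      unfolding T_def
      by (intro continuous_open_preimage cont T0 chart_image_open c chart_openin d)
    moreover have "u \<in> T"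
      using T0 eq'[OF T0(2)] d(2) unfolding T_def by (auto intro!: image_eqI[of _ _ "\<gamma> u"])
    moreover have T_sub: "\<gamma> r \<in> fst d" if "r \<in> T" for r
    proof -
      have r: "r \<in> T0" "g r \<in> ?W" using that by (auto simp: T_def)
      then obtain q where "q \<in> fst c" "q \<in> fst d" "snd c q = snd c (\<gamma> r)" using eq'(2) by auto
      then show ?thesis using chart_inj[OF c] eq'(1)[OF r(1)] by (metis inj_onD)
    qed
    moreover have "((\<lambda>r. snd d (\<gamma> r)) has_vector_derivative
        frechet_derivative (coord_change c d) (at (g u)) (frechet_derivative g (at u) 1)) (at u)"
    proof (rule has_vector_derivative_transform_within_open)
      have D: "(coord_change c d has_derivative frechet_derivative (coord_change c d) (at (g u))) (at (g u))"
        using coord_change_has_derivative[OF c d(1) eq'(1)[OF T0(2)] d(2)] eq'(2)[OF T0(2)] by simp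
      have "(g has_vector_derivative frechet_derivative g (at u) 1) (at u)"
        using smooth_on_has_vector_derivative[OF g] e by auto
      from has_derivative_compose[OF this[unfolded has_vector_derivative_def] D]
      show "((\<lambda>r. coord_change c d (g r)) has_vector_derivative
        frechet_derivative (coord_change c d) (at (g u)) (frechet_derivative g (at u) 1)) (at u)"
        unfolding has_vector_derivative_def
        by (simp add: linear_cmul[OF has_derivative_linear[OF D]])
      show "coord_change c d (g r) = snd d (\<gamma> r)" if "r \<in> T" for r
      proof -
        have "r \<in> T0" using that by (simp add: T_def)
        then show ?thesis using coord_change_apply[OF c eq'(1)] eq'(2) by metis
      qed
    qed fact+
    ultimately show ?thesis by blast
  qed
  moreover have "\<gamma> u \<in> topspace X" using eq'(1)[OF T0(2)] chart_subset[OF c] by blast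
  ultimately show ?thesis unfolding regular_at_def by blast
qed

lemma smooth_curve_on_affine:
  assumes \<gamma>: "smooth_curve_on A {s..t} \<gamma>" and a: "a > 0"
    and s: "a * s' + b = s" and t: "a * t' + b = t"
    and eq: "\<And>r. r \<in> {s'..t'} \<Longrightarrow> \<gamma>' r = \<gamma> (a * r + b)"
  shows "smooth_curve_on A {s'..t'} \<gamma>'"
  unfolding smooth_curve_on_def
proof
  fix u assume "u \<in> {s'..t'}"
  have sub: "a * r + b \<in> {s..t}" if "r \<in> {s'..t'}" for r
    using that a unfolding s[symmetric] t[symmetric] by auto
  from sub[OF \<open>u \<in> {s'..t'}\<close>]
  obtain c e g where c: "c \<in> A" and e: "e > 0"
    and g: "smooth_on {a * u + b - e<..<a * u + b + e} g"
    and g_eq: "\<forall>r \<in> {s..t} \<inter> {a * u + b - e<..<a * u + b + e}. \<gamma> r \<in> fst c \<and> snd c (\<gamma> r) = g r"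
    using \<gamma> unfolding smooth_curve_on_def by meson
  have in_e: "a * r + b \<in> {a * u + b - e<..<a * u + b + e}" if "r \<in> {u - e / a<..<u + e / a}" for r
  proof -
    have "a * (u - e / a) < a * r" "a * r < a * (u + e / a)"
      using that a by (auto intro!: mult_strict_left_mono)
    then show ?thesis using a by (auto simp: algebra_simps)
  qed
  have "smooth_on {u - e / a<..<u + e / a} (\<lambda>r. g (a *\<^sub>R r + b))"
    using in_e by (intro smooth_on_compose_affine[OF _ _ g]) auto
  moreover have "\<gamma>' r \<in> fst c \<and> snd c (\<gamma>' r) = g (a *\<^sub>R r + b)"
    if "r \<in> {s'..t'} \<inter> {u - e / a<..<u + e / a}" for r
    using that eq[of r] g_eq sub[of r] in_e[of r] by simp
  ultimately show "\<exists>c\<in>A. \<exists>e>0. \<exists>g. smooth_on {u - e<..<u + e} g \<and>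
        (\<forall>r \<in> {s'..t'} \<inter> {u - e<..<u + e}. \<gamma>' r \<in> fst c \<and> snd c (\<gamma>' r) = g r)"
    using c e a by (intro bexI[of _ c] exI[of _ "e / a"] exI[of _ "\<lambda>r. g (a *\<^sub>R r + b)"]) auto
qed

end

context finsler_manifold
begin

definition speed :: "(real \<Rightarrow> 'a) \<Rightarrow> real \<Rightarrow> real" where
  "speed \<gamma> t = F (\<gamma> t, velocity A \<gamma> t)"

lemma speed_chart:
  assumes "d \<in> A" "open T" "t \<in> T" "\<And>r. r \<in> T \<Longrightarrow> \<gamma> r \<in> fst d"
    and "((\<lambda>r. snd d (\<gamma> r)) has_vector_derivative w) (at t)"
  shows "speed \<gamma> t = LE d (snd d (\<gamma> t), w)"
  unfolding speed_def using velocity_eq_tvec_of[OF assms] local_expr_chart[OF assms(1)] assms(3,4) by simp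

lemma speed_nonneg: "regular_at \<gamma> u \<Longrightarrow> 0 \<le> speed \<gamma> u"
proof -
  assume r: "regular_at \<gamma> u"
  then obtain d where d: "d \<in> A" "\<gamma> u \<in> fst d" by (rule regular_at_chart)
  from r d show ?thesis
  proof (rule regular_atE)
    fix w assume "velocity A \<gamma> u = tvec_of A d (\<gamma> u) w"
    then show ?thesis
      unfolding speed_def using nonneg[OF tvec_of_in_tangent_bundle[OF d]] by simp
  qed
qed

text \<open>The chain rule multiplies the velocity by \<open>a\<close>. Since \<open>F\<close> is
  only positively homogeneous, the reparametrisation must not reverse the curve.\<close>

lemma speed_affine:
  assumes r: "regular_at \<gamma> (a * u + b)" and a: "0 \<le> a"
    and T: "open T" "u \<in> T" "\<And>r. r \<in> T \<Longrightarrow> \<gamma>' r = \<gamma> (a * r + b)"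
  shows "speed \<gamma>' u = a * speed \<gamma> (a * u + b)"
proof -
  obtain d where d: "d \<in> A" "\<gamma> (a * u + b) \<in> fst d" using r by (rule regular_at_chart)
  obtain w S where S: "open S" "a * u + b \<in> S" "\<And>r. r \<in> S \<Longrightarrow> \<gamma> r \<in> fst d"
    "((\<lambda>r. snd d (\<gamma> r)) has_vector_derivative w) (at (a * u + b))"
    using regular_atE[OF r d] by metis
  define T' where "T' = T \<inter> (\<lambda>r. a * r + b) -` S"
  have T': "open T'" "u \<in> T'"
    unfolding T'_def using T(1,2) S(1,2)
    by (auto intro!: open_Int open_vimage continuous_intros)
  have in': "\<gamma>' r \<in> fst d" if "r \<in> T'" for r
    using that T(3) S(3) by (auto simp: T'_def)
  have "((\<lambda>r. snd d (\<gamma>' r)) has_vector_derivative a *\<^sub>R w) (at u)"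
  proof (rule has_vector_derivative_transform_within_open[OF _ T(1,2)])
    have "((\<lambda>r. a * r + b) has_vector_derivative a) (at u)"
      by (auto intro!: derivative_eq_intros)
    from vector_diff_chain_at[OF this S(4)]
    show "((\<lambda>r. snd d (\<gamma> (a * r + b))) has_vector_derivative a *\<^sub>R w) (at u)"
      by (simp add: o_def)
  qed (simp add: T(3))
  from speed_chart[OF d(1) T' in' this]
  have "speed \<gamma>' u = LE d (snd d (\<gamma> (a * u + b)), a *\<^sub>R w)" using T(2,3) by simp
  also have "\<dots> = a * LE d (snd d (\<gamma> (a * u + b)), w)"
    using d a by (intro local_expr_scale) auto
  also have "LE d (snd d (\<gamma> (a * u + b)), w) = speed \<gamma> (a * u + b)"
    using speed_chart[OF d(1) S] by simp
  finally show ?thesis .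
qed

text \<open>Near each point the speed agrees with the continuous function \<open>?h\<close> of the
  smooth extension. The exceptions are the ends of the subinterval, where the two-sided derivative
  in \<open>velocity\<close> may depend on the curve outside it.\<close>

lemma speed_integrable_smooth:
  assumes \<gamma>: "smooth_curve_on A {s..t} \<gamma>"
  shows "speed \<gamma> integrable_on {s..t}"
proof -
  have "\<exists>e>0. \<forall>u v. x \<in> {u..v} \<and> {u..v} \<subseteq> ball x e \<and> {u..v} \<subseteq> {s..t} \<longrightarrow>
      speed \<gamma> integrable_on {u..v}" if x: "x \<in> {s..t}" for x
  proof -
    obtain c e g where c: "c \<in> A" and e: "e > 0" and g: "smooth_on {x - e<..<x + e} g"
      and eq: "\<forall>r \<in> {s..t} \<inter> {x - e<..<x + e}. \<gamma> r \<in> fst c \<and> snd c (\<gamma> r) = g r"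
      using \<gamma> x unfolding smooth_curve_on_def by meson
    have "speed \<gamma> integrable_on {u..v}"
      if uv: "{u..v} \<subseteq> ball x e" "{u..v} \<subseteq> {s..t}" for u v
    proof (rule integrable_spike_finite[of "{u, v}"])
      have in_e: "r \<in> {x - e<..<x + e}" if "r \<in> {u..v}" for r
        using subsetD[OF uv(1) that] by (auto simp: ball_def dist_real_def)
      have eq': "\<gamma> r \<in> fst c" "snd c (\<gamma> r) = g r" if "r \<in> {u..v}" for r
        using eq in_e[OF that] subsetD[OF uv(2) that] by blast+
      let ?h = "\<lambda>r. LE c (g r, frechet_derivative g (at r) 1)"
      have sub: "{u..v} \<subseteq> {x - e<..<x + e}" using in_e by blast
      have "continuous_on {u..v} (\<lambda>r. (g r, frechet_derivative g (at r) 1))"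
        by (intro continuous_on_Pair continuous_on_subset[OF smooth_onD(1)[OF g] sub]
            continuous_on_subset[OF smooth_onD(3)[OF g] sub])
      moreover have "(\<lambda>r. (g r, frechet_derivative g (at r) 1)) ` {u..v} \<subseteq> (snd c ` fst c) \<times> UNIV"
        using eq' by (auto simp: image_iff) (metis)
      ultimately have "continuous_on {u..v} ?h"
        using continuous_on_compose2[OF continuous[OF c]] by blast
      then show "?h integrable_on {u..v}" by (rule integrable_continuous_real)
      show "speed \<gamma> r = ?h r" if r: "r \<in> {u..v} - {u, v}" for r
      proof -
        have r': "r \<in> {u<..<v}" "r \<in> {u..v}" using r by auto
        have "((\<lambda>r. snd c (\<gamma> r)) has_vector_derivative frechet_derivative g (at r) 1) (at r)"
          by (rule has_vector_derivative_transform_within_open[OF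
                smooth_on_has_vector_derivative[OF g in_e[OF r'(2)]] _ r'(1)])
            (use eq' in auto)
        from speed_chart[OF c _ r'(1) _ this] eq' r'(2) show ?thesis by auto
      qed
    qed simp
    then show ?thesis using e by blast
  qed
  then show ?thesis
    using integrable_on_little_subintervals[of s t "speed \<gamma>"] by simp
qed

lemma piecewise_smooth_pathE:
  assumes "piecewise_smooth_path X A \<gamma>"
  obtains S where "finite S" "\<And>u. u \<in> {0..1} - S \<Longrightarrow> regular_at \<gamma> u"
    "speed \<gamma> integrable_on {0..1}"
proof -
  obtain m and \<tau> :: "nat \<Rightarrow> real" where \<tau>: "\<tau> 0 = 0" "\<tau> m = 1"
    "\<And>i. i < m \<Longrightarrow> \<tau> i < \<tau> (Suc i)" "\<And>i. i < m \<Longrightarrow> smooth_curve_on A {\<tau> i..\<tau> (Suc i)} \<gamma>"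
    using assms unfolding piecewise_smooth_path_def by blast
  have "\<tau> 0 \<le> \<tau> i \<and> speed \<gamma> integrable_on {\<tau> 0..\<tau> i}" if "i \<le> m" for i
    using that
  proof (induction i)
    case (Suc i)
    then have IH: "\<tau> 0 \<le> \<tau> i" "speed \<gamma> integrable_on {\<tau> 0..\<tau> i}" "\<tau> i < \<tau> (Suc i)"
      using \<tau>(3)[of i] by auto
    have "speed \<gamma> integrable_on {\<tau> i..\<tau> (Suc i)}"
      using speed_integrable_smooth[OF \<tau>(4)] Suc.prems by simp
    then have "speed \<gamma> integrable_on {\<tau> 0..\<tau> (Suc i)}"
      using Henstock_Kurzweil_Integration.integrable_combine[OF IH(1) less_imp_le[OF IH(3)] IH(2)] by blast
    then show ?case using IH by simp
  next
    case 0
    then show ?case using integrable_on_refl[of "speed \<gamma>" "\<tau> 0"] by simp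
  qed
  then have int: "speed \<gamma> integrable_on {0..1}" using \<tau>(1,2) by force
  have "regular_at \<gamma> u" if "u \<in> {0..1} - \<tau> ` {..m}" for u
  proof -
    have "u \<in> {\<tau> 0..\<tau> m}" "u \<notin> \<tau> ` {..m}" using that \<tau>(1,2) by auto
    then obtain i where "i < m" "u \<in> {\<tau> i<..<\<tau> (Suc i)}"
      using piecewise_partition_cover[of u \<tau> m] by blast
    then show ?thesis using smooth_curve_regular_at[OF \<tau>(4)] by blast
  qed
  then show thesis using that[of "\<tau> ` {..m}"] int by blast
qed

lemma finsler_length_eq: "finsler_length A F \<gamma> = integral {0..1} (speed \<gamma>)"
  by (simp add: finsler_length_def speed_def[abs_def])

lemma finsler_length_nonneg:
  assumes "piecewise_smooth_path X A \<gamma>"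
  shows "0 \<le> finsler_length A F \<gamma>"
proof (rule piecewise_smooth_pathE[OF assms])
  fix S assume S: "finite S" "\<And>u. u \<in> {0..1} - S \<Longrightarrow> regular_at \<gamma> u"
    "speed \<gamma> integrable_on {0..1}"
  have "integral {0..1} (\<lambda>_::real. 0::real) \<le> integral {0..1} (speed \<gamma>)"
    using S speed_nonneg by (intro integral_le_off_finite[of _ _ _ S]) auto
  then show ?thesis by (simp add: finsler_length_eq)
qed

section \<open>Concatenation of paths\<close>

definition join :: "(real \<Rightarrow> 'a) \<Rightarrow> (real \<Rightarrow> 'a) \<Rightarrow> real \<Rightarrow> 'a" where
  "join \<gamma> \<eta> t = (if t \<le> 1/2 then \<gamma> (2 * t) else \<eta> (2 * t - 1))"

text \<open>The arguments have the shape \<open>a * r + b\<close> of the lemmas on affine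
  reparametrisation. The hypothesis serves the point 1/2, where both formulas apply.\<close>

lemma join_simps:
  assumes "\<gamma> 1 = \<eta> 0"
  shows "t \<le> 1/2 \<Longrightarrow> join \<gamma> \<eta> t = \<gamma> (2 * t + 0)" "1/2 \<le> t \<Longrightarrow> join \<gamma> \<eta> t = \<eta> (2 * t + (-1))"
proof -
  show "t \<le> 1/2 \<Longrightarrow> join \<gamma> \<eta> t = \<gamma> (2 * t + 0)" by (simp add: join_def)
  show "1/2 \<le> t \<Longrightarrow> join \<gamma> \<eta> t = \<eta> (2 * t + (-1))"
  proof (cases "t = 1/2")
    case True
    then have "2 * t = 1" by simp
    then show ?thesis using assms by (simp add: join_def)
  qed (simp add: join_def)
qed

lemma piecewise_smooth_path_join:
  assumes \<gamma>: "piecewise_smooth_path X A \<gamma>" and \<eta>: "piecewise_smooth_path X A \<eta>"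
    and eq: "\<gamma> 1 = \<eta> 0"
  shows "piecewise_smooth_path X A (join \<gamma> \<eta>)"
  unfolding piecewise_smooth_path_def
proof
  have \<gamma>c: "continuous_map (top_of_set {0..1}) X \<gamma>" and \<eta>c: "continuous_map (top_of_set {0..1}) X \<eta>"
    using \<gamma> \<eta> by (simp_all add: piecewise_smooth_path_def pathin_def)
  have "continuous_map (top_of_set {0..1}) X (\<lambda>t. if t \<le> 1/2 then \<gamma> (2 * t) else \<eta> (2 * t - 1))"
  proof (rule continuous_map_cases_le)
    show "continuous_map (top_of_set {0..1}) euclideanreal (\<lambda>t. t)"
      "continuous_map (top_of_set {0..1}) euclideanreal (\<lambda>t. 1/2)"
      by auto
    have "continuous_map (top_of_set {0..1/2}) (top_of_set {0..1}) ((*) (2::real))"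
      by (auto intro!: continuous_intros)
    from continuous_map_compose[OF this \<gamma>c]
    have "continuous_map (top_of_set {0..1/2}) X (\<lambda>t. \<gamma> (2 * t))" by (simp add: o_def)
    moreover have "{x::real. x \<in> {0..1} \<and> x \<le> 1/2} = {0..1/2}" by auto
    ultimately show "continuous_map (subtopology (top_of_set {0..1})
        {x \<in> topspace (top_of_set {0..1}). x \<le> 1/2}) X (\<lambda>t. \<gamma> (2 * t))"
      by (simp add: subtopology_subtopology Int_absorb1 del: atLeastAtMost_iff)
    have "continuous_map (top_of_set {1/2..1}) (top_of_set {0..1}) (\<lambda>t. 2 * t - 1 :: real)"
      by (auto intro!: continuous_intros)
    from continuous_map_compose[OF this \<eta>c]
    have "continuous_map (top_of_set {1/2..1}) X (\<lambda>t. \<eta> (2 * t - 1))" by (simp add: o_def)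
    moreover have "{x::real. x \<in> {0..1} \<and> 1/2 \<le> x} = {1/2..1}" by auto
    ultimately show "continuous_map (subtopology (top_of_set {0..1})
        {x \<in> topspace (top_of_set {0..1}). 1/2 \<le> x}) X (\<lambda>t. \<eta> (2 * t - 1))"
      by (simp add: subtopology_subtopology Int_absorb1 del: atLeastAtMost_iff)
    show "\<gamma> (2 * t) = \<eta> (2 * t - 1)" if "t = 1/2" for t
    proof -
      have "2 * t = 1" using that by simp
      then show ?thesis using eq by simp
    qed
  qed
  then show "pathin X (join \<gamma> \<eta>)" by (simp add: pathin_def join_def[abs_def])
  obtain m and \<tau> :: "nat \<Rightarrow> real" where \<tau>: "\<tau> 0 = 0" "\<tau> m = 1"
    "\<And>i. i < m \<Longrightarrow> \<tau> i < \<tau> (Suc i)" "\<And>i. i < m \<Longrightarrow> smooth_curve_on A {\<tau> i..\<tau> (Suc i)} \<gamma>"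
    using \<gamma> unfolding piecewise_smooth_path_def by blast
  obtain n and \<sigma> :: "nat \<Rightarrow> real" where \<sigma>: "\<sigma> 0 = 0" "\<sigma> n = 1"
    "\<And>i. i < n \<Longrightarrow> \<sigma> i < \<sigma> (Suc i)" "\<And>i. i < n \<Longrightarrow> smooth_curve_on A {\<sigma> i..\<sigma> (Suc i)} \<eta>"
    using \<eta> unfolding piecewise_smooth_path_def by blast
  have \<tau>_le: "\<tau> i \<le> 1" if "i \<le> m" for i
    using that
  proof (induction rule: inc_induct)
    case (step k)
    then show ?case using \<tau>(3)[of k] by simp
  qed (simp add: \<tau>)
  have \<sigma>_ge: "0 \<le> \<sigma> i" if "i \<le> n" for i
    using that
  proof (induction i)
    case (Suc k)
    then show ?case using \<sigma>(3)[of k] by simp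
  qed (simp add: \<sigma>)
  \<comment> \<open>The two partitions shrunk to the halves of the interval. At index
    \<open>m\<close> both formulas give 1/2, as \<open>\<tau> m = 1\<close> and
    \<open>\<sigma> 0 = 0\<close>.\<close>
  define \<rho> where "\<rho> i = (if i \<le> m then \<tau> i / 2 else 1/2 + \<sigma> (i - m) / 2)" for i
  have \<rho>2: "\<rho> (m + j) = 1/2 + \<sigma> j / 2" for j using \<tau>(2) \<sigma>(1) by (auto simp: \<rho>_def)
  have "\<rho> i < \<rho> (Suc i) \<and> smooth_curve_on A {\<rho> i..\<rho> (Suc i)} (join \<gamma> \<eta>)" if i: "i < m + n" for i
  proof (cases "i < m")
    case True
    have \<rho>1: "\<rho> i = \<tau> i / 2" "\<rho> (Suc i) = \<tau> (Suc i) / 2" using True by (auto simp: \<rho>_def)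
    have "smooth_curve_on A {\<rho> i..\<rho> (Suc i)} (join \<gamma> \<eta>)"
    proof (rule smooth_curve_on_affine[OF \<tau>(4)[OF True], where a = 2 and b = 0])
      show "join \<gamma> \<eta> r = \<gamma> (2 * r + 0)" if "r \<in> {\<rho> i..\<rho> (Suc i)}" for r
        using that \<tau>_le[of "Suc i"] True \<rho>1 by (intro join_simps eq) auto
    qed (use \<rho>1 in auto)
    moreover have "\<rho> i < \<rho> (Suc i)" using \<tau>(3)[OF True] \<rho>1 by simp
    ultimately show ?thesis by blast
  next
    case False
    then obtain j where j: "i = m + j" "j < n" using i by (metis add_less_cancel_left le_Suc_ex not_less)
    have \<rho>1: "\<rho> i = 1/2 + \<sigma> j / 2" "\<rho> (Suc i) = 1/2 + \<sigma> (Suc j) / 2"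
      using \<rho>2[of j] \<rho>2[of "Suc j"] j by auto
    have "smooth_curve_on A {\<rho> i..\<rho> (Suc i)} (join \<gamma> \<eta>)"
    proof (rule smooth_curve_on_affine[OF \<sigma>(4)[OF j(2)], where a = 2 and b = "-1"])
      show "join \<gamma> \<eta> r = \<eta> (2 * r + (-1))" if "r \<in> {\<rho> i..\<rho> (Suc i)}" for r
        using that \<sigma>_ge[of j] j \<rho>1 by (intro join_simps eq) auto
    qed (use \<rho>1 in auto)
    moreover have "\<rho> i < \<rho> (Suc i)" using \<sigma>(3)[OF j(2)] \<rho>1 by simp
    ultimately show ?thesis by blast
  qed
  moreover have "\<rho> 0 = 0" "\<rho> (m + n) = 1" using \<tau>(1) \<rho>2[of n] \<sigma>(2) by (auto simp: \<rho>_def)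
  ultimately show "\<exists>m. \<exists>\<tau>::nat \<Rightarrow> real. \<tau> 0 = 0 \<and> \<tau> m = 1 \<and>
      (\<forall>i<m. \<tau> i < \<tau> (Suc i) \<and> smooth_curve_on A {\<tau> i..\<tau> (Suc i)} (join \<gamma> \<eta>))"
    by blast
qed

lemma finsler_length_join:
  assumes \<gamma>: "piecewise_smooth_path X A \<gamma>" and \<eta>: "piecewise_smooth_path X A \<eta>"
    and eq: "\<gamma> 1 = \<eta> 0"
  shows "finsler_length A F (join \<gamma> \<eta>) = finsler_length A F \<gamma> + finsler_length A F \<eta>"
proof -
  \<comment> \<open>One computation for both halves: \<open>b'\<close> is the left end of the half,
    and the factor 2 in the speed cancels the factor 1/2 from the substitution.\<close>
  have half: "(speed \<zeta> has_integral finsler_length A F \<gamma>') {b'..b' + 1/2}"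
    if \<gamma>': "piecewise_smooth_path X A \<gamma>'" and b: "b = - 2 * b'"
      and \<zeta>: "\<And>r. r \<in> {b'..b' + 1/2} \<Longrightarrow> \<zeta> r = \<gamma>' (2 * r + b)" for \<zeta> \<gamma>' b b'
  proof (rule piecewise_smooth_pathE[OF \<gamma>'])
    fix S assume S: "finite S" "\<And>u. u \<in> {0..1} - S \<Longrightarrow> regular_at \<gamma>' u"
      "speed \<gamma>' integrable_on {0..1}"
    have "(speed \<gamma>' has_integral finsler_length A F \<gamma>') (cbox 0 1)"
      using S(3) by (simp add: finsler_length_eq integrable_integral)
    from has_integral_affinity[OF this, of 2 b]
    have "((\<lambda>x. speed \<gamma>' (2 * x + b)) has_integral (1 / 2) * finsler_length A F \<gamma>')
        ((\<lambda>x. x / 2 + b') ` {0..1})"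
      using b by (simp add: mult.commute)
    also have "(\<lambda>x. x / 2 + b') ` {0..1} = {b'..b' + 1/2}"
      using image_affinity_atLeastAtMost[of "1/2" b' 0 1] by (simp add: add.commute)
    finally have "((\<lambda>x. 2 * speed \<gamma>' (2 * x + b)) has_integral finsler_length A F \<gamma>') {b'..b' + 1/2}"
      using has_integral_mult_right[of _ "(1 / 2) * finsler_length A F \<gamma>'" _ 2] by simp
    then show ?thesis
    proof (rule has_integral_spike_finite[rotated 2])
      \<comment> \<open>Excluded are the points that the reparametrisation sends to exceptional
        points of the given path, and the two ends, at which the formula for the joined curve holds
        on one side only.\<close>
      let ?S = "(\<lambda>u. (u - b) / 2) ` S \<union> {b', b' + 1/2}"
      show "finite ?S" using S(1) by simp
      fix u assume u: "u \<in> {b'..b' + 1/2} - ?S"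
      have "2 * u + b \<notin> S" using u by (auto simp: image_iff)
      then have "regular_at \<gamma>' (2 * u + b)" using S(2) u b by auto
      then show "speed \<zeta> u = 2 * speed \<gamma>' (2 * u + b)"
        by (rule speed_affine[where T = "{b'<..<b' + 1/2}"]) (use u \<zeta> in auto)
    qed
  qed
  have 1: "(speed (join \<gamma> \<eta>) has_integral finsler_length A F \<gamma>) {0..1/2}"
    using half[OF \<gamma>, of 0 0 "join \<gamma> \<eta>"] join_simps(1)[of \<gamma> \<eta>] eq by simp
  have 2: "(speed (join \<gamma> \<eta>) has_integral finsler_length A F \<eta>) {1/2..1}"
    using half[OF \<eta>, of "-1" "1/2" "join \<gamma> \<eta>"] join_simps(2)[of \<gamma> \<eta>] eq by simp
  show ?thesis
    unfolding finsler_length_eq[of "join \<gamma> \<eta>"]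
    by (rule integral_unique, rule has_integral_combine[OF _ _ 1 2]) auto
qed

text \<open>A straight segment in coordinates has constant coordinate velocity
  \<open>y - x\<close>.\<close>

lemma chart_segment:
  assumes c: "c \<in> A" and sub: "closed_segment x y \<subseteq> snd c ` fst c"
    and M: "\<And>z v. z \<in> closed_segment x y \<Longrightarrow> LE c (z, v) \<le> M * norm v"
  obtains \<gamma> where "piecewise_smooth_path X A \<gamma>" "\<gamma> 0 = chart_inv c x" "\<gamma> 1 = chart_inv c y"
    "finsler_length A F \<gamma> \<le> M * norm (y - x)"
proof -
  define l where "l t = x + t *\<^sub>R (y - x)" for t
  define \<gamma> where "\<gamma> t = chart_inv c (l t)" for t
  have l: "l t \<in> closed_segment x y" if "t \<in> {0..1}" for t
    using that by (auto simp: l_def in_segment algebra_simps intro!: exI[of _ t])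
  have \<gamma>: "\<gamma> t \<in> fst c" "snd c (\<gamma> t) = l t" if "t \<in> {0..1}" for t
    using chart_inv_in[OF subsetD[OF sub l[OF that]]] chart_inv_right[OF subsetD[OF sub l[OF that]]]
    by (simp_all add: \<gamma>_def)
  have path: "piecewise_smooth_path X A \<gamma>"
    unfolding piecewise_smooth_path_def pathin_def
  proof
    have "continuous_map (top_of_set {0..1}) (top_of_set (snd c ` fst c)) l"
      using l sub by (auto simp: l_def[abs_def] intro!: continuous_intros)
    from continuous_map_compose[OF this chart_inv_continuous_map[OF c]]
    show "continuous_map (top_of_set {0..1}) X \<gamma>" by (simp add: o_def \<gamma>_def[abs_def])
    have "smooth_curve_on A {0..1} \<gamma>"
      unfolding smooth_curve_on_def
    proof
      fix u :: real
      show "\<exists>c\<in>A. \<exists>e>0. \<exists>g. smooth_on {u - e<..<u + e} g \<and>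
        (\<forall>r \<in> {0..1} \<inter> {u - e<..<u + e}. \<gamma> r \<in> fst c \<and> snd c (\<gamma> r) = g r)"
        using c \<gamma> smooth_on_line[of _ x "y - x"]
        by (intro bexI[of _ c] exI[of _ 1] exI[of _ l]) (auto simp: l_def[abs_def])
    qed
    then show "\<exists>m. \<exists>\<tau>::nat \<Rightarrow> real. \<tau> 0 = 0 \<and> \<tau> m = 1 \<and>
        (\<forall>i<m. \<tau> i < \<tau> (Suc i) \<and> smooth_curve_on A {\<tau> i..\<tau> (Suc i)} \<gamma>)"
      by (intro exI[of _ 1] exI[of _ real]) auto
  qed
  have "integral {0..1} (speed \<gamma>) \<le> integral {0..1} (\<lambda>_::real. M * norm (y - x))"
  proof (rule piecewise_smooth_pathE[OF path], rule integral_le_off_finite[of _ _ _ "{0, 1}"])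
    fix u :: real assume "u \<in> {0..1} - {0, 1}"
    then have u: "u \<in> {0<..<1}" "u \<in> {0..1}" by auto
    have "((\<lambda>r. snd c (\<gamma> r)) has_vector_derivative y - x) (at u)"
    proof (rule has_vector_derivative_transform_within_open[OF _ _ u(1)])
      show "(l has_vector_derivative y - x) (at u)"
        unfolding l_def[abs_def] by (auto intro!: derivative_eq_intros)
    qed (use \<gamma> in auto)
    from speed_chart[OF c _ u(1) _ this] \<gamma> u
    have "speed \<gamma> u = LE c (l u, y - x)" by auto
    then show "speed \<gamma> u \<le> M * norm (y - x)" using M[OF l[OF u(2)]] by simp
  qed auto
  then have "finsler_length A F \<gamma> \<le> M * norm (y - x)" by (simp add: finsler_length_eq)
  then show thesis
    by (rule that[OF path, rotated 2]) (simp_all add: \<gamma>_def l_def)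
qed

end

section \<open>The Finsler distance in a chart\<close>

context finsler_manifold
begin

abbreviation dF where "dF \<equiv> finsler_dist X A F"

lemma chart_ball:
  assumes c: "c \<in> A" and p: "p \<in> fst c"
  obtains r m M where "r > 0" "m > 0" "M > 0" "cball (snd c p) r \<subseteq> snd c ` fst c"
    "\<And>x y. x \<in> cball (snd c p) r \<Longrightarrow> m * norm y \<le> LE c (x, y)"
    "\<And>x y. x \<in> cball (snd c p) r \<Longrightarrow> LE c (x, y) \<le> M * norm y"
proof -
  obtain r where r: "r > 0" "cball (snd c p) r \<subseteq> snd c ` fst c"
    using chart_open_image[OF c] p by (metis imageI open_contains_cball)
  obtain m M where "m > 0" "M > 0"
    "\<And>x y. x \<in> cball (snd c p) r \<Longrightarrow> m * norm y \<le> LE c (x, y)"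
    "\<And>x y. x \<in> cball (snd c p) r \<Longrightarrow> LE c (x, y) \<le> M * norm y"
    using local_expr_norm_bounds[OF c compact_cball r(2)] by metis
  then show thesis using that r by blast
qed

text \<open>Balls are convex, so the coordinate segment stays where the bound \<open>M\<close>
  holds.\<close>

lemma chart_ball_path:
  assumes c: "c \<in> A" and q: "q \<in> fst c" "q' \<in> fst c"
    and r: "cball x r \<subseteq> snd c ` fst c" "snd c q \<in> cball x r" "snd c q' \<in> cball x r"
    and M: "\<And>z y. z \<in> cball x r \<Longrightarrow> LE c (z, y) \<le> M * norm y"
  obtains \<gamma> where "piecewise_smooth_path X A \<gamma>" "\<gamma> 0 = q" "\<gamma> 1 = q'"
    "finsler_length A F \<gamma> \<le> M * norm (snd c q' - snd c q)"
proof -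
  have seg: "closed_segment (snd c q) (snd c q') \<subseteq> cball x r"
    using r(2,3) by (intro closed_segment_subset convex_cball)
  have sub: "closed_segment (snd c q) (snd c q') \<subseteq> snd c ` fst c" using seg r(1) by blast
  have M': "LE c (z, y) \<le> M * norm y" if "z \<in> closed_segment (snd c q) (snd c q')" for z y
    using M seg that by blast
  obtain \<gamma> where "piecewise_smooth_path X A \<gamma>" "\<gamma> 0 = chart_inv c (snd c q)"
    "\<gamma> 1 = chart_inv c (snd c q')" "finsler_length A F \<gamma> \<le> M * norm (snd c q' - snd c q)"
    using chart_segment[OF c sub M'] .
  then show thesis using that chart_inv_left[OF c] q by simp
qed

text \<open>Reachability by piecewise smooth paths is locally constant, hence constant.\<close>

lemma exists_path:
  assumes p: "p \<in> topspace X" and q: "q \<in> topspace X"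
  obtains \<gamma> where "piecewise_smooth_path X A \<gamma>" "\<gamma> 0 = p" "\<gamma> 1 = q"
proof -
  define R where "R u v \<longleftrightarrow> (\<exists>\<gamma>. piecewise_smooth_path X A \<gamma> \<and> \<gamma> 0 = u \<and> \<gamma> 1 = v)" for u v
  have R_trans: "R u w" if uv: "R u v" and vw: "R v w" for u v w
  proof -
    obtain \<gamma> where g: "piecewise_smooth_path X A \<gamma>" "\<gamma> 0 = u" "\<gamma> 1 = v"
      using uv unfolding R_def by blast
    obtain \<eta> where h: "piecewise_smooth_path X A \<eta>" "\<eta> 0 = v" "\<eta> 1 = w"
      using vw unfolding R_def by blast
    have "piecewise_smooth_path X A (join \<gamma> \<eta>)"
      using g h by (intro piecewise_smooth_path_join) auto
    moreover have "join \<gamma> \<eta> 0 = u" "join \<gamma> \<eta> 1 = w" using g h by (auto simp: join_def)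
    ultimately show ?thesis unfolding R_def by blast
  qed
  \<comment> \<open>All pairs in \<open>W\<close> are joined in both orders. The openness of
    \<open>?T\<close> uses paths starting at \<open>v\<close> and that of its complement paths
    ending at \<open>v\<close>, so no path has to be reversed.\<close>
  have loc: "\<exists>W. openin X W \<and> z \<in> W \<and> (\<forall>u\<in>W. \<forall>v\<in>W. R u v)" if z: "z \<in> topspace X" for z
  proof -
    obtain c where c: "c \<in> A" "z \<in> fst c" using z cover by blast
    obtain r m M where r: "r > 0" "cball (snd c z) r \<subseteq> snd c ` fst c"
      and M: "\<And>x y. x \<in> cball (snd c z) r \<Longrightarrow> LE c (x, y) \<le> M * norm y"
      using chart_ball[OF c] by metis
    let ?W = "{u \<in> fst c. snd c u \<in> ball (snd c z) r}"
    have "R u v" if "u \<in> ?W" "v \<in> ?W" for u v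
    proof -
      have "u \<in> fst c" "v \<in> fst c" "snd c u \<in> cball (snd c z) r" "snd c v \<in> cball (snd c z) r"
        using that by auto
      then obtain \<gamma> where "piecewise_smooth_path X A \<gamma>" "\<gamma> 0 = u" "\<gamma> 1 = v"
        using chart_ball_path[OF c(1) _ _ r(2) _ _ M] by metis
      then show ?thesis unfolding R_def by blast
    qed
    moreover have "openin X ?W" by (intro chart_preimage_openin c) auto
    moreover have "z \<in> ?W" using c r by simp
    ultimately show ?thesis by blast
  qed
  let ?T = "{v \<in> topspace X. R p v}"
  have "openin X ?T"
  proof (subst openin_subopen, intro ballI)
    fix v assume v: "v \<in> ?T"
    then obtain W where W: "openin X W" "v \<in> W" "\<forall>u\<in>W. \<forall>v\<in>W. R u v" using loc by blast
    then have "W \<subseteq> ?T" using v R_trans openin_subset[OF W(1)] by blast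
    then show "\<exists>W. openin X W \<and> v \<in> W \<and> W \<subseteq> ?T" using W by blast
  qed
  moreover have "openin X (topspace X - ?T)"
  proof (subst openin_subopen, intro ballI)
    fix v assume v: "v \<in> topspace X - ?T"
    then obtain W where W: "openin X W" "v \<in> W" "\<forall>u\<in>W. \<forall>v\<in>W. R u v" using loc by blast
    then have "W \<subseteq> topspace X - ?T" using v R_trans openin_subset[OF W(1)] by blast
    then show "\<exists>W. openin X W \<and> v \<in> W \<and> W \<subseteq> topspace X - ?T" using W by blast
  qed
  then have "closedin X ?T" by (simp add: closedin_def)
  moreover have "p \<in> ?T" using loc[OF p] p by blast
  ultimately have "?T = topspace X"
    using connected unfolding connected_space_clopen_in by blast
  then show thesis using q that unfolding R_def by blast
qed

lemma finsler_dist_le: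
  assumes "piecewise_smooth_path X A \<gamma>"
  shows "dF (\<gamma> 0) (\<gamma> 1) \<le> finsler_length A F \<gamma>"
  unfolding finsler_dist_def
proof (rule cInf_lower)
  show "bdd_below {finsler_length A F \<eta> |\<eta>. piecewise_smooth_path X A \<eta> \<and> \<eta> 0 = \<gamma> 0 \<and> \<eta> 1 = \<gamma> 1}"
    using finsler_length_nonneg by (intro bdd_belowI[of _ 0]) auto
qed (use assms in blast)

text \<open>Connectedness enters here through \<open>exists_path\<close>: the infimum is taken over
  a nonempty set.\<close>

lemma finsler_dist_approx:
  assumes "p \<in> topspace X" "q \<in> topspace X" "dF p q < e"
  obtains \<gamma> where "piecewise_smooth_path X A \<gamma>" "\<gamma> 0 = p" "\<gamma> 1 = q" "finsler_length A F \<gamma> < e"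
proof -
  let ?L = "{finsler_length A F \<eta> |\<eta>. piecewise_smooth_path X A \<eta> \<and> \<eta> 0 = p \<and> \<eta> 1 = q}"
  have ne: "?L \<noteq> {}" using exists_path[OF assms(1,2)] by blast
  have lt: "Inf ?L < e" using assms(3) unfolding finsler_dist_def .
  obtain l where "l \<in> ?L" "l < e" by (rule bexE[OF cInf_lessD[OF ne lt]])
  then show thesis using that by blast
qed

lemma finsler_dist_chart_le:
  assumes c: "c \<in> A" and q: "q \<in> fst c" "q' \<in> fst c"
    and r: "cball x r \<subseteq> snd c ` fst c" "snd c q \<in> cball x r" "snd c q' \<in> cball x r"
    and M: "\<And>z y. z \<in> cball x r \<Longrightarrow> LE c (z, y) \<le> M * norm y"
  shows "dF q q' \<le> M * norm (snd c q' - snd c q)"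
proof -
  obtain \<gamma> where \<gamma>: "piecewise_smooth_path X A \<gamma>" "\<gamma> 0 = q" "\<gamma> 1 = q'"
    "finsler_length A F \<gamma> \<le> M * norm (snd c q' - snd c q)"
    using chart_ball_path[OF c q r M] .
  from finsler_dist_le[OF \<gamma>(1)] \<gamma>(2-4) show ?thesis by simp
qed

text \<open>Joining nearly optimal paths gives the triangle inequality, and a degenerate coordinate
  segment shows that \<open>dF p p\<close> is at most 0.\<close>

lemma asym_dist_finsler: "asym_dist dF (topspace X)"
proof
  fix p q s assume p: "p \<in> topspace X" and q: "q \<in> topspace X"
  show "0 \<le> dF p q"
  proof (rule ccontr)
    assume "\<not> 0 \<le> dF p q"
    then obtain \<gamma> where "piecewise_smooth_path X A \<gamma>" "finsler_length A F \<gamma> < 0"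
      using finsler_dist_approx[OF p q, of 0] by auto
    then show False using finsler_length_nonneg[of \<gamma>] by simp
  qed
  assume s: "s \<in> topspace X"
  show "dF p s \<le> dF p q + dF q s"
  proof (rule field_le_epsilon)
    fix e :: real assume e: "e > 0"
    obtain \<gamma> where \<gamma>: "piecewise_smooth_path X A \<gamma>" "\<gamma> 0 = p" "\<gamma> 1 = q"
      "finsler_length A F \<gamma> < dF p q + e / 2"
      using finsler_dist_approx[OF p q, of "dF p q + e / 2"] e by auto
    obtain \<eta> where \<eta>: "piecewise_smooth_path X A \<eta>" "\<eta> 0 = q" "\<eta> 1 = s"
      "finsler_length A F \<eta> < dF q s + e / 2"
      using finsler_dist_approx[OF q s, of "dF q s + e / 2"] e by auto
    have "join \<gamma> \<eta> 0 = p" "join \<gamma> \<eta> 1 = s" using \<gamma> \<eta> by (auto simp: join_def)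
    then have "dF p s \<le> finsler_length A F \<gamma> + finsler_length A F \<eta>"
      using finsler_dist_le[OF piecewise_smooth_path_join[OF \<gamma>(1) \<eta>(1)]]
        finsler_length_join[OF \<gamma>(1) \<eta>(1)] \<gamma>(3) \<eta>(2) by simp
    then show "dF p s \<le> dF p q + dF q s + e" using \<gamma>(4) \<eta>(4) by simp
  qed
next
  fix p assume p: "p \<in> topspace X"
  then obtain c where c: "c \<in> A" "p \<in> fst c" using cover by blast
  obtain r m M where r: "r > 0" "cball (snd c p) r \<subseteq> snd c ` fst c"
    and M: "\<And>x y. x \<in> cball (snd c p) r \<Longrightarrow> LE c (x, y) \<le> M * norm y"
    using chart_ball[OF c] by metis
  have "snd c p \<in> cball (snd c p) r" using r by simp
  from finsler_dist_chart_le[OF c(1) c(2) c(2) r(2) this this M] have "dF p p \<le> 0" by simp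
  moreover have "0 \<le> dF p p"
  proof (rule ccontr)
    assume "\<not> 0 \<le> dF p p"
    then obtain \<gamma> where "piecewise_smooth_path X A \<gamma>" "finsler_length A F \<gamma> < 0"
      using finsler_dist_approx[OF p p, of 0] by auto
    then show False using finsler_length_nonneg[of \<gamma>] by simp
  qed
  ultimately show "dF p p = 0" by simp
qed

section \<open>Short paths near a coordinate ball\<close>

text \<open>The coordinate displacement is the integral of the coordinate velocity, whose norm is at
  most the speed divided by \<open>m\<close>. The fundamental theorem of calculus is used in a form
  that tolerates finitely many exceptional points.\<close>

lemma length_lower_bound:
  assumes \<gamma>: "piecewise_smooth_path X A \<gamma>" and c: "c \<in> A" and m: "m > 0"
    and K: "\<And>x y. x \<in> K \<Longrightarrow> m * norm y \<le> LE c (x, y)"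
    and st: "0 \<le> s" "s \<le> t" "t \<le> 1"
    and sub: "\<And>u. u \<in> {s..t} \<Longrightarrow> \<gamma> u \<in> fst c \<and> snd c (\<gamma> u) \<in> K"
  shows "norm (snd c (\<gamma> t) - snd c (\<gamma> s)) \<le> finsler_length A F \<gamma> / m"
proof (rule piecewise_smooth_pathE[OF \<gamma>])
  fix S assume S: "finite S" "\<And>u. u \<in> {0..1} - S \<Longrightarrow> regular_at \<gamma> u"
    "speed \<gamma> integrable_on {0..1}"
  \<comment> \<open>At exceptional points the velocity may fail to be a tangent vector, where
    nothing is known about the sign of \<open>F\<close>; the value 0 restores nonnegativity.\<close>
  define sp where "sp u = (if u \<in> S then 0 else speed \<gamma> u)" for u
  have sp_nonneg: "0 \<le> sp u" if "u \<in> {0..1}" for u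
    using speed_nonneg[OF S(2), of u] that by (cases "u \<in> S") (auto simp: sp_def)
  have sp: "(sp has_integral finsler_length A F \<gamma>) {0..1}"
    unfolding finsler_length_eq
    by (rule has_integral_spike_finite[OF S(1) _ integrable_integral[OF S(3)]]) (auto simp: sp_def)
  have sp_st: "sp integrable_on {s..t}"
    using integrable_on_subinterval[OF has_integral_integrable[OF sp], of s t] st by simp
  define \<phi> where "\<phi> u = snd c (\<gamma> u)" for u
  have D: "(\<phi> has_vector_derivative vector_derivative \<phi> (at u)) (at u) \<and>
      m * norm (vector_derivative \<phi> (at u)) \<le> sp u" if u: "u \<in> {s..t} - S" for u
  proof -
    have "u \<in> {0..1} - S" using u st by auto
    note r = S(2)[OF this]
    have in_c: "\<gamma> u \<in> fst c" "\<phi> u \<in> K" using sub u by (auto simp: \<phi>_def)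
    obtain w T where T: "open T" "u \<in> T" "\<And>r. r \<in> T \<Longrightarrow> \<gamma> r \<in> fst c"
      and w: "((\<lambda>r. snd c (\<gamma> r)) has_vector_derivative w) (at u)"
      using regular_atE[OF r c in_c(1)] by metis
    have "speed \<gamma> u = LE c (\<phi> u, w)" using speed_chart[OF c T w] by (simp add: \<phi>_def)
    moreover have "(\<phi> has_vector_derivative w) (at u)" using w by (simp add: \<phi>_def[abs_def])
    ultimately show ?thesis
      using K[OF in_c(2), of w] u vector_derivative_at[of \<phi> w u] by (simp add: sp_def)
  qed
  have cont: "continuous_on {s..t} \<phi>"
  proof -
    have "continuous_map (top_of_set {0..1}) X \<gamma>"
      using \<gamma> by (simp add: piecewise_smooth_path_def pathin_def)
    then have "continuous_map (top_of_set {s..t}) X \<gamma>"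
      by (rule continuous_map_from_subtopology_mono) (use st in auto)
    then have "continuous_map (top_of_set {s..t}) (subtopology X (fst c)) \<gamma>"
      using sub by (auto simp: continuous_map_in_subtopology)
    from continuous_map_compose[OF this chart_continuous_map[OF c]]
    show ?thesis by (simp add: \<phi>_def[abs_def] o_def)
  qed
  define f' where "f' u = (if u \<in> S then 0 else vector_derivative \<phi> (at u))" for u
  have "(f' has_integral (\<phi> t - \<phi> s)) {s..t}"
    by (rule fundamental_theorem_of_calculus_interior_strong[OF S(1) st(2) _ cont])
      (use D in \<open>auto simp: f'_def\<close>)
  moreover have "norm (f' u) \<le> sp u / m" if "u \<in> {s..t}" for u
    using D[of u] that m sp_nonneg[of u] st by (cases "u \<in> S") (auto simp: f'_def field_simps)
  moreover have "(\<lambda>u. sp u / m) integrable_on {s..t}" using integrable_on_mult_left[OF sp_st, of "1 / m"] by simp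
  ultimately have "norm (\<phi> t - \<phi> s) \<le> integral {s..t} (\<lambda>u. sp u / m)"
    using integral_norm_bound_integral[of f' "{s..t}" "\<lambda>u. sp u / m"]
    by (auto simp: integral_unique integrable_on_def)
  also have "\<dots> = integral {s..t} sp / m" by simp
  also have "\<dots> \<le> finsler_length A F \<gamma> / m"
  proof -
    have "integral {s..t} sp \<le> integral {0..1} sp"
      using sp sp_st sp_nonneg st by (intro integral_subset_le) auto
    then show ?thesis using sp m by (simp add: integral_unique divide_right_mono)
  qed
  finally show "norm (snd c (\<gamma> t) - snd c (\<gamma> s)) \<le> finsler_length A F \<gamma> / m"
    by (simp add: \<phi>_def)
qed

text \<open>At a first exit time the displacement would still be at most \<open>L\<close>, which is too small to
  reach the boundary of the ball.\<close>

lemma no_escape: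
  fixes \<eta> :: "real \<Rightarrow> 'a"
  assumes c: "c \<in> A" and \<eta>: "continuous_map (top_of_set {0..1}) X \<eta>"
    and r: "cball x r \<subseteq> snd c ` fst c"
    and L: "\<And>s t. \<lbrakk>0 \<le> s; s \<le> t; t \<le> 1; \<And>u. u \<in> {s..t} \<Longrightarrow> \<eta> u \<in> fst c \<and> snd c (\<eta> u) \<in> cball x r\<rbrakk>
        \<Longrightarrow> norm (snd c (\<eta> t) - snd c (\<eta> s)) \<le> L"
    and L0: "0 \<le> L" and start: "\<eta> 0 \<in> fst c" "L + norm (snd c (\<eta> 0) - x) < r"
  shows "\<eta> 1 \<in> fst c \<and> snd c (\<eta> 1) \<in> ball x r \<and> norm (snd c (\<eta> 1) - snd c (\<eta> 0)) \<le> L"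
proof -
  define V where "V = {p \<in> fst c. snd c p \<in> ball x r}"
  define C where "C = {p \<in> fst c. snd c p \<in> cball x r}"
  have VC: "V \<subseteq> C" unfolding V_def C_def by auto
  have "openin X V" unfolding V_def by (intro chart_preimage_openin c) auto
  \<comment> \<open>The Hausdorff property enters here: the compact coordinate ball is closed in the
    whole manifold, so a path cannot leave it without meeting its boundary sphere.\<close>
  have "closedin X C"
  proof -
    have "compactin (top_of_set (snd c ` fst c)) (cball x r)"
      using r by (simp add: compactin_subtopology)
    from image_compactin[OF this chart_inv_continuous_map[OF c]]
    have "compactin X (chart_inv c ` cball x r)" .
    moreover have "chart_inv c ` cball x r = C"
    proof
      show "chart_inv c ` cball x r \<subseteq> C"
      proof
        fix p assume "p \<in> chart_inv c ` cball x r"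
        then obtain y where y: "y \<in> cball x r" "p = chart_inv c y" by blast
        show "p \<in> C"
          using chart_inv_in[OF subsetD[OF r y(1)]] chart_inv_right[OF subsetD[OF r y(1)]] y
          unfolding C_def by simp
      qed
      show "C \<subseteq> chart_inv c ` cball x r"
      proof
        fix p assume "p \<in> C"
        then show "p \<in> chart_inv c ` cball x r"
          using chart_inv_left[OF c, of p] unfolding C_def by (intro image_eqI[of _ _ "snd c p"]) auto
      qed
    qed
    ultimately show ?thesis using Hausdorff compactin_imp_closedin by metis
  qed
  have \<eta>0: "\<eta> 0 \<in> V"
    using start L0 by (simp add: V_def dist_norm norm_minus_commute)
  have cl: "closed S" if "closedin (top_of_set {0..1}) S" for S :: "real set"
    using closedin_closed_trans[OF that] by simp
  define T where "T = {t \<in> {0..1}. \<eta> t \<notin> V}"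
  have "closedin (top_of_set {0..1}) {t \<in> topspace (top_of_set {0..1}). \<eta> t \<in> topspace X - V}"
    using \<eta> \<open>openin X V\<close> by (intro closedin_continuous_map_preimage) auto
  moreover have "{t \<in> topspace (top_of_set {0..1}). \<eta> t \<in> topspace X - V} = T"
    using \<eta> by (auto simp: T_def continuous_map_def)
  ultimately have "closed T" using cl by simp
  have "T = {}"
  proof (rule ccontr)
    assume "T \<noteq> {}"
    moreover have "compact T"
    proof -
      have "{0..1} \<inter> T = T" unfolding T_def by blast
      then show ?thesis
        using compact_Int_closed[OF compact_Icc \<open>closed T\<close>, of 0 1] by simp
    qed
    ultimately obtain t where t: "t \<in> T" "\<And>s. s \<in> T \<Longrightarrow> t \<le> s"
      using compact_attains_inf[of T] by metis
    have t01: "0 < t" "t \<le> 1" using t(1) \<eta>0 by (auto simp: T_def order_less_le)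
    have before: "\<eta> s \<in> C" if "0 \<le> s" "s < t" for s
      using t(2)[of s] that t01 VC by (auto simp: T_def)
    \<comment> \<open>Closedness of \<open>C\<close> carries membership from the times before
      \<open>t\<close> to the exit time itself.\<close>
    have "\<eta> t \<in> C"
    proof -
      have "closedin (top_of_set {0..1}) {s \<in> topspace (top_of_set {0..1}). \<eta> s \<in> C}"
        using \<eta> \<open>closedin X C\<close> by (intro closedin_continuous_map_preimage) auto
      then have "closed {s \<in> {0..1}. \<eta> s \<in> C}" using cl by simp
      moreover have "{0..<t} \<subseteq> {s \<in> {0..1}. \<eta> s \<in> C}" using before t01 by auto
      ultimately have "closure {0..<t} \<subseteq> {s \<in> {0..1}. \<eta> s \<in> C}" by (rule closure_minimal[rotated])
      then show ?thesis using t01 by (simp add: closure_atLeastLessThan subset_iff)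
    qed
    then have "\<eta> u \<in> C" if "u \<in> {0..t}" for u using before that by (cases "u = t") auto
    then have "norm (snd c (\<eta> t) - snd c (\<eta> 0)) \<le> L"
      using t01 by (intro L) (auto simp: C_def)
    then have "norm (snd c (\<eta> t) - x) < r"
      using start(2) norm_triangle_ineq[of "snd c (\<eta> t) - snd c (\<eta> 0)" "snd c (\<eta> 0) - x"] by simp
    then have "\<eta> t \<in> V" using \<open>\<eta> t \<in> C\<close> by (simp add: V_def C_def dist_norm norm_minus_commute)
    then show False using t(1) by (simp add: T_def)
  qed
  then have V: "\<eta> u \<in> V" if "u \<in> {0..1}" for u using that by (auto simp: T_def)
  then have "norm (snd c (\<eta> 1) - snd c (\<eta> 0)) \<le> L"
    by (intro L) (auto simp: V_def less_imp_le)
  then show ?thesis using V[of 1] by (simp add: V_def)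
qed

text \<open>Every path between \<open>q\<close> and a point outside the open ball costs at least
  \<open>m\<close> times the gap \<open>r - norm (snd c q - x)\<close>. A smaller distance, in
  either direction, forces \<open>q'\<close> into the chart, where displacement is bounded by
  length.\<close>

lemma finsler_dist_chart_ge:
  assumes c: "c \<in> A" and q: "q \<in> fst c" "q' \<in> topspace X"
    and m: "m > 0" and r: "cball x r \<subseteq> snd c ` fst c"
    and K: "\<And>z y. z \<in> cball x r \<Longrightarrow> m * norm y \<le> LE c (z, y)"
    and d: "dF q q' < m * (r - norm (snd c q - x)) \<or> dF q' q < m * (r - norm (snd c q - x))"
  shows "q' \<in> fst c" "snd c q' \<in> ball x r"
    "dF q q' < m * (r - norm (snd c q - x)) \<Longrightarrow> m * norm (snd c q' - snd c q) \<le> dF q q'"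
    "dF q' q < m * (r - norm (snd c q - x)) \<Longrightarrow> m * norm (snd c q' - snd c q) \<le> dF q' q"
proof -
  have qX: "q \<in> topspace X" using q chart_subset[OF c] by blast
  have cont: "continuous_map (top_of_set {0..1}) X \<gamma>" if "piecewise_smooth_path X A \<gamma>" for \<gamma>
    using that by (simp add: piecewise_smooth_path_def pathin_def)
  \<comment> \<open>The infimum may not be attained, so a length \<open>l\<close> strictly between
    the distance and the threshold is used.\<close>
  have fwd: "q' \<in> fst c \<and> snd c q' \<in> ball x r \<and> norm (snd c q' - snd c q) \<le> l / m"
    if l: "dF q q' < l" "l < m * (r - norm (snd c q - x))" for l
  proof -
    obtain \<gamma> where \<gamma>: "piecewise_smooth_path X A \<gamma>" "\<gamma> 0 = q" "\<gamma> 1 = q'"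
      and len: "finsler_length A F \<gamma> < l" using finsler_dist_approx[OF qX q(2) l(1)] .
    have "\<gamma> 1 \<in> fst c \<and> snd c (\<gamma> 1) \<in> ball x r \<and> norm (snd c (\<gamma> 1) - snd c (\<gamma> 0)) \<le> l / m"
    proof (rule no_escape[OF c cont[OF \<gamma>(1)] r])
      fix s t :: real
      assume st: "0 \<le> s" "s \<le> t" "t \<le> 1"
        and in_c: "\<And>u. u \<in> {s..t} \<Longrightarrow> \<gamma> u \<in> fst c \<and> snd c (\<gamma> u) \<in> cball x r"
      have "norm (snd c (\<gamma> t) - snd c (\<gamma> s)) \<le> finsler_length A F \<gamma> / m"
        by (rule length_lower_bound[OF \<gamma>(1) c m K st in_c])
      also have "\<dots> \<le> l / m" using len m by (simp add: divide_right_mono)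
      finally show "norm (snd c (\<gamma> t) - snd c (\<gamma> s)) \<le> l / m" .
    qed (use \<gamma> q l m len finsler_length_nonneg[OF \<gamma>(1)] in \<open>auto simp: field_simps\<close>)
    then show ?thesis using \<gamma> by simp
  qed
  have bwd: "q' \<in> fst c \<and> snd c q' \<in> ball x r \<and> norm (snd c q' - snd c q) \<le> l / m"
    if l: "dF q' q < l" "l < m * (r - norm (snd c q - x))" for l
  proof -
    obtain \<gamma> where \<gamma>: "piecewise_smooth_path X A \<gamma>" "\<gamma> 0 = q'" "\<gamma> 1 = q"
      and len: "finsler_length A F \<gamma> < l" using finsler_dist_approx[OF q(2) qX l(1)] .
    \<comment> \<open>Escape is excluded along the reversed path, because the known point
      \<open>q\<close> is the end of \<gamma>. Lengths are still measured along \<gamma>, as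
      reversal may change them.\<close>
    let ?\<eta> = "\<lambda>t. \<gamma> (1 - t)"
    have "continuous_map (top_of_set {0..1}) (top_of_set {0..1}) (\<lambda>t::real. 1 - t)"
      by (auto intro!: continuous_intros)
    from continuous_map_compose[OF this cont[OF \<gamma>(1)]]
    have \<eta>: "continuous_map (top_of_set {0..1}) X ?\<eta>" by (simp add: o_def)
    have "?\<eta> 1 \<in> fst c \<and> snd c (?\<eta> 1) \<in> ball x r \<and> norm (snd c (?\<eta> 1) - snd c (?\<eta> 0)) \<le> l / m"
    proof (rule no_escape[OF c \<eta> r])
      fix s t :: real
      assume st: "0 \<le> s" "s \<le> t" "t \<le> 1"
        and in_c: "\<And>u. u \<in> {s..t} \<Longrightarrow> ?\<eta> u \<in> fst c \<and> snd c (?\<eta> u) \<in> cball x r"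
      have in_c': "\<gamma> u \<in> fst c \<and> snd c (\<gamma> u) \<in> cball x r" if "u \<in> {1 - t..1 - s}" for u
        using in_c[of "1 - u"] that by simp
      have "norm (snd c (\<gamma> (1 - s)) - snd c (\<gamma> (1 - t))) \<le> finsler_length A F \<gamma> / m"
        by (rule length_lower_bound[OF \<gamma>(1) c m K _ _ _ in_c']) (use st in auto)
      also have "\<dots> \<le> l / m" using len m by (simp add: divide_right_mono)
      finally show "norm (snd c (?\<eta> t) - snd c (?\<eta> s)) \<le> l / m" by (simp add: norm_minus_commute)
    qed (use \<gamma> q l m len finsler_length_nonneg[OF \<gamma>(1)] in \<open>auto simp: field_simps\<close>)
    then show ?thesis using \<gamma> by simp
  qed
  show "q' \<in> fst c" "snd c q' \<in> ball x r"
    using d fwd bwd dense by blast+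
  \<comment> \<open>Let \<open>l\<close> decrease to the distance.\<close>
  have lim: "m * a \<le> b" if "b < e" "\<And>l. b < l \<Longrightarrow> l < e \<Longrightarrow> a \<le> l / m" for a b e :: real
  proof (rule dense_ge_bounded[OF that(1)])
    show "m * a \<le> l" if "b < l" "l < e" for l
      using \<open>\<And>l. b < l \<Longrightarrow> l < e \<Longrightarrow> a \<le> l / m\<close>[OF that] m by (simp add: field_simps)
  qed
  show "dF q q' < m * (r - norm (snd c q - x)) \<Longrightarrow> m * norm (snd c q' - snd c q) \<le> dF q q'"
    using lim fwd by blast
  show "dF q' q < m * (r - norm (snd c q - x)) \<Longrightarrow> m * norm (snd c q' - snd c q) \<le> dF q' q"
    using lim bwd by blast
qed

end

text \<open>The constant may vary with the point: near each point the bound for \<open>d'\<close> is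
  multiplied by the local \<open>C\<close>, and locality glues the results. The second curve may
  live in another space, as a coordinate curve does.\<close>

lemma (in asym_dist) has_speed_bound_transfer:
  assumes ab: "a \<le> b" and S: "\<gamma> ` {a..b} \<subseteq> S" and bd: "has_speed_bound d' \<gamma>' a b"
    and loc: "\<And>x. x \<in> {a..b} \<Longrightarrow> \<exists>\<delta>>0. \<exists>C\<ge>0. \<forall>u\<in>{a..b}. \<forall>v\<in>{a..b}.
       \<bar>u - x\<bar> < \<delta> \<longrightarrow> \<bar>v - x\<bar> < \<delta> \<longrightarrow> d (\<gamma> u) (\<gamma> v) \<le> C * d' (\<gamma>' u) (\<gamma>' v)"
  shows "has_speed_bound d \<gamma> a b"
proof (rule has_speed_boundI_local[OF ab S])
  fix x assume "x \<in> {a..b}"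
  from loc[OF this] obtain \<delta> C where "\<delta> > 0" "C \<ge> 0" and
    le: "\<And>u v. \<lbrakk>u \<in> {a..b}; v \<in> {a..b}; \<bar>u - x\<bar> < \<delta>; \<bar>v - x\<bar> < \<delta>\<rbrakk>
      \<Longrightarrow> d (\<gamma> u) (\<gamma> v) \<le> C * d' (\<gamma>' u) (\<gamma>' v)"
    by metis
  have "has_speed_bound d \<gamma> s t" if st: "a \<le> s" "s \<le> x" "x \<le> t" "t \<le> b" "t - s < \<delta>" for s t
    using has_speed_bound_subinterval[OF bd st(1,4)] \<open>C \<ge> 0\<close>
    by (rule has_speed_bound_scaled_mono) (use st in \<open>auto intro!: le\<close>)
  then show "\<exists>e>0. \<forall>s t. a \<le> s \<longrightarrow> s \<le> x \<longrightarrow> x \<le> t \<longrightarrow> t \<le> b \<longrightarrow> t - s < e \<longrightarrow>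
      has_speed_bound d \<gamma> s t"
    using \<open>\<delta> > 0\<close> by (intro exI[of _ \<delta>]) simp
qed

lemma asym_dist_dist: "asym_dist dist UNIV"
  by unfold_locales (auto simp: dist_triangle)

section \<open>Local comparison of the Finsler distance with coordinates\<close>

context finsler_manifold
begin

lemma finsler_dist_chart_bounds:
  assumes c: "c \<in> A" and p: "p \<in> fst c"
  obtains r m M where "r > 0" "m > 0" "M > 0"
    "\<And>q q'. \<lbrakk>q \<in> fst c; q' \<in> fst c; snd c q \<in> ball (snd c p) r; snd c q' \<in> ball (snd c p) r\<rbrakk>
       \<Longrightarrow> m * dist (snd c q) (snd c q') \<le> dF q q' \<and> dF q q' \<le> M * dist (snd c q) (snd c q')"
proof -
  obtain r m M where r: "r > 0" "m > 0" "M > 0" "cball (snd c p) r \<subseteq> snd c ` fst c"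
    and m: "\<And>x y. x \<in> cball (snd c p) r \<Longrightarrow> m * norm y \<le> LE c (x, y)"
    and M: "\<And>x y. x \<in> cball (snd c p) r \<Longrightarrow> LE c (x, y) \<le> M * norm y"
    using chart_ball[OF c p] by metis
  \<comment> \<open>In the ball of radius \<open>r/3\<close> two points differ by less than
    \<open>2 * r / 3\<close>, while the gap from \<open>q\<close> to the sphere of radius
    \<open>r\<close> exceeds it. If the distance is too large for
    \<open>finsler_dist_chart_ge\<close>, the lower bound therefore holds anyway.\<close>
  have "m * dist (snd c q) (snd c q') \<le> dF q q' \<and> dF q q' \<le> M * dist (snd c q) (snd c q')"
    if q: "q \<in> fst c" "q' \<in> fst c" "snd c q \<in> ball (snd c p) (r/3)" "snd c q' \<in> ball (snd c p) (r/3)"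
    for q q'
  proof
    have qX: "q' \<in> topspace X" using q chart_subset[OF c] by blast
    have n: "norm (snd c q - snd c p) < r / 3" "norm (snd c q' - snd c p) < r / 3"
      using q by (auto simp: dist_norm norm_minus_commute)
    have in_r: "snd c q \<in> cball (snd c p) r" "snd c q' \<in> cball (snd c p) r"
      using q r(1) by auto
    show "dF q q' \<le> M * dist (snd c q) (snd c q')"
      using finsler_dist_chart_le[OF c q(1,2) r(4) in_r M] by (simp add: dist_norm norm_minus_commute)
    show "m * dist (snd c q) (snd c q') \<le> dF q q'"
    proof (cases "dF q q' < m * (r - norm (snd c q - snd c p))")
      case True
      then show ?thesis
        using finsler_dist_chart_ge(3)[OF c q(1) qX r(2,4) m] by (simp add: dist_norm norm_minus_commute)
    next
      case False
      have "norm (snd c q - snd c q') \<le> norm (snd c q - snd c p) + norm (snd c q' - snd c p)"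
        using norm_triangle_ineq4[of "snd c q - snd c p" "snd c q' - snd c p"] by simp
      then have "m * dist (snd c q) (snd c q') \<le> m * (r - norm (snd c q - snd c p))"
        using n r(2) by (intro mult_left_mono) (auto simp: dist_norm)
      then show ?thesis using False by simp
    qed
  qed
  then show thesis using that[of "r/3" m M] r by simp
qed

text \<open>The cost \<open>m * r\<close> of leaving a small coordinate ball is the same in both
  directions, so smallness of either distance suffices. A curve with a bound in one direction of
  time offers no more than that.\<close>

lemma finsler_dist_small_imp_chart_near:
  assumes c: "c \<in> A" and p: "p \<in> fst c" and \<rho>: "\<rho> > 0"
  obtains e where "e > 0" "\<And>q. \<lbrakk>q \<in> topspace X; dF p q < e \<or> dF q p < e\<rbrakk>
    \<Longrightarrow> q \<in> fst c \<and> dist (snd c q) (snd c p) < \<rho>"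
proof -
  obtain r0 m M where r0: "r0 > 0" "m > 0" "cball (snd c p) r0 \<subseteq> snd c ` fst c"
    and m0: "\<And>x y. x \<in> cball (snd c p) r0 \<Longrightarrow> m * norm y \<le> LE c (x, y)"
    using chart_ball[OF c p] by metis
  define r where "r = min r0 \<rho>"
  have sub: "cball (snd c p) r \<subseteq> cball (snd c p) r0" by (auto simp: r_def)
  have r: "r > 0" "cball (snd c p) r \<subseteq> snd c ` fst c" using r0 \<rho> sub by (auto simp: r_def)
  have m: "m * norm y \<le> LE c (x, y)" if "x \<in> cball (snd c p) r" for x y using m0 sub that by blast
  show thesis
  proof (rule that[of "m * r"])
    fix q assume q: "q \<in> topspace X" "dF p q < m * r \<or> dF q p < m * r"
    then have d: "dF p q < m * (r - norm (snd c p - snd c p)) \<or> dF q p < m * (r - norm (snd c p - snd c p))"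
      by simp
    from finsler_dist_chart_ge(1,2)[OF c p q(1) r0(2) r(2) m d]
    show "q \<in> fst c \<and> dist (snd c q) (snd c p) < \<rho>" by (auto simp: r_def dist_commute)
  qed (use r r0 in simp)
qed

lemma continuous_map_chartI:
  fixes \<gamma> :: "real \<Rightarrow> 'a"
  assumes \<gamma>: "\<gamma> ` I \<subseteq> topspace X"
    and near: "\<And>x c \<rho>. \<lbrakk>x \<in> I; c \<in> A; \<gamma> x \<in> fst c; \<rho> > 0\<rbrakk> \<Longrightarrow>
      \<exists>\<delta>>0. \<forall>y\<in>I. \<bar>y - x\<bar> < \<delta> \<longrightarrow> \<gamma> y \<in> fst c \<and> dist (snd c (\<gamma> y)) (snd c (\<gamma> x)) < \<rho>"
  shows "continuous_map (top_of_set I) X \<gamma>"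
  unfolding continuous_map_def
proof (intro conjI allI impI)
  show "\<gamma> \<in> topspace (top_of_set I) \<rightarrow> topspace X" using \<gamma> by auto
  fix U assume U: "openin X U"
  have "\<exists>T. openin (top_of_set I) T \<and> x \<in> T \<and> T \<subseteq> {x \<in> topspace (top_of_set I). \<gamma> x \<in> U}"
    if x: "x \<in> I" "\<gamma> x \<in> U" for x
  proof -
    obtain c where c: "c \<in> A" "\<gamma> x \<in> fst c" using cover \<gamma> x by blast
    have "snd c (\<gamma> x) \<in> snd c ` (fst c \<inter> U)" using c x by blast
    then obtain \<rho> where \<rho>: "\<rho> > 0" "ball (snd c (\<gamma> x)) \<rho> \<subseteq> snd c ` (fst c \<inter> U)"
      using chart_image_open[OF c(1) U] open_contains_ball by blast
    obtain \<delta> where \<delta>: "\<delta> > 0"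
      "\<And>y. \<lbrakk>y \<in> I; \<bar>y - x\<bar> < \<delta>\<rbrakk> \<Longrightarrow> \<gamma> y \<in> fst c \<and> dist (snd c (\<gamma> y)) (snd c (\<gamma> x)) < \<rho>"
      using near[OF x(1) c \<rho>(1)] by blast
    have "\<gamma> y \<in> U" if y: "y \<in> I \<inter> ball x \<delta>" for y
    proof -
      have *: "\<gamma> y \<in> fst c" "dist (snd c (\<gamma> y)) (snd c (\<gamma> x)) < \<rho>"
        using \<delta>(2)[of y] y by (auto simp: dist_real_def)
      then have "snd c (\<gamma> y) \<in> ball (snd c (\<gamma> x)) \<rho>" by (simp add: dist_commute)
      then obtain q where "q \<in> fst c" "q \<in> U" "snd c (\<gamma> y) = snd c q" using \<rho>(2) by blast
      then show ?thesis using inj_onD[OF chart_inj[OF c(1)]] *(1) by metis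
    qed
    moreover have "openin (top_of_set I) (I \<inter> ball x \<delta>)" by (simp add: openin_open_Int)
    moreover have "x \<in> I \<inter> ball x \<delta>" using x \<delta> by simp
    ultimately show ?thesis by (intro exI[of _ "I \<inter> ball x \<delta>"]) auto
  qed
  then show "openin (top_of_set I) {x \<in> topspace (top_of_set I). \<gamma> x \<in> U}"
    by (subst openin_subopen) auto
qed

lemma continuous_map_chartD:
  fixes \<gamma> :: "real \<Rightarrow> 'a"
  assumes \<gamma>: "continuous_map (top_of_set I) X \<gamma>" and x: "x \<in> I" and c: "c \<in> A" "\<gamma> x \<in> fst c"
    and \<rho>: "\<rho> > 0"
  obtains \<delta> where "\<delta> > 0"
    "\<And>y. \<lbrakk>y \<in> I; \<bar>y - x\<bar> < \<delta>\<rbrakk> \<Longrightarrow> \<gamma> y \<in> fst c \<and> snd c (\<gamma> y) \<in> ball (snd c (\<gamma> x)) \<rho>"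
proof -
  let ?W = "{p \<in> fst c. snd c p \<in> ball (snd c (\<gamma> x)) \<rho>}"
  have "openin X ?W" by (intro chart_preimage_openin c) auto
  then have "openin (top_of_set I) {y \<in> topspace (top_of_set I). \<gamma> y \<in> ?W}"
    using \<gamma> by (rule openin_continuous_map_preimage[rotated])
  then obtain T where T: "open T" "{y \<in> I. \<gamma> y \<in> ?W} = I \<inter> T"
    unfolding openin_open by auto
  have "x \<in> {y \<in> I. \<gamma> y \<in> ?W}" using x c \<rho> by simp
  then have "x \<in> T" using T(2) by blast
  then obtain \<delta> where \<delta>: "\<delta> > 0" "ball x \<delta> \<subseteq> T" using T(1) open_contains_ball by blast
  have "y \<in> {y \<in> I. \<gamma> y \<in> ?W}" if "y \<in> I" "\<bar>y - x\<bar> < \<delta>" for y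
  proof -
    have "y \<in> ball x \<delta>" using that by (simp add: dist_real_def abs_minus_commute)
    then show ?thesis unfolding T(2) using \<delta>(2) that by blast
  qed
  then show thesis using that[OF \<delta>(1)] by blast
qed

text \<open>On each side of \<open>x\<close> one of the two distances between \<gamma>(x) and
  \<gamma>(y) is small, which one depending on the side and on the kind of bound. Either forces
  closeness in the chart.\<close>

lemma speed_bound_continuous_map:
  assumes \<gamma>: "\<gamma> ` {a..b} \<subseteq> topspace X"
    and bd: "has_speed_bound dF \<gamma> a b \<or> has_speed_bound (\<lambda>p q. dF q p) \<gamma> a b"
  shows "continuous_map (top_of_set {a..b}) X \<gamma>"
proof (rule continuous_map_chartI[OF \<gamma>])
  fix x c and \<rho> :: real assume x: "x \<in> {a..b}" and c: "c \<in> A" "\<gamma> x \<in> fst c" and "\<rho> > 0"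
  obtain e where e: "e > 0" "\<And>q. \<lbrakk>q \<in> topspace X; dF (\<gamma> x) q < e \<or> dF q (\<gamma> x) < e\<rbrakk>
    \<Longrightarrow> q \<in> fst c \<and> dist (snd c q) (snd c (\<gamma> x)) < \<rho>"
    using finsler_dist_small_imp_chart_near[OF c \<open>\<rho> > 0\<close>] by metis
  from bd have "\<exists>\<delta>>0. \<forall>y\<in>{a..b}. \<bar>y - x\<bar> < \<delta> \<longrightarrow> dF (\<gamma> x) (\<gamma> y) < e \<or> dF (\<gamma> y) (\<gamma> x) < e"
  proof
    assume "has_speed_bound dF \<gamma> a b"
    from has_speed_bound_tendsto[OF this x e(1)] show ?thesis by (meson linear)
  next
    assume "has_speed_bound (\<lambda>p q. dF q p) \<gamma> a b"
    from has_speed_bound_tendsto[OF this x e(1)] show ?thesis by (meson linear)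
  qed
  then obtain \<delta> where "\<delta> > 0" and
    \<delta>: "\<forall>y\<in>{a..b}. \<bar>y - x\<bar> < \<delta> \<longrightarrow> dF (\<gamma> x) (\<gamma> y) < e \<or> dF (\<gamma> y) (\<gamma> x) < e" by blast
  have "\<gamma> y \<in> fst c \<and> dist (snd c (\<gamma> y)) (snd c (\<gamma> x)) < \<rho>" if "y \<in> {a..b}" "\<bar>y - x\<bar> < \<delta>" for y
    using e(2)[of "\<gamma> y"] \<delta> that \<gamma> by blast
  then show "\<exists>\<delta>>0. \<forall>y\<in>{a..b}. \<bar>y - x\<bar> < \<delta> \<longrightarrow>
      \<gamma> y \<in> fst c \<and> dist (snd c (\<gamma> y)) (snd c (\<gamma> x)) < \<rho>"
    using \<open>\<delta> > 0\<close> by blast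
qed

lemma continuous_curve_comparison:
  fixes \<gamma> :: "real \<Rightarrow> 'a"
  assumes \<gamma>: "continuous_map (top_of_set I) X \<gamma>" and x: "x \<in> I" and c: "c \<in> A" "\<gamma> x \<in> fst c"
  obtains \<delta> m M where "\<delta> > 0" "m > 0" "M > 0" "\<And>u. \<lbrakk>u \<in> I; \<bar>u - x\<bar> < \<delta>\<rbrakk> \<Longrightarrow> \<gamma> u \<in> fst c"
    "\<And>u v. \<lbrakk>u \<in> I; v \<in> I; \<bar>u - x\<bar> < \<delta>; \<bar>v - x\<bar> < \<delta>\<rbrakk> \<Longrightarrow>
       m * dist (snd c (\<gamma> u)) (snd c (\<gamma> v)) \<le> dF (\<gamma> u) (\<gamma> v) \<and>
       dF (\<gamma> u) (\<gamma> v) \<le> M * dist (snd c (\<gamma> u)) (snd c (\<gamma> v))"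
proof -
  obtain r m M where r: "r > 0" "m > 0" "M > 0"
    and b: "\<And>q q'. \<lbrakk>q \<in> fst c; q' \<in> fst c; snd c q \<in> ball (snd c (\<gamma> x)) r; snd c q' \<in> ball (snd c (\<gamma> x)) r\<rbrakk>
       \<Longrightarrow> m * dist (snd c q) (snd c q') \<le> dF q q' \<and> dF q q' \<le> M * dist (snd c q) (snd c q')"
    using finsler_dist_chart_bounds[OF c] by metis
  obtain \<delta> where "\<delta> > 0"
    "\<And>y. \<lbrakk>y \<in> I; \<bar>y - x\<bar> < \<delta>\<rbrakk> \<Longrightarrow> \<gamma> y \<in> fst c \<and> snd c (\<gamma> y) \<in> ball (snd c (\<gamma> x)) r"
    using continuous_map_chartD[OF \<gamma> x c r(1)] by metis
  then show thesis using that[of \<delta> m M] r b by simp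
qed

text \<open>Both distances are locally comparable with the symmetric coordinate distance, and hence
  with each other with constant \<open>M / m\<close>.\<close>

lemma speed_bound_reverse:
  assumes ab: "a \<le> b" and \<gamma>: "continuous_map (top_of_set {a..b}) X \<gamma>"
  shows "has_speed_bound dF \<gamma> a b \<longleftrightarrow> has_speed_bound (\<lambda>p q. dF q p) \<gamma> a b"
proof -
  interpret d: asym_dist dF "topspace X" by (rule asym_dist_finsler)
  interpret d': asym_dist "\<lambda>p q. dF q p" "topspace X" by (rule d.flip)
  have img: "\<gamma> ` {a..b} \<subseteq> topspace X" using continuous_map_image_subset_topspace[OF \<gamma>] by simp
  have loc: "\<exists>\<delta>>0. \<exists>C\<ge>0. \<forall>u\<in>{a..b}. \<forall>v\<in>{a..b}.
       \<bar>u - x\<bar> < \<delta> \<longrightarrow> \<bar>v - x\<bar> < \<delta> \<longrightarrow> dF (\<gamma> u) (\<gamma> v) \<le> C * dF (\<gamma> v) (\<gamma> u)" if x: "x \<in> {a..b}" for x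
  proof -
    obtain c where c: "c \<in> A" "\<gamma> x \<in> fst c" using cover img x by blast
    obtain \<delta> m M where "\<delta> > 0" and mM: "m > 0" "M > 0" and
      b: "\<And>u v. \<lbrakk>u \<in> {a..b}; v \<in> {a..b}; \<bar>u - x\<bar> < \<delta>; \<bar>v - x\<bar> < \<delta>\<rbrakk> \<Longrightarrow>
       m * dist (snd c (\<gamma> u)) (snd c (\<gamma> v)) \<le> dF (\<gamma> u) (\<gamma> v) \<and>
       dF (\<gamma> u) (\<gamma> v) \<le> M * dist (snd c (\<gamma> u)) (snd c (\<gamma> v))"
      using continuous_curve_comparison[OF \<gamma> x c] by metis
    have "dF (\<gamma> u) (\<gamma> v) \<le> (M / m) * dF (\<gamma> v) (\<gamma> u)"
      if uv: "u \<in> {a..b}" "v \<in> {a..b}" "\<bar>u - x\<bar> < \<delta>" "\<bar>v - x\<bar> < \<delta>" for u v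
    proof -
      let ?D = "dist (snd c (\<gamma> u)) (snd c (\<gamma> v))"
      have "?D \<le> dF (\<gamma> v) (\<gamma> u) / m"
        using b[OF uv(2,1,4,3)] mM by (simp add: field_simps dist_commute)
      then have "M * ?D \<le> M * (dF (\<gamma> v) (\<gamma> u) / m)" using mM by (intro mult_left_mono) auto
      then show ?thesis using b[OF uv] by simp
    qed
    moreover have "0 \<le> M / m" using mM by simp
    ultimately show ?thesis using \<open>\<delta> > 0\<close> by blast
  qed
  show ?thesis
  proof
    assume "has_speed_bound dF \<gamma> a b"
    then show "has_speed_bound (\<lambda>p q. dF q p) \<gamma> a b"
      by (rule d'.has_speed_bound_transfer[OF ab img]) (use loc in blast)
  next
    assume "has_speed_bound (\<lambda>p q. dF q p) \<gamma> a b"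
    then show "has_speed_bound dF \<gamma> a b"
      by (rule d.has_speed_bound_transfer[OF ab img]) (use loc in blast)
  qed
qed

text \<open>From left to right the constant is \<open>1 / m\<close>, applied at all points of an
  interval mapped into one chart. From right to left it is \<open>M\<close>, in a chart chosen at
  each point, and the local bounds are glued.\<close>

lemma speed_bound_iff_charts:
  assumes ab: "a \<le> b" and \<gamma>: "continuous_map (top_of_set {a..b}) X \<gamma>"
  shows "has_speed_bound dF \<gamma> a b \<longleftrightarrow>
    (\<forall>c\<in>A. \<forall>s t. {s..t} \<subseteq> {r \<in> {a..b}. \<gamma> r \<in> fst c} \<longrightarrow> abs_cont_wrt dist {s..t} (snd c \<circ> \<gamma>))"
    (is "?L \<longleftrightarrow> ?R")
proof
  interpret d: asym_dist dF "topspace X" by (rule asym_dist_finsler)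
  interpret e: asym_dist "dist :: real ^ 'n \<Rightarrow> real ^ 'n \<Rightarrow> real" UNIV by (rule asym_dist_dist)
  have img: "\<gamma> ` {a..b} \<subseteq> topspace X" using continuous_map_image_subset_topspace[OF \<gamma>] by simp
  {
    assume L: ?L
    show ?R
    proof (intro ballI allI impI)
      fix c s t assume c: "c \<in> A" and sub: "{s..t} \<subseteq> {r \<in> {a..b}. \<gamma> r \<in> fst c}"
      have "has_speed_bound dist (snd c \<circ> \<gamma>) s t"
      proof (cases "s \<le> t")
        case True
        have st: "a \<le> s" "t \<le> b" using sub True by auto
        show ?thesis
        proof (rule e.has_speed_bound_transfer[OF True _ has_speed_bound_subinterval[OF L st]])
          fix x assume x: "x \<in> {s..t}"
          then have x': "x \<in> {a..b}" "\<gamma> x \<in> fst c" using sub by auto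
          obtain \<delta> m where \<delta>: "\<delta> > 0" "m > 0" and
            b: "\<And>u v. \<lbrakk>u \<in> {a..b}; v \<in> {a..b}; \<bar>u - x\<bar> < \<delta>; \<bar>v - x\<bar> < \<delta>\<rbrakk> \<Longrightarrow>
              m * dist (snd c (\<gamma> u)) (snd c (\<gamma> v)) \<le> dF (\<gamma> u) (\<gamma> v)"
            using continuous_curve_comparison[OF \<gamma> x'(1) c x'(2)] by metis
          have "dist ((snd c \<circ> \<gamma>) u) ((snd c \<circ> \<gamma>) v) \<le> (1 / m) * dF (\<gamma> u) (\<gamma> v)"
            if "u \<in> {s..t}" "v \<in> {s..t}" "\<bar>u - x\<bar> < \<delta>" "\<bar>v - x\<bar> < \<delta>" for u v
            using b[of u v] that st \<delta> by (simp add: field_simps)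
          moreover have "0 \<le> 1 / m" using \<delta> by simp
          ultimately show "\<exists>\<delta>>0. \<exists>C\<ge>0. \<forall>u\<in>{s..t}. \<forall>v\<in>{s..t}. \<bar>u - x\<bar> < \<delta> \<longrightarrow> \<bar>v - x\<bar> < \<delta> \<longrightarrow>
              dist ((snd c \<circ> \<gamma>) u) ((snd c \<circ> \<gamma>) v) \<le> C * dF (\<gamma> u) (\<gamma> v)"
            using \<delta>(1) by blast
        qed simp
      next
        \<comment> \<open>\<open>NAC\<close> quantifies over all \<open>s\<close> and
          \<open>t\<close>, so the interval may be empty.\<close>
        case False
        then show ?thesis unfolding has_speed_bound_def by (intro exI[of _ "\<lambda>_. 0"]) auto
      qed
      then show "abs_cont_wrt dist {s..t} (snd c \<circ> \<gamma>)" by (rule has_speed_bound_imp_abs_cont_wrt)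
    qed
  }
  assume R: ?R
  show ?L
  proof (rule d.has_speed_boundI_local[OF ab img])
    fix x assume x: "x \<in> {a..b}"
    obtain c where c: "c \<in> A" "\<gamma> x \<in> fst c" using cover img x by blast
    obtain \<delta> m M where \<delta>: "\<delta> > 0" "M > 0" "\<And>u. \<lbrakk>u \<in> {a..b}; \<bar>u - x\<bar> < \<delta>\<rbrakk> \<Longrightarrow> \<gamma> u \<in> fst c" and
      b: "\<And>u v. \<lbrakk>u \<in> {a..b}; v \<in> {a..b}; \<bar>u - x\<bar> < \<delta>; \<bar>v - x\<bar> < \<delta>\<rbrakk> \<Longrightarrow>
       m * dist (snd c (\<gamma> u)) (snd c (\<gamma> v)) \<le> dF (\<gamma> u) (\<gamma> v) \<and>
       dF (\<gamma> u) (\<gamma> v) \<le> M * dist (snd c (\<gamma> u)) (snd c (\<gamma> v))"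
      using continuous_curve_comparison[OF \<gamma> x c] by metis
    have "has_speed_bound dF \<gamma> s t" if st: "a \<le> s" "s \<le> x" "x \<le> t" "t \<le> b" "t - s < \<delta>" for s t
    proof -
      have near: "\<bar>u - x\<bar> < \<delta>" if "u \<in> {s..t}" for u using that st by auto
      have "{s..t} \<subseteq> {r \<in> {a..b}. \<gamma> r \<in> fst c}" using \<delta>(3) near st by auto
      then have "abs_cont_wrt dist {s..t} (snd c \<circ> \<gamma>)" using R c(1) by blast
      then have "has_speed_bound dist (snd c \<circ> \<gamma>) s t"
        using e.abs_cont_wrt_iff_has_speed_bound[of s t "snd c \<circ> \<gamma>"] st by simp
      then show ?thesis
      proof (rule has_speed_bound_scaled_mono)
        show "dF (\<gamma> u) (\<gamma> v) \<le> M * dist ((snd c \<circ> \<gamma>) u) ((snd c \<circ> \<gamma>) v)"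
          if "s \<le> u" "u \<le> v" "v \<le> t" for u v
          using b[of u v] near[of u] near[of v] that st by simp
      qed (use \<delta> in simp)
    qed
    then show "\<exists>e>0. \<forall>s t. a \<le> s \<longrightarrow> s \<le> x \<longrightarrow> x \<le> t \<longrightarrow> t \<le> b \<longrightarrow> t - s < e \<longrightarrow>
      has_speed_bound dF \<gamma> s t"
      using \<delta>(1) by (intro exI[of _ \<delta>]) simp
  qed
qed

end

section \<open>The classes of curves in terms of one bound\<close>

lemma has_speed_bound_iff_absolutely_integrable:
  "has_speed_bound d \<gamma> a b \<longleftrightarrow>
     (\<exists>f::real \<Rightarrow> real. f absolutely_integrable_on {a..b} \<and> (\<forall>s\<in>{a..b}. 0 \<le> f s) \<and>
        (\<forall>t\<^sub>1\<in>{a..b}. \<forall>t\<^sub>2\<in>{a..b}. t\<^sub>1 \<le> t\<^sub>2 \<longrightarrow> d (\<gamma> t\<^sub>1) (\<gamma> t\<^sub>2) \<le> integral {t\<^sub>1..t\<^sub>2} f))"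
proof -
  have i1: "f absolutely_integrable_on {a..b} \<longleftrightarrow> f integrable_on {a..b}"
    if "\<forall>s\<in>{a..b}. 0 \<le> f s" for f :: "real \<Rightarrow> real"
    using nonnegative_absolutely_integrable_1[of f "{a..b}"] that
      set_lebesgue_integral_eq_integral(1)[of "{a..b}" f] by auto
  have i2: "(\<forall>t\<^sub>1\<in>{a..b}. \<forall>t\<^sub>2\<in>{a..b}. t\<^sub>1 \<le> t\<^sub>2 \<longrightarrow> d (\<gamma> t\<^sub>1) (\<gamma> t\<^sub>2) \<le> integral {t\<^sub>1..t\<^sub>2} f) \<longleftrightarrow>
      (\<forall>u v. a \<le> u \<longrightarrow> u \<le> v \<longrightarrow> v \<le> b \<longrightarrow> d (\<gamma> u) (\<gamma> v) \<le> integral {u..v} f)" for f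
    by (auto simp: Ball_def)
  show ?thesis
    unfolding has_speed_bound_def i2 by (intro ex_cong1) (use i1 in blast)
qed

theorem theorem3p2:
  fixes X :: "'a topology" and A :: "('a, 'n::finite) chart set"
    and F :: "'a \<times> ('a, 'n) tvec \<Rightarrow> real" and a b :: real
  assumes "finsler_manifold X A F" and "a \<le> b"
  shows "NAC X A {a..b} = MAC X A F {a..b} \<and>
         MAC X A F {a..b} = AC X A F {a..b} \<and>
         AC X A F {a..b} = FAC X A F {a..b} \<and>
         FAC X A F {a..b} = BAC X A F {a..b}"
proof -
  interpret finsler_manifold X A F by fact
  interpret d: asym_dist dF "topspace X" by (rule asym_dist_finsler)
  let ?E = "{a..b} \<rightarrow>\<^sub>E topspace X"
  have img: "\<gamma> ` {a..b} \<subseteq> topspace X" if "\<gamma> \<in> ?E" for \<gamma> using that by auto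
  have FAC: "FAC X A F {a..b} = {\<gamma> \<in> ?E. has_speed_bound dF \<gamma> a b}"
    unfolding FAC_def has_speed_bound_iff_absolutely_integrable ..
  have "BAC X A F {a..b} = {\<gamma> \<in> ?E. has_speed_bound (\<lambda>p q. dF q p) \<gamma> a b}"
    unfolding BAC_def has_speed_bound_iff_absolutely_integrable ..
  \<comment> \<open>Either bound makes the curve continuous, which is what the reversal
    requires.\<close>
  also have "\<dots> = {\<gamma> \<in> ?E. has_speed_bound dF \<gamma> a b}"
    using speed_bound_reverse[OF assms(2)] speed_bound_continuous_map[OF img] by blast
  finally have BAC: "BAC X A F {a..b} = {\<gamma> \<in> ?E. has_speed_bound dF \<gamma> a b}" .
  have MAC: "MAC X A F {a..b} = {\<gamma> \<in> ?E. has_speed_bound dF \<gamma> a b}"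
    unfolding MAC_def using d.abs_cont_wrt_iff_has_speed_bound[OF assms(2) img] by blast
  \<comment> \<open>Continuity is part of \<open>NAC\<close>; in the other direction it is recovered
    from the bound.\<close>
  have NAC: "NAC X A {a..b} = {\<gamma> \<in> ?E. has_speed_bound dF \<gamma> a b}"
    unfolding NAC_def using speed_bound_iff_charts[OF assms(2)] speed_bound_continuous_map[OF img]
    by blast
  show ?thesis unfolding AC_def FAC BAC MAC NAC by blast
qed

end
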